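(* Let $F=\mathbb{R}$ or $F=\mathbb{C}$. Every $3$-dimensional Novikov algebra over $F$ whose associated Lie algebra is non-abelian is isomorphic to an algebra in the following list. Each algebra has a basis $e_1,e_2,e_3$; only the nonzero products are listed (all products $e_ie_j$ not listed are zero); the parameters $a,\alpha$ range over $F$. Associated Lie algebra $\mathfrak{g}_1$: - $N^{\mathfrak{g}_1}_1(a)$: $e_1e_1=ae_1$, $e_1e_2=(a+1)e_2$, $e_1e_3=(a+1)e_3$, $e_2e_1=ae_2$, $e_3e_1=ae_3$. - $N^{\mathfrak{g}_1}_2$: $e_1e_1=-e_1+e_2$, $e_2e_1=-e_2$, $e_3e_1=-e_3$. Associated Lie algebra $\mathfrak{g}_2^\alpha$, for arbitrary $\alpha\in F$: - $N^{\mathfrak{g}_2^\alpha}_1(a)$: $e_1e_1=ae_1$, $e_1e_2=ae_2+e_3$, $e_1e_3=\alpha e_2+(a+1)e_3$, $e_2e_1=ae_2$, $e_3e_1=ae_3$. - for each $a\in F$ with $a^2+a=\alpha$, $N^{\mathfrak{g}_2^{a^2+a}}_2(a)$: $e_1e_1=ae_1+e_2$, $e_1e_2=ae_2+e_3$, $e_1e_3=(a^2+a)e_2+(a+1)e_3$, $e_2e_1=ae_2$, $e_3e_1=ae_3$. In addition, for $\alpha=-\tfrac29$ (associated Lie algebra $\mathfrak{g}=\mathfrak{g}_2^{-2/9}$): - $N^{\mathfrak{g}}_3$: $e_1e_1=-\tfrac13e_1$, $e_1e_2=\tfrac83e_2-8e_3$, $e_1e_3=\tfrac79e_2-\tfrac73e_3$,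 $e_2e_1=\tfrac83e_2-9e_3$, $e_3e_1=e_2-\tfrac{10}{3}e_3$. - $N^{\mathfrak{g}}_4$: $e_1e_1=-\tfrac13e_1+e_2$, $e_1e_2=\tfrac83e_2-8e_3$, $e_1e_3=\tfrac79e_2-\tfrac73e_3$, $e_2e_1=\tfrac83e_2-9e_3$, $e_3e_1=e_2-\tfrac{10}{3}e_3$. - $N^{\mathfrak{g}}_5(a)$: $e_1e_1=3ae_1+(-3a^2-\tfrac13a)e_2$, $e_1e_2=6ae_2+(-9a+1)e_3$, $e_1e_3=(a-\tfrac29)e_2+e_3$, $e_2e_1=6ae_2-9ae_3$, $e_2e_2=-3e_2+9e_3$, $e_2e_3=-e_2+3e_3$, $e_3e_1=ae_2$, $e_3e_2=-e_2+3e_3$, $e_3e_3=-\tfrac13e_2+e_3$. - $N^{\mathfrak{g}}_6$: $e_1e_1=-\tfrac23e_1-\tfrac{8}{27}e_2+\tfrac23e_3$, $e_1e_2=-\tfrac43e_2+3e_3$, $e_1e_3=-\tfrac49e_2+e_3$, $e_2e_1=-\tfrac43e_2+2e_3$, $e_2e_2=-3e_2+9e_3$, $e_2e_3=-e_2+3e_3$, $e_3e_1=-\tfrac29e_2$, $e_3e_2=-e_2+3e_3$, $e_3e_3=-\tfrac13e_2+e_3$. - $N^{\mathfrak{g}}_7$: $e_1e_1=-\tfrac23e_1-\tfrac{11}{27}e_2+e_3$, $e_1e_2=-\tfrac43e_2+3e_3$, $e_1e_3=-\tfrac49e_2+e_3$, $e_2e_1=-\tfrac43e_2+2e_3$, $e_2e_2=-3e_2+9e_3$,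 $e_2e_3=-e_2+3e_3$, $e_3e_1=-\tfrac29e_2$, $e_3e_2=-e_2+3e_3$, $e_3e_3=-\tfrac13e_2+e_3$. In addition, for $\alpha=0$ (associated Lie algebra $\mathfrak{g}_2^0$): - $N^{\mathfrak{g}_2^0}_8(a)$ with $a\neq0$: $e_1e_1=ae_1$, $e_1e_2=(a+1)e_3$, $e_1e_3=(a+1)e_3$, $e_2e_1=ae_3$, $e_3e_1=ae_3$. - $N^{\mathfrak{g}_2^0}_9$: $e_1e_1=-e_1+e_3$, $e_2e_1=-e_3$, $e_3e_1=-e_3$. - $N^{\mathfrak{g}_2^0}_{10}(a)$: $e_1e_1=ae_1$, $e_1e_2=ae_2+e_3$, $e_1e_3=(a+1)e_3$, $e_2e_1=ae_2$, $e_2e_2=-e_2+e_3$, $e_3e_1=ae_3$. - $N^{\mathfrak{g}_2^0}_{11}$: $e_1e_1=-e_1+e_3$, $e_1e_2=-e_2+e_3$, $e_2e_1=-e_2$, $e_2e_2=-e_2+e_3$, $e_3e_1=-e_3$. Associated Lie algebra $\mathfrak{g}_3$: - $N^{\mathfrak{g}_3}_1(a)$: $e_1e_1=e_2$, $e_1e_2=(a+1)e_3$, $e_2e_1=ae_3$. - $N^{\mathfrak{g}_3}_2(a)$: $e_1e_1=ae_3$, $e_1e_2=e_3$, $e_2e_2=e_3$. - $N^{\mathfrak{g}_3}_3$: $e_1e_1=e_3$, $e_1e_2=e_1$, $e_2e_1=e_1-e_3$, $e_2e_2=e_2$, $e_2e_3=e_3$, $e_3e_2=e_3$. - $N^{\mathfrak{g}_3}_4$: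 $e_1e_2=e_1$, $e_2e_1=e_1-e_3$, $e_2e_2=e_2$, $e_2e_3=e_3$, $e_3e_2=e_3$. - $N^{\mathfrak{g}_3}_5$: $e_1e_2=\tfrac12e_3$, $e_2e_1=-\tfrac12e_3$. Associated Lie algebra $\mathfrak{g}_4$: - $N^{\mathfrak{g}_4}_1(a)$: $e_1e_1=ae_1$, $e_1e_2=ae_2+e_3$, $e_1e_3=e_2+ae_3$, $e_2e_1=ae_2$, $e_3e_1=ae_3$. - $N^{\mathfrak{g}_4}_2$: $e_1e_1=e_1+e_3$, $e_1e_2=e_2+e_3$, $e_1e_3=e_2+e_3$, $e_2e_1=e_2$, $e_3e_1=e_3$. Associated Lie algebra $\mathfrak{g}_5$: - $N^{\mathfrak{g}_5}_1(a)$: $e_1e_1=ae_1$, $e_1e_2=ae_2+e_3$, $e_1e_3=-e_2+ae_3$, $e_2e_1=ae_2$, $e_3e_1=ae_3$. Conversely, every algebra in the list is a Novikov algebra over $F$ with the indicated associated Lie algebra. If $F=\mathbb{R}$, the only isomorphisms between different members of the list are $N^{\mathfrak{g}_4}_1(a)\cong N^{\mathfrak{g}_4}_1(-a)$ and $N^{\mathfrak{g}_5}_1(a)\cong N^{\mathfrak{g}_5}_1(-a)$. If $F=\mathbb{C}$, then $N^{\mathfrak{g}_5}_1(a)\cong N^{\mathfrak{g}_4}_1(ia)$ for all $a$, and $N_7^{\mathfrak{g}}\cong N_5^{\mathfrak{g}}(-\tfrac29)$ for $\mathfrak{g}=\mathfrak{g}_2^{-2/9}$; after deleting the algebras $N^{\mathfrak{g}_5}_1(a)$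 and $N_7^{\mathfrak{g}_2^{-2/9}}$ from the list, the only isomorphisms between different members of the remaining list are $N^{\mathfrak{g}_4}_1(a)\cong N^{\mathfrak{g}_4}_1(-a)$.
   Context: A Novikov algebra over a field $F$ is an $F$-vector space $A$ with a bilinear product $(x,y)\mapsto x\cdot y$ (also written $xy$) satisfying, for all $x,y,z\in A$, $x\cdot(y\cdot z)-(x\cdot y)\cdot z=y\cdot(x\cdot z)-(y\cdot x)\cdot z$ and $(x\cdot y)\cdot z=(x\cdot z)\cdot y$. Its associated Lie algebra is the vector space $A$ with bracket $[x,y]=x\cdot y-y\cdot x$. Isomorphism means isomorphism of $F$-algebras. The $3$-dimensional Lie algebras named in the claim have basis $e_1,e_2,e_3$ and the following nonzero brackets (up to antisymmetry): $\mathfrak{g}_1$: $[e_1,e_2]=e_2$, $[e_1,e_3]=e_3$; $\mathfrak{g}_2^\alpha$ ($\alpha\in F$): $[e_1,e_2]=e_3$, $[e_1,e_3]=\alpha e_2+e_3$; $\mathfrak{g}_3$: $[e_1,e_2]=e_3$; $\mathfrak{g}_4$: $[e_1,e_2]=e_3$, $[e_1,e_3]=e_2$; $\mathfrak{g}_5$: $[e_1,e_2]=e_3$, $[e_1,e_3]=-e_2$. Over $\mathbb{C}$, $\mathfrak{g}_4\cong\mathfrak{g}_5$; there are no other isomorphisms among these Lie algebras. *)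

theory Defs
  imports "HOL-Analysis.Analysis"
begin

section \<open>Novikov algebras\<close>

locale novikov_algebra = vector_space scale
  for scale :: "'f::field \<Rightarrow> 'a::ab_group_add \<Rightarrow> 'a" +
  fixes mul :: "'a \<Rightarrow> 'a \<Rightarrow> 'a"
  assumes linear_right: "\<And>x. Vector_Spaces.linear scale scale (\<lambda>y. mul x y)"
    and linear_left: "\<And>y. Vector_Spaces.linear scale scale (\<lambda>x. mul x y)"
    and left_symmetric:
      "\<And>x y z. mul x (mul y z) - mul (mul x y) z = mul y (mul x z) - mul (mul y x) z"
    and right_commutative: "\<And>x y z. mul (mul x y) z = mul (mul x z) y"

definition commutator :: "('a::ab_group_add \<Rightarrow> 'a \<Rightarrow> 'a) \<Rightarrow> 'a \<Rightarrow> 'a \<Rightarrow> 'a" where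
  "commutator mul x y = mul x y - mul y x"

definition algebra_iso ::
  "('f::field \<Rightarrow> 'a::ab_group_add \<Rightarrow> 'a) \<Rightarrow> ('a \<Rightarrow> 'a \<Rightarrow> 'a) \<Rightarrow>
   ('f \<Rightarrow> 'b::ab_group_add \<Rightarrow> 'b) \<Rightarrow> ('b \<Rightarrow> 'b \<Rightarrow> 'b) \<Rightarrow> bool" where
  "algebra_iso scaleA mulA scaleB mulB \<longleftrightarrow>
     (\<exists>f. Vector_Spaces.linear scaleA scaleB f \<and> bij f \<and>
          (\<forall>x y. f (mulA x y) = mulB (f x) (f y)))"

section \<open>Structure constants on the standard basis\<close>

text \<open>An entry \<open>(i, j, v)\<close> stands for the product \<open>e\<^sub>i e\<^sub>j = v\<close>, where
  \<open>v = vector [v\<^sub>1, v\<^sub>2, v\<^sub>3]\<close> is \<open>v\<^sub>1 e\<^sub>1 + v\<^sub>2 e\<^sub>2 + v\<^sub>3 e\<^sub>3\<close>.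
  Products without an entry are zero.  The index \<open>3\<close> of type \<open>3\<close> is the third
  coordinate (it equals \<open>0\<close> in that type).\<close>

type_synonym 'f structure_table = "(3 \<times> 3 \<times> ('f ^ 3)) list"

definition table_product :: "'f::field structure_table \<Rightarrow> 'f ^ 3 \<Rightarrow> 'f ^ 3 \<Rightarrow> 'f ^ 3" where
  "table_product T x y = (\<Sum>(i, j, v) \<leftarrow> T. (x $ i * y $ j) *s v)"

section \<open>The Lie algebras\<close>

datatype 'f lie_name = G1 | G2 'f | G3 | G4 | G5

fun lie_table :: "'f::field lie_name \<Rightarrow> 'f structure_table" where
  "lie_table G1 =
    [(1, 2, vector [0, 1, 0]),
     (1, 3, vector [0, 0, 1])]"
| "lie_table (G2 \<alpha>) =
    [(1, 2, vector [0, 0, 1]),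
     (1, 3, vector [0, \<alpha>, 1])]"
| "lie_table G3 =
    [(1, 2, vector [0, 0, 1])]"
| "lie_table G4 =
    [(1, 2, vector [0, 0, 1]),
     (1, 3, vector [0, 1, 0])]"
| "lie_table G5 =
    [(1, 2, vector [0, 0, 1]),
     (1, 3, vector [0, -1, 0])]"

text \<open>The tables list brackets up to antisymmetry, whence the second summand.\<close>

definition lie_bracket :: "'f::field lie_name \<Rightarrow> 'f ^ 3 \<Rightarrow> 'f ^ 3 \<Rightarrow> 'f ^ 3" where
  "lie_bracket g x y = table_product (lie_table g) x y - table_product (lie_table g) y x"

section \<open>The list of Novikov algebras\<close>

text \<open>\<open>Ni_k\<close> is the \<open>k\<close>-th algebra (or family) over the Lie algebra \<open>Gi\<close>.  For \<open>N2_1\<close> and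
  \<open>N2_2\<close> the first parameter is that of \<open>G2\<close>.  The remaining \<open>N2_k\<close> belong to
  \<open>G2 (-2/9)\<close> for \<open>k \<le> 7\<close> and to \<open>G2 0\<close> for \<open>k \<ge> 8\<close>.\<close>

datatype 'f novikov_name =
    N1_1 'f | N1_2
  | N2_1 'f 'f | N2_2 'f 'f
  | N2_3 | N2_4 | N2_5 'f | N2_6 | N2_7
  | N2_8 'f | N2_9 | N2_10 'f | N2_11
  | N3_1 'f | N3_2 'f | N3_3 | N3_4 | N3_5
  | N4_1 'f | N4_2
  | N5_1 'f

text \<open>Admissible parameters; all other names denote a member of the list unconditionally.\<close>

fun listed :: "'f::field novikov_name \<Rightarrow> bool" where
  "listed (N2_2 \<alpha> a) \<longleftrightarrow> a\<^sup>2 + a = \<alpha>"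
| "listed (N2_8 a) \<longleftrightarrow> a \<noteq> 0"
| "listed _ \<longleftrightarrow> True"

fun lie_of :: "'f::field novikov_name \<Rightarrow> 'f lie_name" where
  "lie_of (N1_1 a) = G1"
| "lie_of N1_2 = G1"
| "lie_of (N2_1 \<alpha> a) = G2 \<alpha>"
| "lie_of (N2_2 \<alpha> a) = G2 \<alpha>"
| "lie_of N2_3 = G2 (-2/9)"
| "lie_of N2_4 = G2 (-2/9)"
| "lie_of (N2_5 a) = G2 (-2/9)"
| "lie_of N2_6 = G2 (-2/9)"
| "lie_of N2_7 = G2 (-2/9)"
| "lie_of (N2_8 a) = G2 0"
| "lie_of N2_9 = G2 0"
| "lie_of (N2_10 a) = G2 0"
| "lie_of N2_11 = G2 0"
| "lie_of (N3_1 a) = G3"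
| "lie_of (N3_2 a) = G3"
| "lie_of N3_3 = G3"
| "lie_of N3_4 = G3"
| "lie_of N3_5 = G3"
| "lie_of (N4_1 a) = G4"
| "lie_of N4_2 = G4"
| "lie_of (N5_1 a) = G5"

fun novikov_table :: "'f::field novikov_name \<Rightarrow> 'f structure_table" where
  "novikov_table (N1_1 a) =
    [(1, 1, vector [a, 0, 0]),
     (1, 2, vector [0, a + 1, 0]),
     (1, 3, vector [0, 0, a + 1]),
     (2, 1, vector [0, a, 0]),
     (3, 1, vector [0, 0, a])]"
| "novikov_table N1_2 =
    [(1, 1, vector [-1, 1, 0]),
     (2, 1, vector [0, -1, 0]),
     (3, 1, vector [0, 0, -1])]"
| "novikov_table (N2_1 \<alpha> a) =
    [(1, 1, vector [a, 0, 0]),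
     (1, 2, vector [0, a, 1]),
     (1, 3, vector [0, \<alpha>, a + 1]),
     (2, 1, vector [0, a, 0]),
     (3, 1, vector [0, 0, a])]"
| "novikov_table (N2_2 \<alpha> a) =
    [(1, 1, vector [a, 1, 0]),
     (1, 2, vector [0, a, 1]),
     (1, 3, vector [0, a\<^sup>2 + a, a + 1]),
     (2, 1, vector [0, a, 0]),
     (3, 1, vector [0, 0, a])]"
| "novikov_table N2_3 =
    [(1, 1, vector [-1/3, 0, 0]),
     (1, 2, vector [0, 8/3, -8]),
     (1, 3, vector [0, 7/9, -7/3]),
     (2, 1, vector [0, 8/3, -9]),
     (3, 1, vector [0, 1, -10/3])]"
| "novikov_table N2_4 =
    [(1, 1, vector [-1/3, 1, 0]),
     (1, 2, vector [0, 8/3, -8]),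
     (1, 3, vector [0, 7/9, -7/3]),
     (2, 1, vector [0, 8/3, -9]),
     (3, 1, vector [0, 1, -10/3])]"
| "novikov_table (N2_5 a) =
    [(1, 1, vector [3 * a, -3 * a\<^sup>2 - 1/3 * a, 0]),
     (1, 2, vector [0, 6 * a, -9 * a + 1]),
     (1, 3, vector [0, a - 2/9, 1]),
     (2, 1, vector [0, 6 * a, -9 * a]),
     (2, 2, vector [0, -3, 9]),
     (2, 3, vector [0, -1, 3]),
     (3, 1, vector [0, a, 0]),
     (3, 2, vector [0, -1, 3]),
     (3, 3, vector [0, -1/3, 1])]"
| "novikov_table N2_6 =
    [(1, 1, vector [-2/3, -8/27, 2/3]),
     (1, 2, vector [0, -4/3, 3]),
     (1, 3, vector [0, -4/9, 1]),
     (2, 1, vector [0, -4/3, 2]),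
     (2, 2, vector [0, -3, 9]),
     (2, 3, vector [0, -1, 3]),
     (3, 1, vector [0, -2/9, 0]),
     (3, 2, vector [0, -1, 3]),
     (3, 3, vector [0, -1/3, 1])]"
| "novikov_table N2_7 =
    [(1, 1, vector [-2/3, -11/27, 1]),
     (1, 2, vector [0, -4/3, 3]),
     (1, 3, vector [0, -4/9, 1]),
     (2, 1, vector [0, -4/3, 2]),
     (2, 2, vector [0, -3, 9]),
     (2, 3, vector [0, -1, 3]),
     (3, 1, vector [0, -2/9, 0]),
     (3, 2, vector [0, -1, 3]),
     (3, 3, vector [0, -1/3, 1])]"
| "novikov_table (N2_8 a) =
    [(1, 1, vector [a, 0, 0]),
     (1, 2, vector [0, 0, a + 1]),
     (1, 3, vector [0, 0, a + 1]),
     (2, 1, vector [0, 0, a]),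
     (3, 1, vector [0, 0, a])]"
| "novikov_table N2_9 =
    [(1, 1, vector [-1, 0, 1]),
     (2, 1, vector [0, 0, -1]),
     (3, 1, vector [0, 0, -1])]"
| "novikov_table (N2_10 a) =
    [(1, 1, vector [a, 0, 0]),
     (1, 2, vector [0, a, 1]),
     (1, 3, vector [0, 0, a + 1]),
     (2, 1, vector [0, a, 0]),
     (2, 2, vector [0, -1, 1]),
     (3, 1, vector [0, 0, a])]"
| "novikov_table N2_11 =
    [(1, 1, vector [-1, 0, 1]),
     (1, 2, vector [0, -1, 1]),
     (2, 1, vector [0, -1, 0]),
     (2, 2, vector [0, -1, 1]),
     (3, 1, vector [0, 0, -1])]"
| "novikov_table (N3_1 a) =
    [(1, 1, vector [0, 1, 0]),
     (1, 2, vector [0, 0, a + 1]),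
     (2, 1, vector [0, 0, a])]"
| "novikov_table (N3_2 a) =
    [(1, 1, vector [0, 0, a]),
     (1, 2, vector [0, 0, 1]),
     (2, 2, vector [0, 0, 1])]"
| "novikov_table N3_3 =
    [(1, 1, vector [0, 0, 1]),
     (1, 2, vector [1, 0, 0]),
     (2, 1, vector [1, 0, -1]),
     (2, 2, vector [0, 1, 0]),
     (2, 3, vector [0, 0, 1]),
     (3, 2, vector [0, 0, 1])]"
| "novikov_table N3_4 =
    [(1, 2, vector [1, 0, 0]),
     (2, 1, vector [1, 0, -1]),
     (2, 2, vector [0, 1, 0]),
     (2, 3, vector [0, 0, 1]),
     (3, 2, vector [0, 0, 1])]"
| "novikov_table N3_5 =
    [(1, 2, vector [0, 0, 1/2]),
     (2, 1, vector [0, 0, -1/2])]"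
| "novikov_table (N4_1 a) =
    [(1, 1, vector [a, 0, 0]),
     (1, 2, vector [0, a, 1]),
     (1, 3, vector [0, 1, a]),
     (2, 1, vector [0, a, 0]),
     (3, 1, vector [0, 0, a])]"
| "novikov_table N4_2 =
    [(1, 1, vector [1, 0, 1]),
     (1, 2, vector [0, 1, 1]),
     (1, 3, vector [0, 1, 1]),
     (2, 1, vector [0, 1, 0]),
     (3, 1, vector [0, 0, 1])]"
| "novikov_table (N5_1 a) =
    [(1, 1, vector [a, 0, 0]),
     (1, 2, vector [0, a, 1]),
     (1, 3, vector [0, -1, a]),
     (2, 1, vector [0, a, 0]),
     (3, 1, vector [0, 0, a])]"

definition novikov_product :: "'f::field novikov_name \<Rightarrow> 'f ^ 3 \<Rightarrow> 'f ^ 3 \<Rightarrow> 'f ^ 3" where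
  "novikov_product N = table_product (novikov_table N)"

definition isomorphic :: "'f::field novikov_name \<Rightarrow> 'f novikov_name \<Rightarrow> bool" where
  "isomorphic M N \<longleftrightarrow> algebra_iso (*s) (novikov_product M) (*s) (novikov_product N)"

end

theory Submission
  imports Defs
begin

text \<open>
  Write \<open>L\<^sub>x\<close> and \<open>R\<^sub>x\<close> for the multiplications by \<open>x\<close>.  The Novikov identities say that \<open>x \<mapsto> L\<^sub>x\<close>
  represents the Lie algebra, that the \<open>R\<^sub>x\<close> commute, and that \<open>R\<^sub>x\<^sub>y = R\<^sub>y R\<^sub>x + [L\<^sub>x, R\<^sub>y]\<close>.  Traces
  of these relations show that the Lie algebra is not perfect (\<open>commutator_functional_exists\<close>).  A
  non-perfect three-dimensional Lie algebra has a two-dimensional abelian ideal \<open>V\<close>, so the algebra is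
  \<open>F e\<^sub>1 \<oplus> V\<close>, and its Lie structure is one operator \<open>D = [e\<^sub>1, _]\<close> of the plane \<open>V\<close>, up to similarity
  and scaling; this gives the Lie algebras of the list (\<open>lie_shape_normal_form\<close>).

  Suppose \<open>D\<^sup>2 \<noteq> 0\<close>.  Then \<open>V\<close> is an ideal of the algebra (\<open>ideal_structure\<close>).  With
  \<open>e\<^sub>1 e\<^sub>1 = c e\<^sub>1 + w\<close> and \<open>u e\<^sub>1 = c u + Q u\<close>, the operator \<open>Q\<close> and the multiplications inside \<open>V\<close> satisfy
  \<open>D Q = 2 Q D\<close>: they double eigenvalues of \<open>D\<close>.  If \<open>D\<close> has no eigenvalues \<open>\<lambda>, 2 \<lambda>\<close>, only \<open>c\<close> and \<open>w\<close>
  remain.  Replacing \<open>e\<^sub>1\<close> by \<open>e\<^sub>1 + v\<close> adds \<open>(D + c) v\<close> to \<open>w\<close>, so there is one algebra for each \<open>c\<close> and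
  an exceptional one when \<open>- c\<close> is an eigenvalue of \<open>D\<close>.  For trace 1 the eigenvalues \<open>\<lambda>, 2 \<lambda>\<close> are
  \<open>1/3, 2/3\<close> or \<open>0, 1\<close> (where \<open>0\<close> is its own double), that is, \<open>\<alpha> = - 2/9\<close> or \<open>\<alpha> = 0\<close>, and the extra
  entries of \<open>Q\<close> and of the product of \<open>V\<close> account for the sporadic families.

  If \<open>D\<^sup>2 = 0\<close>, the Lie algebra is the Heisenberg algebra.  Its centre is an ideal of the algebra; the
  quotient is a commutative associative plane with a character whose double is the regular trace
  (\<open>heisenberg_structure\<close>).  The character is non-zero, or the plane is generated by a nilpotent
  element, or its product is zero and a bilinear form is left.

  An isomorphism of algebras with \<open>D\<^sup>2 \<noteq> 0\<close> preserves \<open>V\<close>, multiplies \<open>e\<^sub>1\<close> by some \<open>t\<close> modulo \<open>V\<close>, and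
  so divides \<open>D\<close> and \<open>c\<close> by \<open>t\<close>.  Together with a few basis-free properties, such as whether some
  \<open>x \<notin> V\<close> has \<open>x x \<in> F x\<close>, this separates the list (\<open>isomorphic_classification\<close>).  The fields differ
  in two places: the Lie algebras \<open>G4\<close> and \<open>G5\<close> are isomorphic if and only if \<open>- 1\<close> is a square, and the
  algebras named \<open>N2_7\<close> and \<open>N2_5 (- 2/9)\<close> if and only if \<open>- 2\<close> is.  All arguments are therefore
  given over a field of characteristic zero, with the squares that exist as hypotheses.
\<close>

section \<open>Algebras on coordinate space\<close>

abbreviation novikov3 :: "('f::field ^ 3 \<Rightarrow> 'f ^ 3 \<Rightarrow> 'f ^ 3) \<Rightarrow> bool" where
  "novikov3 \<equiv> novikov_algebra (*s)"

abbreviation iso3 :: "('f::field ^ 3 \<Rightarrow> 'f ^ 3 \<Rightarrow> 'f ^ 3) \<Rightarrow> ('f ^ 3 \<Rightarrow> 'f ^ 3 \<Rightarrow> 'f ^ 3) \<Rightarrow> bool" where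
  "iso3 m1 m2 \<equiv> algebra_iso (*s) m1 (*s) m2"

lemma vec3_eq_iff: "x = y \<longleftrightarrow> x$1 = y$1 \<and> x$2 = y$2 \<and> x$3 = y$3" for x y :: "'f ^ 3"
  by (simp add: vec_eq_iff forall_3)

lemma linear3I:
  assumes "\<And>x y. f (x + y) = f x + f y" "\<And>c x. f (c *s x) = c *s f x"
  shows "Vector_Spaces.linear (*s) (*s) (f :: 'f::field ^ 'm \<Rightarrow> 'f ^ 'n)"
  using assms by (simp add: Vector_Spaces.linear_iff vec.vector_space_axioms)

lemma algebra_iso_trans:
  "algebra_iso s1 m1 s2 m2 \<Longrightarrow> algebra_iso s2 m2 s3 m3 \<Longrightarrow> algebra_iso s1 m1 s3 m3"
  unfolding algebra_iso_def
proof (elim exE conjE)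
  fix f g
  assume "Vector_Spaces.linear s1 s2 f" "bij f" "\<forall>x y. f (m1 x y) = m2 (f x) (f y)"
    "Vector_Spaces.linear s2 s3 g" "bij g" "\<forall>x y. g (m2 x y) = m3 (g x) (g y)"
  then show "\<exists>f. Vector_Spaces.linear s1 s3 f \<and> bij f \<and> (\<forall>x y. f (m1 x y) = m3 (f x) (f y))"
    by (intro exI[of _ "g \<circ> f"]) (auto simp: bij_comp Vector_Spaces.linear_iff)
qed

lemma algebra_iso_sym:
  assumes "algebra_iso s1 m1 s2 m2" shows "algebra_iso s2 m2 s1 m1"
proof -
  from assms obtain f where f: "Vector_Spaces.linear s1 s2 f" "bij f" "\<And>x y. f (m1 x y) = m2 (f x) (f y)"
    unfolding algebra_iso_def by blast
  let ?g = "inv f"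
  have gf: "?g (f x) = x" for x using f(2) by (simp add: bij_is_inj)
  have fg: "f (?g y) = y" for y using f(2) by (simp add: bij_is_surj surj_f_inv_f)
  have "?g (x + y) = ?g x + ?g y" for x y
    using f(1) gf[of "?g x + ?g y"] by (simp add: Vector_Spaces.linear_iff fg)
  moreover have "?g (s2 c x) = s1 c (?g x)" for c x
    using f(1) gf[of "s1 c (?g x)"] by (simp add: Vector_Spaces.linear_iff fg)
  moreover have "?g (m2 x y) = m1 (?g x) (?g y)" for x y
    using gf[of "m1 (?g x) (?g y)"] by (simp add: f(3) fg)
  ultimately show ?thesis
    unfolding algebra_iso_def using f(1,2) bij_imp_bij_inv
    by (intro exI[of _ ?g]) (auto simp: Vector_Spaces.linear_iff)
qed

lemma novikov_algebra_transport:
  assumes "novikov_algebra s1 m1" and s2: "vector_space s2" and g: "Vector_Spaces.linear s2 s1 g" "inj g"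
    and m: "\<And>x y. g (m2 x y) = m1 (g x) (g y)"
  shows "novikov_algebra s2 m2"
proof -
  interpret A: novikov_algebra s1 m1 by fact
  interpret B: vector_space s2 by fact
  have add: "g (x + y) = g x + g y" and sc: "g (s2 c x) = s1 c (g x)" for x y c
    using g(1) by (auto simp: Vector_Spaces.linear_iff)
  have diff: "g (x - y) = g x - g y" for x y
    using add[of "x - y" y] by (simp add: algebra_simps)
  have A: "m1 x (y + z) = m1 x y + m1 x z" "m1 (y + z) x = m1 y x + m1 z x"
    "m1 x (s1 c y) = s1 c (m1 x y)" "m1 (s1 c y) x = s1 c (m1 y x)" for x y z c
    using A.linear_left A.linear_right by (auto simp: Vector_Spaces.linear_iff)
  have B: "m2 x (y + z) = m2 x y + m2 x z" "m2 (y + z) x = m2 y x + m2 z x"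
    "m2 x (s2 c y) = s2 c (m2 x y)" "m2 (s2 c y) x = s2 c (m2 y x)" for x y z c
    by (rule injD[OF g(2)], simp add: m add sc A)+
  show ?thesis
  proof unfold_locales
    show "m2 x (m2 y z) - m2 (m2 x y) z = m2 y (m2 x z) - m2 (m2 y x) z" for x y z
      by (rule injD[OF g(2)]) (simp add: m diff A.left_symmetric)
    show "m2 (m2 x y) z = m2 (m2 x z) y" for x y z
      by (rule injD[OF g(2)]) (simp add: m A.right_commutative)
  qed (simp_all add: Vector_Spaces.linear_iff B.vector_space_axioms B)
qed

subsection \<open>Change of frame\<close>

text \<open>Three independent vectors of a three-dimensional space form a basis, so a linear map that
  sends the standard basis to such a triple is bijective; classification by choosing a good basis
  uses isomorphisms of this form only.\<close>

definition frame :: "'f::field ^ 3 \<Rightarrow> 'f ^ 3 \<Rightarrow> 'f ^ 3 \<Rightarrow> bool" where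
  "frame b1 b2 b3 \<longleftrightarrow> (\<forall>a b c. a *s b1 + b *s b2 + c *s b3 = 0 \<longrightarrow> a = 0 \<and> b = 0 \<and> c = 0)"

definition frame_map :: "'f::field ^ 3 \<Rightarrow> 'f ^ 3 \<Rightarrow> 'f ^ 3 \<Rightarrow> 'f ^ 3 \<Rightarrow> 'f ^ 3" where
  "frame_map b1 b2 b3 x = x$1 *s b1 + x$2 *s b2 + x$3 *s b3"

lemma linear_frame_map: "Vector_Spaces.linear (*s) (*s) (frame_map b1 b2 b3)"
  by (rule linear3I) (simp_all add: frame_map_def vec_eq_iff algebra_simps)

lemma bij_frame_map:
  assumes "frame b1 b2 b3" shows "bij (frame_map b1 b2 b3)"
proof -
  have "x = 0" if "frame_map b1 b2 b3 x = 0" for x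
    using assms that unfolding frame_map_def frame_def vec3_eq_iff[of x] by (metis zero_index)
  then have "inj (frame_map b1 b2 b3)"
    using vec.linear_inj_iff_eq_0[OF linear_frame_map] by blast
  then show ?thesis
    using vec.linear_inj_imp_surj[OF linear_frame_map] by (simp add: bij_def)
qed

lemma iso3_frame:
  assumes "frame b1 b2 b3"
    and "\<And>x y. frame_map b1 b2 b3 (m2 x y) = m1 (frame_map b1 b2 b3 x) (frame_map b1 b2 b3 y)"
  shows "iso3 m1 m2"
  by (rule algebra_iso_sym) (use assms bij_frame_map linear_frame_map in \<open>unfold algebra_iso_def, blast\<close>)

lemma reframe:
  assumes "novikov3 m1" and "frame b1 b2 b3"
  obtains m2 where "novikov3 m2" "iso3 m1 m2"
    "\<And>x y. frame_map b1 b2 b3 (m2 x y) = m1 (frame_map b1 b2 b3 x) (frame_map b1 b2 b3 y)"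
proof -
  let ?g = "frame_map b1 b2 b3"
  have g: "bij ?g" by (rule bij_frame_map) fact
  define m2 where "m2 x y = inv ?g (m1 (?g x) (?g y))" for x y
  have m2: "?g (m2 x y) = m1 (?g x) (?g y)" for x y
    unfolding m2_def using g by (simp add: bij_is_surj surj_f_inv_f)
  show thesis
  proof (rule that[of m2])
    show "novikov3 m2"
    proof (rule novikov_algebra_transport)
      show "inj ?g" using g by (simp add: bij_is_inj)
    qed (fact assms(1) vec.vector_space_axioms linear_frame_map m2)+
    show "iso3 m1 m2" by (rule iso3_frame) (fact assms(2) m2)+
  qed (rule m2)
qed

lemma three_dimensional_coordinates:
  assumes A: "novikov_algebra sc mul" and dim: "vector_space.dim sc UNIV = 3"
  obtains m where "novikov3 m" "algebra_iso sc mul (*s) m"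
proof -
  interpret A: novikov_algebra sc mul by fact
  obtain B where B: "\<not> A.dependent B" "A.span B = A.span UNIV" "card B = 3"
    using dim unfolding A.dim_def
    by (metis (mono_tags, lifting) someI_ex zero_neq_numeral)
  obtain b1 b2 b3 where b: "B = {b1, b2, b3}" "b1 \<noteq> b2" "b1 \<noteq> b3" "b2 \<noteq> b3"
    using B(3) by (auto simp: card_3_iff)
  define g where "g x = sc (x$1) b1 + sc (x$2) b2 + sc (x$3) b3" for x :: "'a ^ 3"
  have lin: "Vector_Spaces.linear (*s) sc g"
    unfolding Vector_Spaces.linear_iff g_def
    by (auto simp: vec.vector_space_axioms A.vector_space_axioms A.scale_left_distrib
        A.scale_right_distrib algebra_simps)
  have sum_B: "(\<Sum>v\<in>B. sc (u v) v) = sc (u b1) b1 + sc (u b2) b2 + sc (u b3) b3" for u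
    using b by (simp add: algebra_simps)
  have "x = 0" if "g x = 0" for x
  proof -
    let ?u = "\<lambda>v. if v = b1 then x$1 else if v = b2 then x$2 else x$3"
    have "(\<Sum>v\<in>B. sc (?u v) v) = 0"
      unfolding sum_B using that b by (simp add: g_def)
    moreover have "finite B" using b(1) by simp
    ultimately have "\<forall>v\<in>B. ?u v = 0"
      using A.independentD[OF B(1) \<open>finite B\<close> subset_refl, of ?u] by blast
    then show ?thesis using b by (auto simp: vec3_eq_iff)
  qed
  then have inj: "inj g"
    using vector_space_pair.linear_inj_iff_eq_0[OF _ lin]
    by (simp add: vector_space_pair_def vec.vector_space_axioms A.vector_space_axioms)
  have "y \<in> range g" for y
  proof -
    have "y \<in> A.span B" using B(2) by simp
    then obtain u where "y = (\<Sum>v\<in>B. sc (u v) v)"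
      using A.span_finite[of B] b(1) by auto
    then have "y = g (vector [u b1, u b2, u b3])" by (simp add: sum_B g_def)
    then show ?thesis by blast
  qed
  then have "bij g" using inj by (auto simp: bij_def)
  define m where "m x y = inv g (mul (g x) (g y))" for x y
  have m: "g (m x y) = mul (g x) (g y)" for x y
    unfolding m_def using \<open>bij g\<close> by (simp add: bij_is_surj surj_f_inv_f)
  show thesis
  proof (rule that[of m])
    show "novikov3 m"
      by (rule novikov_algebra_transport[where ?s1.0 = sc and g = g])
        (fact A vec.vector_space_axioms lin inj m)+
    show "algebra_iso sc mul (*s) m"
      by (rule algebra_iso_sym) (use lin m \<open>bij g\<close> in \<open>unfold algebra_iso_def, blast\<close>)
  qed
qed

section \<open>The listed algebras are Novikov algebras\<close>

definition e1 :: "'f::field ^ 3" where "e1 = vector [1, 0, 0]"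
definition e2 :: "'f::field ^ 3" where "e2 = vector [0, 1, 0]"
definition e3 :: "'f::field ^ 3" where "e3 = vector [0, 0, 1]"

lemma e_nth [simp]:
  "e1$1 = 1" "e1$2 = 0" "e1$3 = 0" "e2$1 = 0" "e2$2 = 1" "e2$3 = 0" "e3$1 = 0" "e3$2 = 0" "e3$3 = 1"
  by (simp_all add: e1_def e2_def e3_def)

lemma linear3_eqI:
  fixes f :: "'f::field ^ 3 \<Rightarrow> 'f ^ 3"
  assumes "\<And>x y. f (x + y) = f x + f y" "\<And>c x. f (c *s x) = c *s f x"
    and "\<And>x y. g (x + y) = g x + g y" "\<And>c x. g (c *s x) = c *s g x"
    and "f e1 = g e1" "f e2 = g e2" "f e3 = g e3"
  shows "f x = g x"
proof -
  have x: "x = x$1 *s e1 + x$2 *s e2 + x$3 *s e3" by (simp add: vec3_eq_iff)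
  show ?thesis by (subst (1 2) x) (simp only: assms)
qed

text \<open>Both identities are trilinear, so it suffices to test them on basis vectors.\<close>

lemma novikov3_bilinearI:
  fixes m :: "'f::field ^ 3 \<Rightarrow> 'f ^ 3 \<Rightarrow> 'f ^ 3"
  assumes bil: "\<And>x y z. m (x + y) z = m x z + m y z" "\<And>x y z. m z (x + y) = m z x + m z y"
    "\<And>c x z. m (c *s x) z = c *s m x z" "\<And>c x z. m z (c *s x) = c *s m z x"
    and LS: "\<And>x y z. x \<in> {e1, e2, e3} \<Longrightarrow> y \<in> {e1, e2, e3} \<Longrightarrow> z \<in> {e1, e2, e3} \<Longrightarrow>
      m x (m y z) - m (m x y) z = m y (m x z) - m (m y x) z"
    and RC: "\<And>x y z. x \<in> {e1, e2, e3} \<Longrightarrow> y \<in> {e1, e2, e3} \<Longrightarrow> z \<in> {e1, e2, e3} \<Longrightarrow>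
      m (m x y) z = m (m x z) y"
  shows "novikov3 m"
proof -
  note lin = bil vector_add_ldistrib vector_ssub_ldistrib algebra_simps
  have LS1: "m x (m y z) - m (m x y) z = m y (m x z) - m (m y x) z"
    if "x \<in> {e1, e2, e3}" "y \<in> {e1, e2, e3}" for x y z
    by (rule linear3_eqI[where f = "\<lambda>z. m x (m y z) - m (m x y) z"]) ((rule LS, use that in simp, use that in simp, simp) | simp add: lin)+
  have LS2: "m x (m y z) - m (m x y) z = m y (m x z) - m (m y x) z" if "x \<in> {e1, e2, e3}" for x y z
    by (rule linear3_eqI[where f = "\<lambda>y. m x (m y z) - m (m x y) z"]) ((rule LS1, use that in simp, simp) | simp add: lin)+
  have LS3: "m x (m y z) - m (m x y) z = m y (m x z) - m (m y x) z" for x y z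
    by (rule linear3_eqI[where f = "\<lambda>x. m x (m y z) - m (m x y) z"]) ((rule LS2, simp) | simp add: lin)+
  have RC1: "m (m x y) z = m (m x z) y" if "x \<in> {e1, e2, e3}" "y \<in> {e1, e2, e3}" for x y z
    by (rule linear3_eqI[where f = "\<lambda>z. m (m x y) z"]) ((rule RC, use that in simp, use that in simp, simp) | simp add: lin)+
  have RC2: "m (m x y) z = m (m x z) y" if "x \<in> {e1, e2, e3}" for x y z
    by (rule linear3_eqI[where f = "\<lambda>y. m (m x y) z"]) ((rule RC1, use that in simp, simp) | simp add: lin)+
  have RC3: "m (m x y) z = m (m x z) y" for x y z
    by (rule linear3_eqI[where f = "\<lambda>x. m (m x y) z"]) ((rule RC2, simp) | simp add: lin)+
  show ?thesis
    by unfold_locales (auto intro!: linear3I LS3 RC3 simp: bil)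
qed

lemma table_product_bilinear:
  "table_product T (x + y) z = table_product T x z + table_product T y z"
  "table_product T z (x + y) = table_product T z x + table_product T z y"
  "table_product T (c *s x) z = c *s table_product T x z"
  "table_product T z (c *s x) = c *s table_product T z x"
  unfolding table_product_def by (induction T) (auto simp: vec_eq_iff algebra_simps)

text \<open>Each identity is antisymmetric in two of its arguments, which leaves nine instances of
  either one.\<close>

lemma novikov3_tableI:
  fixes T :: "'f::field structure_table"
  defines "m \<equiv> table_product T"
  assumes LS: "\<forall>z\<in>{e1, e2, e3}. \<forall>(x, y)\<in>{(e1, e2), (e1, e3), (e2, e3)}.
      m x (m y z) - m (m x y) z = m y (m x z) - m (m y x) z"
    and RC: "\<forall>x\<in>{e1, e2, e3}. \<forall>(y, z)\<in>{(e1, e2), (e1, e3), (e2, e3)}.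
      m (m x y) z = m (m x z) y"
  shows "novikov3 (table_product T)"
  unfolding m_def[symmetric]
proof (rule novikov3_bilinearI)
  show "m x (m y z) - m (m x y) z = m y (m x z) - m (m y x) z"
    if "x \<in> {e1, e2, e3}" "y \<in> {e1, e2, e3}" "z \<in> {e1, e2, e3}" for x y z
  proof -
    have "x = y \<or> (x, y) \<in> {(e1, e2), (e1, e3), (e2, e3)} \<or> (y, x) \<in> {(e1, e2), (e1, e3), (e2, e3)}"
      using that by auto
    then show ?thesis using bspec[OF LS that(3)] by fastforce
  qed
  show "m (m x y) z = m (m x z) y"
    if "x \<in> {e1, e2, e3}" "y \<in> {e1, e2, e3}" "z \<in> {e1, e2, e3}" for x y z
  proof -
    have "y = z \<or> (y, z) \<in> {(e1, e2), (e1, e3), (e2, e3)} \<or> (z, y) \<in> {(e1, e2), (e1, e3), (e2, e3)}"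
      using that by auto
    then show ?thesis using bspec[OF RC that(1)] by fastforce
  qed
qed (simp_all add: m_def table_product_bilinear)

lemma novikov_product_is_novikov:
  "novikov3 (novikov_product N)" for N :: "'f::field_char_0 novikov_name"
  unfolding novikov_product_def
  by (rule novikov3_tableI; cases N; simp add: table_product_def vec3_eq_iff;
      simp add: field_simps power2_eq_square)

lemma commutator_novikov_product:
  "listed N \<Longrightarrow> commutator (novikov_product N) = lie_bracket (lie_of N)" for N :: "'f::field_char_0 novikov_name"
  unfolding novikov_product_def commutator_def lie_bracket_def fun_eq_iff
  by (cases N; simp add: table_product_def vec3_eq_iff; simp add: field_simps)

section \<open>The Lie algebra of a Novikov algebra is not perfect\<close>

lemma novikov3D:
  assumes "novikov3 m"
  shows "m (x + y) z = m x z + m y z" "m z (x + y) = m z x + m z y"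
    "m (c *s x) z = c *s m x z" "m z (c *s x) = c *s m z x"
    "m (x - y) z = m x z - m y z" "m z (x - y) = m z x - m z y"
    "m 0 z = 0" "m z 0 = 0"
proof -
  interpret novikov_algebra "(*s)" m by fact
  show A: "m (x + y) z = m x z + m y z" "m z (x + y) = m z x + m z y" for x y z
    using linear_left linear_right by (auto simp: Vector_Spaces.linear_iff)
  show "m (c *s x) z = c *s m x z" "m z (c *s x) = c *s m z x"
    using linear_left linear_right by (auto simp: Vector_Spaces.linear_iff)
  show "m (x - y) z = m x z - m y z" "m z (x - y) = m z x - m z y"
    using A(1)[of "x - y" y z] A(2)[of z "x - y" y] by (simp_all add: algebra_simps)
  show "m 0 z = 0" "m z 0 = 0"
    using A(1)[of 0 0 z] A(2)[of z 0 0] by simp_all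
qed

lemma novikov3_left_symmetric:
  "novikov3 m \<Longrightarrow> m x (m y z) - m (m x y) z = m y (m x z) - m (m y x) z"
  by (rule novikov_algebra.left_symmetric)

lemma novikov3_right_commutative: "novikov3 m \<Longrightarrow> m (m x y) z = m (m x z) y"
  by (rule novikov_algebra.right_commutative)

abbreviation lin3 :: "('f::field ^ 3 \<Rightarrow> 'f ^ 3) \<Rightarrow> bool" where
  "lin3 \<equiv> Vector_Spaces.linear (*s) (*s)"

lemma lin3D: "lin3 f \<Longrightarrow> f (x + y) = f x + f y" "lin3 f \<Longrightarrow> f (c *s x) = c *s f x"
  by (auto simp: Vector_Spaces.linear_iff)

lemma lin3_expand: "f x = x$1 *s f e1 + x$2 *s f e2 + x$3 *s f e3" if "lin3 f"
proof -
  have "x = x$1 *s e1 + x$2 *s e2 + x$3 *s e3" by (simp add: vec3_eq_iff)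
  then show ?thesis using that by (metis lin3D)
qed

definition tr3 :: "('f::field ^ 3 \<Rightarrow> 'f ^ 3) \<Rightarrow> 'f" where
  "tr3 f = f e1 $ 1 + f e2 $ 2 + f e3 $ 3"

lemma tr3_add: "tr3 (\<lambda>x. f x + g x) = tr3 f + tr3 g"
  and tr3_diff: "tr3 (\<lambda>x. f x - g x) = tr3 f - tr3 g"
  by (simp_all add: tr3_def)

lemma tr3_comp_commute: "tr3 (\<lambda>x. f (g x)) = tr3 (\<lambda>x. g (f x))" if "lin3 f" "lin3 g"
  unfolding tr3_def
  by (subst (1 2 3) lin3_expand[OF that(1)], subst (4 5 6) lin3_expand[OF that(2)])
    (simp add: algebra_simps)

text \<open>In characteristic zero the traces of the first three powers determine the characteristic
  polynomial, so the next lemma is the Cayley--Hamilton theorem.\<close>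

lemma nilpotent_if_traces_zero:
  fixes f :: "'f::field_char_0 ^ 3 \<Rightarrow> 'f ^ 3"
  assumes f: "lin3 f"
    and tr: "tr3 f = 0" "tr3 (\<lambda>x. f (f x)) = 0" "tr3 (\<lambda>x. f (f (f x))) = 0"
  shows "f (f (f x)) = 0"
proof -
  obtain a11 a21 a31 a12 a22 a32 a13 a23 a33 where a:
    "f e1 = a11 *s e1 + a21 *s e2 + a31 *s e3" "f e2 = a12 *s e1 + a22 *s e2 + a32 *s e3"
    "f e3 = a13 *s e1 + a23 *s e2 + a33 *s e3"
  proof
    show "f e1 = f e1$1 *s e1 + f e1$2 *s e2 + f e1$3 *s e3" by (simp add: vec3_eq_iff)
    show "f e2 = f e2$1 *s e1 + f e2$2 *s e2 + f e2$3 *s e3" by (simp add: vec3_eq_iff)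
    show "f e3 = f e3$1 *s e1 + f e3$2 *s e2 + f e3$3 *s e3" by (simp add: vec3_eq_iff)
  qed
  have fx: "f x = vector [a11 * x$1 + a12 * x$2 + a13 * x$3, a21 * x$1 + a22 * x$2 + a23 * x$3,
      a31 * x$1 + a32 * x$2 + a33 * x$3]" for x
    unfolding lin3_expand[OF f, of x] a by (simp add: vec3_eq_iff algebra_simps)
  define t where "t = a11 + a22 + a33"
  define s where "s = a11*a22 - a12*a21 + a11*a33 - a13*a31 + a22*a33 - a23*a32"
  define d where "d = a11*(a22*a33 - a23*a32) - a12*(a21*a33 - a23*a31) + a13*(a21*a32 - a22*a31)"
  have t: "t = 0" using tr(1) by (simp add: tr3_def fx t_def)
  have "t\<^sup>2 - 2 * s = 0"
    using tr(2) by (simp add: tr3_def fx s_def t_def algebra_simps power2_eq_square)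
  then have s: "s = 0" using t by simp
  \<comment> \<open>the adjugate of \<open>f\<close>\<close>
  define g where "g x = (vector [(a22*a33 - a23*a32) * x$1 + (a13*a32 - a12*a33) * x$2 + (a12*a23 - a13*a22) * x$3,
      (a23*a31 - a21*a33) * x$1 + (a11*a33 - a13*a31) * x$2 + (a13*a21 - a11*a23) * x$3,
      (a21*a32 - a22*a31) * x$1 + (a12*a31 - a11*a32) * x$2 + (a11*a22 - a12*a21) * x$3] :: 'f ^ 3)" for x :: "'f ^ 3"
  have "f (f x) = t *s f x - s *s x + g x" for x
    by (simp add: fx g_def vec3_eq_iff s_def t_def) (simp add: algebra_simps)
  then have ff: "f (f x) = g x" for x using t s by simp
  have "f (g x) = d *s x" for x
    by (simp add: fx g_def vec3_eq_iff d_def) (simp add: algebra_simps)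
  then have fff: "f (f (f x)) = d *s x" for x by (simp add: ff)
  have "3 * d = 0" using tr(3) by (simp add: tr3_def fff)
  then show ?thesis by (simp add: fff)
qed

lemma symmetric_trilinear_zero:
  fixes f :: "'f::field_char_0 ^ 3 \<Rightarrow> 'f ^ 3 \<Rightarrow> 'f ^ 3 \<Rightarrow> 'f ^ 3"
  assumes add: "\<And>a a' b c. f (a + a') b c = f a b c + f a' b c"
    and sym: "\<And>a b c. f a b c = f b a c" "\<And>a b c. f a b c = f a c b"
    and diag: "\<And>a. f a a a = 0"
  shows "f a b c = 0"
proof -
  have add2: "f a (b + b') c = f a b c + f a b' c" for a b b' c
    using add sym(1) by metis
  have add3: "f a b (c + c') = f a b c + f a b c'" for a b c c'
    using add2 sym(2) by metis
  have *: "3 *s (f a a b + f a b b) = 0" for a b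
  proof -
    have "f (a + b) (a + b) (a + b) = f a a b + f a b a + f b a a + (f a b b + f b a b + f b b a)"
      unfolding add add2 add3 by (simp add: diag[of a] diag[of b])
    also have "\<dots> = 3 *s (f a a b + f a b b)"
      using sym(1)[of b a a] sym(2)[of a b a] sym(1)[of b a b] sym(2)[of b b a]
      by (simp add: vec_eq_iff algebra_simps)
    finally show ?thesis by (simp add: diag)
  qed
  then have 1: "f a a b + f a b b = 0" for a b
    using *[of a b] unfolding vector_mul_eq_0 by simp
  have neg: "f a b (- c) = - f a b c" for a b c
    using add3[of a b c "- c"] add3[of a b 0 0] by (simp add: eq_neg_iff_add_eq_0 add.commute)
  have neg2: "f a (- b) c = - f a b c" for a b c using neg sym(2) by metis
  have "f a b b = 0" for a b
  proof -
    have "f a b b + f a b b = 0"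
      using 1[of a b] 1[of a "- b"] by (simp add: neg neg2 algebra_simps)
    then have "2 *s f a b b = 0" by (simp add: vec_eq_iff)
    then show ?thesis by (simp add: vec_eq_iff)
  qed
  then have "f a (b + c) (b + c) = 0" "f a b b = 0" "f a c c = 0" by auto
  then have "f a b c + f a b c = 0" using sym(2)[of a b c] by (simp add: add2 add3)
  then have "2 *s f a b c = 0" by (simp add: vec_eq_iff)
  then show ?thesis by (simp add: vec_eq_iff)
qed

definition dot3 :: "'f::field ^ 3 \<Rightarrow> 'f ^ 3 \<Rightarrow> 'f" where
  "dot3 h y = h$1 * y$1 + h$2 * y$2 + h$3 * y$3"

text \<open>If every functional vanishing on commutators is zero, then so are the traces
  \<open>tr R\<^sub>y\<close> of the right multiplications: left symmetry reads
  \<open>R\<^sub>x\<^sub>y = R\<^sub>y R\<^sub>x + [L\<^sub>x, R\<^sub>y]\<close>, whence \<open>tr R\<^sub>x\<^sub>y = tr R\<^sub>y R\<^sub>x\<close> is symmetric.  The traces of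
  products of two and three right multiplications vanish for the same reason, and the commuting
  operators \<open>R\<^sub>y\<close> become nilpotent.  This contradicts \<open>A = A \<cdot> A\<close>.\<close>

lemma commutator_functional_exists:
  fixes m :: "'f::field_char_0 ^ 3 \<Rightarrow> 'f ^ 3 \<Rightarrow> 'f ^ 3"
  assumes N: "novikov3 m"
  shows "\<exists>h. h \<noteq> 0 \<and> (\<forall>x y. dot3 h (m x y) = dot3 h (m y x))"
proof (rule ccontr)
  note bil = novikov3D[OF N]
  note LS = novikov3_left_symmetric[OF N] and RC = novikov3_right_commutative[OF N]
  have linR: "lin3 (\<lambda>x. m x y)" and linL: "lin3 (m x)" for x y
    by (auto intro!: linear3I simp: bil)
  have linRR: "lin3 (\<lambda>x. m (m x y) z)" and linRL: "lin3 (\<lambda>x. m (m z x) y)" for y z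
    by (auto intro!: linear3I simp: bil)
  assume "\<not> ?thesis"
  then have NF: "h = 0" if "\<And>x y. dot3 h (m x y) = dot3 h (m y x)" for h
    using that by blast
  have functional: "\<phi> y = 0"
    if add: "\<And>x y. \<phi> (x + y) = \<phi> x + \<phi> y" and sc: "\<And>c x. \<phi> (c *s x) = c * \<phi> x"
      and com: "\<And>x y. \<phi> (m x y) = \<phi> (m y x)" for \<phi> :: "'f ^ 3 \<Rightarrow> 'f" and y
  proof -
    have \<phi>: "\<phi> y = dot3 (vector [\<phi> e1, \<phi> e2, \<phi> e3]) y" for y
    proof -
      have "y = y$1 *s e1 + y$2 *s e2 + y$3 *s e3" by (simp add: vec3_eq_iff)
      then have "\<phi> y = \<phi> (y$1 *s e1 + y$2 *s e2 + y$3 *s e3)" by (rule arg_cong)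
      then show ?thesis by (simp add: add sc dot3_def)
    qed
    have "vector [\<phi> e1, \<phi> e2, \<phi> e3] = (0 :: 'f ^ 3)"
      by (rule NF) (simp only: \<phi>[symmetric] com)
    then show ?thesis unfolding \<phi>[of y] by (simp only: dot3_def zero_index mult_zero_left add_0)
  qed
  have R_mult: "m z (m x y) = m (m z x) y + m x (m z y) - m (m x z) y" for x y z
    using LS[of z x y] by (simp add: algebra_simps)
  have tr_mult: "tr3 (\<lambda>z. m z (m x y)) = tr3 (\<lambda>z. m (m z x) y)" for x y
    using tr3_comp_commute[OF linL[of x] linR[of y]]
    by (subst R_mult) (simp add: tr3_add tr3_diff)
  have tr1: "tr3 (\<lambda>z. m z y) = 0" for y
  proof (rule functional)
    show "tr3 (\<lambda>z. m z (m x y)) = tr3 (\<lambda>z. m z (m y x))" for x y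
      unfolding tr_mult by (subst RC) (rule refl)
  qed (simp_all add: tr3_def bil algebra_simps)
  have tr2: "tr3 (\<lambda>z. m (m z x) y) = 0" for x y
    using tr_mult[of x y] tr1[of "m x y"] by simp
  have tr3: "tr3 (\<lambda>z. m (m (m z x) y) w) = 0" for x y w
  proof -
    have "m (m z (m x y)) w = m (m (m z x) y) w + m (m x (m z y)) w - m (m (m x z) y) w" for z
      by (subst R_mult) (simp add: bil)
    then have "tr3 (\<lambda>z. m (m z (m x y)) w) = tr3 (\<lambda>z. m (m (m z x) y) w)
        + tr3 (\<lambda>z. m (m x (m z y)) w) - tr3 (\<lambda>z. m (m (m x z) y) w)"
      by (simp add: tr3_add tr3_diff)
    moreover have "tr3 (\<lambda>z. m (m x (m z y)) w) = tr3 (\<lambda>z. m (m (m x z) w) y)"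
      using tr3_comp_commute[OF linRL[of x w] linR[of y]] by simp
    moreover have "tr3 (\<lambda>z. m (m (m x z) w) y) = tr3 (\<lambda>z. m (m (m x z) y) w)"
      by (subst RC) (rule refl)
    ultimately show ?thesis using tr2 by simp
  qed
  have cube: "m (m (m x y) y) y = 0" for x y
    by (rule nilpotent_if_traces_zero[OF linR]) (fact tr1 tr2 tr3)+
  have RRR: "m (m (m x a) b) c = 0" for x a b c
  proof (rule symmetric_trilinear_zero[where f = "\<lambda>a b c. m (m (m x a) b) c"])
    show "m (m (m x (a + a')) b) c = m (m (m x a) b) c + m (m (m x a') b) c" for a a' b c
      by (simp add: bil)
    show "m (m (m x a) b) c = m (m (m x b) a) c" for a b c by (subst RC) (rule refl)
  qed (rule RC, rule cube)
  have functional': "\<phi> y = 0"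
    if add: "\<And>x y. \<phi> (x + y) = \<phi> x + \<phi> y" and sc: "\<And>c x. \<phi> (c *s x) = c * \<phi> x"
      and com: "\<And>x y. \<phi> (m x y) = 0" for \<phi> :: "'f ^ 3 \<Rightarrow> 'f" and y
    by (rule functional) (simp_all only: add sc com)
  have "m (m y b) c $ i = 0" for y b c i
    by (rule functional'[where \<phi> = "\<lambda>y. m (m y b) c $ i"]) (simp_all add: bil RRR)
  then have RR: "m (m y b) c = 0" for y b c by (simp add: vec_eq_iff)
  have "m y c $ i = 0" for y c i
    by (rule functional'[where \<phi> = "\<lambda>y. m y c $ i"]) (simp_all add: bil RR)
  then have "m y c = 0" for y c by (simp add: vec_eq_iff)
  then have "e1 = (0 :: 'f ^ 3)" by (intro NF) simp
  then show False using e_nth(1)[where 'a = 'f] by simp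
qed

section \<open>Lie algebra normal forms\<close>

lemma novikov3_commutator:
  assumes "novikov3 m"
  shows "commutator m (x + y) z = commutator m x z + commutator m y z"
    "commutator m z (x + y) = commutator m z x + commutator m z y"
    "commutator m (c *s x) z = c *s commutator m x z"
    "commutator m z (c *s x) = c *s commutator m z x"
    "commutator m x x = 0"
  using novikov3D[OF assms] by (simp_all add: commutator_def vec_eq_iff algebra_simps)

lemma commutator_swap: "commutator m y x = - commutator m x y"
  by (simp add: commutator_def)

text \<open>The Jacobi identity is the sum of three instances of left symmetry.\<close>

lemma jacobi:
  assumes "novikov3 m"
  shows "commutator m x (commutator m y z) = commutator m (commutator m x y) z + commutator m y (commutator m x z)"
proof -
  note bil = novikov3D[OF assms] and LS = novikov3_left_symmetric[OF assms]
  have L: "m (m x y) z $ i = m (m y x) z $ i + m x (m y z) $ i - m y (m x z) $ i" for x y z i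
    using arg_cong[OF LS[of x y z], of "\<lambda>v. v $ i"] by (simp add: algebra_simps)
  show ?thesis
    unfolding vec_eq_iff
    using L[of x y z] L[of y z x] L[of z x y] by (simp add: commutator_def bil)
qed

text \<open>The Lie bracket of \<open>F e\<^sub>1 \<oplus> V\<close> in which \<open>e\<^sub>1\<close> acts on the abelian ideal \<open>V\<close> by the matrix with
  columns \<open>(p, q)\<close> and \<open>(r, s)\<close>.\<close>

definition bracketD :: "'f \<Rightarrow> 'f \<Rightarrow> 'f \<Rightarrow> 'f \<Rightarrow> 'f::field ^ 3 \<Rightarrow> 'f ^ 3 \<Rightarrow> 'f ^ 3" where
  "bracketD p q r s x y = vector [0,
     p * (x$1 * y$2 - x$2 * y$1) + r * (x$1 * y$3 - x$3 * y$1),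
     q * (x$1 * y$2 - x$2 * y$1) + s * (x$1 * y$3 - x$3 * y$1)]"

definition lie_shape :: "'f \<Rightarrow> 'f \<Rightarrow> 'f \<Rightarrow> 'f \<Rightarrow> ('f::field ^ 3 \<Rightarrow> 'f ^ 3 \<Rightarrow> 'f ^ 3) \<Rightarrow> bool" where
  "lie_shape p q r s m \<longleftrightarrow> novikov3 m \<and> (\<forall>x y. commutator m x y = bracketD p q r s x y)"

lemma lie_shape_frame_map:
  assumes N: "novikov3 m" and fr: "frame b1 b2 b3"
    and K: "commutator m b1 b2 = p *s b2 + q *s b3" "commutator m b1 b3 = r *s b2 + s *s b3"
      "commutator m b2 b3 = 0"
  shows "\<exists>m'. lie_shape p q r s m' \<and> iso3 m m' \<and>
    (\<forall>x y. frame_map b1 b2 b3 (m' x y) = m (frame_map b1 b2 b3 x) (frame_map b1 b2 b3 y))"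
proof -
  let ?g = "frame_map b1 b2 b3"
  obtain m' where m': "novikov3 m'" "iso3 m m'" "\<And>x y. ?g (m' x y) = m (?g x) (?g y)"
    using reframe[OF N fr] by metis
  note bil = novikov3_commutator[OF N]
  have K': "commutator m b2 b1 = - (p *s b2 + q *s b3)" "commutator m b3 b1 = - (r *s b2 + s *s b3)"
    "commutator m b3 b2 = 0"
    using K commutator_swap by (metis neg_0_equal_iff_equal)+
  have "commutator m' x y = bracketD p q r s x y" for x y
  proof (rule injD[OF bij_is_inj[OF bij_frame_map[OF fr]]])
    have "?g (commutator m' x y) = commutator m (?g x) (?g y)"
      using vec.linear_diff[OF linear_frame_map[of b1 b2 b3]] by (simp add: commutator_def m')
    also have "\<dots> = ?g (bracketD p q r s x y)"
      unfolding frame_map_def bil K K' by (simp add: bracketD_def vec_eq_iff algebra_simps)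
    finally show "?g (commutator m' x y) = ?g (bracketD p q r s x y)" .
  qed
  then show ?thesis using m' by (auto simp: lie_shape_def)
qed

lemma lie_shape_frame:
  assumes "novikov3 m" "frame b1 b2 b3" "commutator m b1 b2 = p *s b2 + q *s b3"
    "commutator m b1 b3 = r *s b2 + s *s b3" "commutator m b2 b3 = 0"
  shows "\<exists>m'. lie_shape p q r s m' \<and> iso3 m m'"
  using lie_shape_frame_map[OF assms] by blast

lemma kernel_frame:
  fixes h :: "'f::field ^ 3" assumes "h \<noteq> 0"
  obtains b1 b2 b3 where "frame b1 b2 b3" "\<And>y. dot3 h y = 0 \<Longrightarrow> \<exists>\<beta> \<gamma>. y = \<beta> *s b2 + \<gamma> *s b3"
proof -
  have solve: "x = (- b / a) * y + (- c / a) * z" if "a \<noteq> 0" "a * x + b * y + c * z = 0" for a b c x y z :: 'f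
  proof -
    have "a * x = a * ((- b / a) * y + (- c / a) * z)"
      using that by (simp add: algebra_simps eq_neg_iff_add_eq_0)
    then show ?thesis using that(1) by (rule mult_left_cancel[THEN iffD1, rotated])
  qed
  have "h$1 \<noteq> 0 \<or> h$2 \<noteq> 0 \<or> h$3 \<noteq> 0" using assms by (simp add: vec3_eq_iff)
  then consider "h$1 \<noteq> 0" | "h$2 \<noteq> 0" | "h$3 \<noteq> 0" by blast
  then show thesis
  proof cases
    case 1
    show thesis
    proof (rule that)
      show "frame e1 (vector [- h$2 / h$1, 1, 0]) (vector [- h$3 / h$1, 0, 1])"
        by (auto simp: frame_def vec3_eq_iff)
      show "\<exists>\<beta> \<gamma>. y = \<beta> *s vector [- h$2 / h$1, 1, 0] + \<gamma> *s vector [- h$3 / h$1, 0, 1]"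
        if "dot3 h y = 0" for y
      proof -
        have "y$1 = (- h$2 / h$1) * y$2 + (- h$3 / h$1) * y$3"
          using that 1 by (intro solve[of "h$1"]) (simp_all add: dot3_def algebra_simps)
        then show ?thesis
          by - (rule exI[of _ "y$2"], rule exI[of _ "y$3"], simp add: vec3_eq_iff mult.commute)
      qed
    qed
  next
    case 2
    show thesis
    proof (rule that)
      show "frame e2 (vector [1, - h$1 / h$2, 0]) (vector [0, - h$3 / h$2, 1])"
        by (auto simp: frame_def vec3_eq_iff)
      show "\<exists>\<beta> \<gamma>. y = \<beta> *s vector [1, - h$1 / h$2, 0] + \<gamma> *s vector [0, - h$3 / h$2, 1]"
        if "dot3 h y = 0" for y
      proof -
        have "y$2 = (- h$1 / h$2) * y$1 + (- h$3 / h$2) * y$3"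
          using that 2 by (intro solve[of "h$2"]) (simp_all add: dot3_def algebra_simps)
        then show ?thesis
          by - (rule exI[of _ "y$1"], rule exI[of _ "y$3"], simp add: vec3_eq_iff mult.commute)
      qed
    qed
  next
    case 3
    show thesis
    proof (rule that)
      show "frame e3 (vector [1, 0, - h$1 / h$3]) (vector [0, 1, - h$2 / h$3])"
        by (auto simp: frame_def vec3_eq_iff)
      show "\<exists>\<beta> \<gamma>. y = \<beta> *s vector [1, 0, - h$1 / h$3] + \<gamma> *s vector [0, 1, - h$2 / h$3]"
        if "dot3 h y = 0" for y
      proof -
        have "y$3 = (- h$1 / h$3) * y$1 + (- h$2 / h$3) * y$2"
          using that 3 by (intro solve[of "h$3"]) (simp_all add: dot3_def algebra_simps)
        then show ?thesis
          by - (rule exI[of _ "y$1"], rule exI[of _ "y$2"], simp add: vec3_eq_iff mult.commute)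
      qed
    qed
  qed
qed

lemma frameD: "frame b1 b2 b3 \<Longrightarrow> a *s b1 + b *s b2 + c *s b3 = 0 \<Longrightarrow> a = 0 \<and> b = 0 \<and> c = 0"
  by (simp add: frame_def)

lemma frame_cong_coeff:
  assumes "frame b1 b2 b3" "a *s b1 + b *s b2 + c *s b3 = a' *s b1 + b' *s b2 + c' *s b3"
  shows "a = a' \<and> b = b' \<and> c = c'"
  using frameD[OF assms(1), of "a - a'" "b - b'" "c - c'"] assms(2)
  by (simp add: vec_eq_iff algebra_simps)

text \<open>Cramer's rule: the determinant annihilates the coefficients of every linear relation.\<close>

lemma frame_change:
  assumes fr: "frame b1 b2 b3"
    and det: "u1 * (v2 * w3 - v3 * w2) - u2 * (v1 * w3 - v3 * w1) + u3 * (v1 * w2 - v2 * w1) \<noteq> 0"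
  shows "frame (u1 *s b1 + u2 *s b2 + u3 *s b3) (v1 *s b1 + v2 *s b2 + v3 *s b3)
    (w1 *s b1 + w2 *s b2 + w3 *s b3)"
  unfolding frame_def
proof (intro allI impI)
  fix a b c
  assume "a *s (u1 *s b1 + u2 *s b2 + u3 *s b3) + b *s (v1 *s b1 + v2 *s b2 + v3 *s b3)
    + c *s (w1 *s b1 + w2 *s b2 + w3 *s b3) = 0"
  then have "(a * u1 + b * v1 + c * w1) *s b1 + (a * u2 + b * v2 + c * w2) *s b2 + (a * u3 + b * v3 + c * w3) *s b3 = 0"
    by (simp add: vec_eq_iff algebra_simps)
  from frameD[OF fr this] have E: "a * u1 + b * v1 + c * w1 = 0" "a * u2 + b * v2 + c * w2 = 0" "a * u3 + b * v3 + c * w3 = 0"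
    by auto
  let ?d = "u1 * (v2 * w3 - v3 * w2) - u2 * (v1 * w3 - v3 * w1) + u3 * (v1 * w2 - v2 * w1)"
  have "?d * a = (a * u1 + b * v1 + c * w1) * (v2 * w3 - v3 * w2)
      - (a * u2 + b * v2 + c * w2) * (v1 * w3 - v3 * w1) + (a * u3 + b * v3 + c * w3) * (v1 * w2 - v2 * w1)"
    "?d * b = (a * u2 + b * v2 + c * w2) * (u1 * w3 - u3 * w1)
      - (a * u1 + b * v1 + c * w1) * (u2 * w3 - u3 * w2) - (a * u3 + b * v3 + c * w3) * (u1 * w2 - u2 * w1)"
    "?d * c = (a * u1 + b * v1 + c * w1) * (u2 * v3 - u3 * v2)
      - (a * u2 + b * v2 + c * w2) * (u1 * v3 - u3 * v1) + (a * u3 + b * v3 + c * w3) * (u1 * v2 - u2 * v1)"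
    by (simp_all add: algebra_simps)
  then have "?d * a = 0" "?d * b = 0" "?d * c = 0" unfolding E by simp_all
  then show "a = 0 \<and> b = 0 \<and> c = 0" using det by simp
qed

text \<open>The kernel of the functional is a two-dimensional ideal of the Lie algebra; if it is not
  abelian, all its derivations are inner, so it splits off a central direction, which then
  together with the derived algebra spans an abelian one.\<close>

lemma novikov_lie_shape:
  fixes m :: "'f::field_char_0 ^ 3 \<Rightarrow> 'f ^ 3 \<Rightarrow> 'f ^ 3"
  assumes N: "novikov3 m"
  shows "\<exists>p q r s m'. lie_shape p q r s m' \<and> iso3 m m'"
proof -
  let ?K = "commutator m"
  note bil = novikov3_commutator[OF N]
  obtain h where h: "h \<noteq> 0" "\<And>x y. dot3 h (m x y) = dot3 h (m y x)"
    using commutator_functional_exists[OF N] by blast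
  have hK: "dot3 h (?K x y) = 0" for x y
    using h(2)[of x y] by (simp add: commutator_def dot3_def algebra_simps)
  obtain b1 b2 b3 where fr: "frame b1 b2 b3"
    and ker: "\<And>y. dot3 h y = 0 \<Longrightarrow> \<exists>\<beta> \<gamma>. y = \<beta> *s b2 + \<gamma> *s b3"
    using kernel_frame[OF h(1)] by metis
  obtain p q where pq: "?K b1 b2 = p *s b2 + q *s b3" using ker hK by meson
  obtain r s where rs: "?K b1 b3 = r *s b2 + s *s b3" using ker hK by meson
  obtain u v where uv: "?K b2 b3 = u *s b2 + v *s b3" using ker hK by meson
  show ?thesis
  proof (cases "u = 0 \<and> v = 0")
    case True
    then show ?thesis using lie_shape_frame[OF N fr pq rs] uv by (simp, blast)
  next
    case False
    obtain c2 c3 where c: "frame b1 c2 c3" "?K c2 c3 = c3"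
      "\<And>y. dot3 h y = 0 \<Longrightarrow> \<exists>\<beta> \<gamma>. y = \<beta> *s c2 + \<gamma> *s c3"
    proof (cases "v = 0")
      case True
      then have u: "u \<noteq> 0" using False by simp
      show thesis
      proof (rule that[of "(- 1 / u) *s b3" "u *s b2"])
        show "frame b1 ((- 1 / u) *s b3) (u *s b2)"
          using frame_change[OF fr, where ?u1.0 = 1 and ?u2.0 = 0 and ?u3.0 = 0 and ?v1.0 = 0
              and ?v2.0 = 0 and ?v3.0 = "-1/u" and ?w1.0 = 0 and ?w2.0 = u and ?w3.0 = 0] u
          by simp
        show "?K ((- 1 / u) *s b3) (u *s b2) = u *s b2"
          unfolding bil commutator_swap[of m b3 b2] uv True using u by (simp add: vec_eq_iff)
        show "\<exists>\<beta> \<gamma>. y = \<beta> *s ((- 1 / u) *s b3) + \<gamma> *s (u *s b2)" if "dot3 h y = 0" for y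
        proof -
          obtain \<beta> \<gamma> where "y = \<beta> *s b2 + \<gamma> *s b3" using ker \<open>dot3 h y = 0\<close> by blast
          then have "y = (- \<gamma> * u) *s ((- 1 / u) *s b3) + (\<beta> / u) *s (u *s b2)"
            using u by (simp add: vec_eq_iff)
          then show ?thesis by blast
        qed
      qed
    next
      case v: False
      show thesis
      proof (rule that[of "(1 / v) *s b2" "u *s b2 + v *s b3"])
        show "frame b1 ((1 / v) *s b2) (u *s b2 + v *s b3)"
          using frame_change[OF fr, where ?u1.0 = 1 and ?u2.0 = 0 and ?u3.0 = 0 and ?v1.0 = 0
              and ?v2.0 = "1/v" and ?v3.0 = 0 and ?w1.0 = 0 and ?w2.0 = u and ?w3.0 = v] v
          by simp
        show "?K ((1 / v) *s b2) (u *s b2 + v *s b3) = u *s b2 + v *s b3"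
          using uv v by (simp add: bil vec_eq_iff)
        show "\<exists>\<beta> \<gamma>. y = \<beta> *s ((1 / v) *s b2) + \<gamma> *s (u *s b2 + v *s b3)" if "dot3 h y = 0" for y
        proof -
          obtain \<beta> \<gamma> where "y = \<beta> *s b2 + \<gamma> *s b3" using ker \<open>dot3 h y = 0\<close> by blast
          then have "y = ((\<beta> - \<gamma> * u / v) * v) *s ((1 / v) *s b2) + (\<gamma> / v) *s (u *s b2 + v *s b3)"
            using v by (simp add: vec_eq_iff field_simps)
          then show ?thesis by blast
        qed
      qed
    qed
    obtain a b where ab: "?K b1 c2 = a *s c2 + b *s c3" using c(3) hK by meson
    obtain c' d where cd: "?K b1 c3 = c' *s c2 + d *s c3" using c(3) hK by meson
    have "?K b1 (?K c2 c3) = ?K (?K b1 c2) c3 + ?K c2 (?K b1 c3)" by (rule jacobi[OF N])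
    then have "0 *s b1 + c' *s c2 + d *s c3 = 0 *s b1 + 0 *s c2 + (a + d) *s c3"
      by (simp add: c(2) ab cd bil vec_eq_iff algebra_simps)
    from frame_cong_coeff[OF c(1) this] have a: "a = 0" "c' = 0" by auto
    let ?x = "1 *s b1 + (- d) *s c2 + b *s c3"
    have "frame (0 *s b1 + 1 *s c2 + 0 *s c3) ?x (0 *s b1 + 0 *s c2 + 1 *s c3)"
      by (rule frame_change[OF c(1)]) simp
    then have fr': "frame c2 ?x c3" by simp
    have K: "?K c2 ?x = 0 *s ?x + 0 *s c3" "?K c2 c3 = 0 *s ?x + 1 *s c3" "?K ?x c3 = 0"
      unfolding bil commutator_swap[of m c2 b1] ab cd c(2) a by (simp_all add: vec_eq_iff)
    show ?thesis using lie_shape_frame[OF N fr' K] by blast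
  qed
qed

text \<open>A non-zero operator on a plane is scalar, or it has a cyclic vector and is given by its trace
  and determinant.  Rescaling \<open>e\<^sub>1\<close> rescales the operator, which makes its trace 1 if it is non-zero,
  and otherwise multiplies the determinant by squares.\<close>

lemma lie_shape_normal_form:
  fixes m :: "'f::field_char_0 ^ 3 \<Rightarrow> 'f ^ 3 \<Rightarrow> 'f ^ 3"
  assumes m: "lie_shape p q r s m" and nz: "p \<noteq> 0 \<or> q \<noteq> 0 \<or> r \<noteq> 0 \<or> s \<noteq> 0"
    and sq: "\<And>y :: 'f. \<exists>t. y = t\<^sup>2 \<or> y = - t\<^sup>2"
  shows "\<exists>m'. iso3 m m' \<and> (lie_shape 1 0 0 1 m' \<or> (\<exists>\<alpha>. lie_shape 0 1 \<alpha> 1 m') \<or>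
    lie_shape 0 1 1 0 m' \<or> lie_shape 0 1 (-1) 0 m' \<and> (\<nexists>i::'f. i\<^sup>2 = -1) \<or> lie_shape 0 1 0 0 m')"
proof -
  have N: "novikov3 m" and K: "commutator m x y = bracketD p q r s x y" for x y
    using m by (auto simp: lie_shape_def)
  show ?thesis
  proof (cases "q = 0 \<and> r = 0 \<and> p = s")
    case True
    then have s: "s \<noteq> 0" using nz by auto
    have "\<exists>m'. lie_shape 1 0 0 1 m' \<and> iso3 m m'"
      by (rule lie_shape_frame[OF N, of "(1/s) *s e1" e2 e3])
        (use True s in \<open>auto simp: frame_def vec3_eq_iff K bracketD_def\<close>)
    then show ?thesis by blast
  next
    case False
    have "\<exists>a b. a * (q * a + s * b) - b * (p * a + r * b) \<noteq> 0"
    proof (rule ccontr)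
      assume "\<not> ?thesis"
      then have *: "a * (q * a + s * b) - b * (p * a + r * b) = 0" for a b by blast
      have "q = 0" using *[of 1 0] by simp
      moreover have "r = 0" using *[of 0 1] by simp
      moreover have "p = s" using *[of 1 1] calculation by simp
      ultimately show False using False by simp
    qed
    then obtain a b where ab: "a * (q * a + s * b) - b * (p * a + r * b) \<noteq> 0" by blast
    define T where "T = p + s"
    define \<delta> where "\<delta> = p * s - q * r"
    have cyclic: "\<exists>m'. lie_shape 0 1 (- k\<^sup>2 * \<delta>) (k * T) m' \<and> iso3 m m'" if k: "k \<noteq> 0" for k
    proof (rule lie_shape_frame[OF N])
      let ?b = "vector [0, a, b] :: 'f ^ 3"
      let ?c = "vector [0, k * (p * a + r * b), k * (q * a + s * b)] :: 'f ^ 3"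
      have std: "frame e1 e2 (e3 :: 'f ^ 3)" by (simp add: frame_def vec3_eq_iff)
      have "k * (a * (k * (q * a + s * b)) - b * (k * (p * a + r * b)))
          = k * k * (a * (q * a + s * b) - b * (p * a + r * b))" by (simp add: algebra_simps)
      then have "k * (a * (k * (q * a + s * b)) - b * (k * (p * a + r * b))) \<noteq> 0"
        using ab k by simp
      then have "frame (k *s e1 + 0 *s e2 + 0 *s e3) (0 *s e1 + a *s e2 + b *s e3)
         (0 *s e1 + (k * (p * a + r * b)) *s e2 + (k * (q * a + s * b)) *s e3)"
        by (intro frame_change[OF std]) simp
      moreover have "k *s e1 + 0 *s e2 + 0 *s e3 = k *s e1" "0 *s e1 + a *s e2 + b *s e3 = ?b"
        "0 *s e1 + (k * (p * a + r * b)) *s e2 + (k * (q * a + s * b)) *s e3 = ?c"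
        by (simp_all add: vec3_eq_iff)
      ultimately show "frame (k *s e1) ?b ?c" by metis
      show "commutator m (k *s e1) ?b = 0 *s ?b + 1 *s ?c"
        by (simp add: K bracketD_def vec3_eq_iff algebra_simps)
      show "commutator m (k *s e1) ?c = (- k\<^sup>2 * \<delta>) *s ?b + (k * T) *s ?c"
        by (simp add: K bracketD_def vec3_eq_iff T_def \<delta>_def power2_eq_square) (simp add: algebra_simps)
      show "commutator m ?b ?c = 0" by (simp add: K bracketD_def vec3_eq_iff)
    qed
    show ?thesis
    proof (cases "T = 0")
      case False
      then show ?thesis using cyclic[of "1 / T"] by auto
    next
      case T: True
      show ?thesis
      proof (cases "\<delta> = 0")
        case True
        then show ?thesis using cyclic[of 1] T by auto
      next
        case \<delta>: False
        show ?thesis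
        proof (cases "\<exists>t. - \<delta> = t\<^sup>2")
          case True
          then obtain t where t: "- \<delta> = t\<^sup>2" by blast
          then have "t \<noteq> 0" using \<delta> by auto
          then have "- (1 / t)\<^sup>2 * \<delta> = 1" using t by (simp add: power_divide field_simps)
          then show ?thesis using cyclic[of "1 / t"] T \<open>t \<noteq> 0\<close> by auto
        next
          case ns: False
          then obtain t where t: "- \<delta> = - t\<^sup>2" using sq by blast
          then have "t \<noteq> 0" using \<delta> by auto
          then have "- (1 / t)\<^sup>2 * \<delta> = - 1" using t by (simp add: power_divide)
          moreover have "i\<^sup>2 \<noteq> - 1" for i :: 'f
            using ns t by (metis mult_minus1 power_mult_distrib)
          ultimately show ?thesis using cyclic[of "1 / t"] T \<open>t \<noteq> 0\<close> by auto
        qed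
      qed
    qed
  qed
qed

section \<open>Structure when the derivation is not nilpotent\<close>

text \<open>If \<open>D F = 2 F D\<close> for operators of a plane, then \<open>D\<^sup>2 F = 4 F D\<^sup>2\<close>, and the Cayley--Hamilton
  theorem gives \<open>F (2 T D - 3 \<delta>) = 0\<close> for the trace \<open>T\<close> and determinant \<open>\<delta>\<close> of \<open>D\<close>.  The assumption says
  that \<open>2 T D - 3 \<delta>\<close> is invertible.\<close>

lemma no_eigenvalue_doubling:
  fixes p q r s :: "'f::field"
  assumes E: "p * a + r * b = 2 * (p * a + q * c)" "q * a + s * b = 2 * (p * b + q * d)"
    "p * c + r * d = 2 * (r * a + s * c)" "q * c + s * d = 2 * (r * b + s * d)"
    and nz: "(p * s - q * r) * (9 * (p * s - q * r) - 2 * (p + s)\<^sup>2) \<noteq> 0"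
  shows "a = 0 \<and> b = 0 \<and> c = 0 \<and> d = 0"
proof -
  let ?T = "p + s" and ?d = "p * s - q * r"
  have aux: "3 * ?d * a = 2 * ?T * (p * a + q * c) \<and> 3 * ?d * c = 2 * ?T * (r * a + s * c) \<and>
      3 * ?d * b = 2 * ?T * (p * b + q * d) \<and> 3 * ?d * d = 2 * ?T * (r * b + s * d)"
  proof -
    let ?g = "p * a + r * b - 2 * (p * a + q * c)" and ?h = "q * a + s * b - 2 * (p * b + q * d)"
    let ?i = "p * c + r * d - 2 * (r * a + s * c)" and ?j = "q * c + s * d - 2 * (r * b + s * d)"
    have "3 * ?d * a - 2 * ?T * (p * a + q * c) = p * ?g + r * ?h + 2 * (p * ?g + q * ?i) - ?T * ?g"
      "3 * ?d * c - 2 * ?T * (r * a + s * c) = p * ?i + r * ?j + 2 * (r * ?g + s * ?i) - ?T * ?i"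
      "3 * ?d * b - 2 * ?T * (p * b + q * d) = q * ?g + s * ?h + 2 * (p * ?h + q * ?j) - ?T * ?h"
      "3 * ?d * d - 2 * ?T * (r * b + s * d) = q * ?i + s * ?j + 2 * (r * ?h + s * ?j) - ?T * ?j"
      by (simp_all add: algebra_simps)
    moreover have "?g = 0" "?h = 0" "?i = 0" "?j = 0" unfolding right_minus_eq by (fact E)+
    ultimately show ?thesis by (simp only: mult_zero_right add_0_right diff_0_right right_minus_eq)
  qed
  have "x = 0 \<and> y = 0"
    if "3 * ?d * x = 2 * ?T * (p * x + q * y)" "3 * ?d * y = 2 * ?T * (r * x + s * y)" for x y
  proof -
    let ?z = "2 * ?T * (p * x + q * y) - 3 * ?d * x" and ?w = "2 * ?T * (r * x + s * y) - 3 * ?d * y"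
    let ?k = "?d * (9 * ?d - 2 * ?T\<^sup>2)"
    have "?k * x = (2 * ?T * s - 3 * ?d) * ?z - 2 * ?T * q * ?w"
      "?k * y = (2 * ?T * p - 3 * ?d) * ?w - 2 * ?T * r * ?z"
      by (simp_all add: algebra_simps power2_eq_square)
    moreover have "?z = 0" "?w = 0" unfolding right_minus_eq by (fact that[symmetric])+
    ultimately have "?k * x = 0" "?k * y = 0" by (simp_all only: mult_zero_right diff_0_right)
    then show ?thesis using nz by simp
  qed
  then show ?thesis using aux by blast
qed

text \<open>Let \<open>V\<close> be the span of \<open>e\<^sub>2, e\<^sub>3\<close>, on which \<open>e\<^sub>1\<close> acts by the derivation \<open>D\<close>, and let \<open>\<beta>(u, v)\<close> and
  \<open>p(u)\<close> be the first coordinates of \<open>u v\<close> and \<open>u e\<^sub>1\<close>.  The Novikov identities give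
  \<open>2 \<beta>(D u, v) = 0\<close> and \<open>\<beta>(v, w) D u = \<beta>(u, w) D v\<close>; taking \<open>u \<in> D V\<close> with \<open>D u \<noteq> 0\<close> yields \<open>\<beta> = 0\<close>, and
  \<open>p = 0\<close> follows in the same way from \<open>p(D u) = 0\<close> and \<open>p(u) D v = p(v) D u\<close>.  So \<open>V\<close> is an ideal of the
  algebra, and the components of the same identities in \<open>V\<close> are the relations for \<open>Q\<close> and for the
  product of \<open>V\<close>.\<close>

lemma ideal_structure:
  fixes m :: "'f::field_char_0 ^ 3 \<Rightarrow> 'f ^ 3 \<Rightarrow> 'f ^ 3" and p q r s :: 'f
  defines "D \<equiv> \<lambda>y. vector [0, p * y$2 + r * y$3, q * y$2 + s * y$3] :: 'f ^ 3"
  defines "c \<equiv> m e1 e1 $ 1"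
  defines "Q \<equiv> \<lambda>u. m u e1 - c *s u"
  assumes m: "lie_shape p q r s m" and D2: "\<exists>u. D (D u) \<noteq> 0"
  shows "\<And>u v. u$1 = 0 \<Longrightarrow> v$1 = 0 \<Longrightarrow> m u v = m v u \<and> m u v $ 1 = 0"
    and "\<And>u. u$1 = 0 \<Longrightarrow> m e1 u = m u e1 + D u \<and> m u e1 $ 1 = 0"
    and "\<And>u. u$1 = 0 \<Longrightarrow> D (Q u) = 2 *s Q (D u)"
    and "\<And>u v. u$1 = 0 \<Longrightarrow> v$1 = 0 \<Longrightarrow> m (D u) v = m u (D v)"
    and "\<And>u v. u$1 = 0 \<Longrightarrow> v$1 = 0 \<Longrightarrow> D (m u v) = 2 *s m (D u) v"
    and "\<And>u. u$1 = 0 \<Longrightarrow> Q (Q u) + c *s Q u + Q (D u) = m u (m e1 e1 - c *s e1)"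
proof -
  have N: "novikov3 m" and K: "m x y - m y x = bracketD p q r s x y" for x y
    using m by (auto simp: lie_shape_def commutator_def)
  note bil = novikov3D[OF N]
  note LS = novikov3_left_symmetric[OF N] and RC = novikov3_right_commutative[OF N]
  have D1 [simp]: "D y $ 1 = 0" for y by (simp add: D_def)
  have D_lin: "D (x + y) = D x + D y" "D (k *s x) = k *s D x" "D (x - y) = D x - D y" for x y k
    by (simp_all add: D_def vec3_eq_iff algebra_simps)
  have De1: "D e1 = 0" by (simp add: D_def vec3_eq_iff)
  have swap: "m y u = m u y + y$1 *s D u" if "u$1 = 0" for y u
    using K[of y u] that by (simp add: bracketD_def D_def vec3_eq_iff algebra_simps)
  have comV: "m u v = m v u" if "u$1 = 0" "v$1 = 0" for u v
    using swap[of u v] that by simp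
  have e1y: "m e1 y = m y e1 + D y" for y
    using K[of e1 y] by (simp add: bracketD_def D_def vec3_eq_iff algebra_simps)
  have I: "m (D v) u + m v e1 $ 1 *s D u = m (D u) v + m u e1 $ 1 *s D v"
    if "u$1 = 0" "v$1 = 0" for u v
  proof -
    have "m u (m v e1) = m v (m u e1)"
      using LS[of u v e1] comV[OF that] by (simp add: algebra_simps)
    moreover have "m (m e1 v) u = m (m e1 u) v" by (rule RC)
    ultimately show ?thesis
      using swap[OF that(1), of "m v e1"] swap[OF that(2), of "m u e1"]
      by (simp add: e1y[of u] e1y[of v] bil vec_eq_iff algebra_simps)
  qed
  have II: "D (m u v) + m u e1 $ 1 *s D v = m u (D v) + m (D u) v"
    if "u$1 = 0" "v$1 = 0" for u v
  proof -
    have "m e1 (m u v) - m u (m e1 v) = m (m e1 u) v - m (m u e1) v"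
      using LS[of e1 u v] by (simp add: algebra_simps)
    also have "\<dots> = m (D u) v" by (simp add: e1y[of u] bil)
    finally have "m (m u v) e1 + D (m u v) - m u (m v e1) - m u (D v) = m (D u) v"
      by (simp add: e1y[of "m u v"] e1y[of v] bil algebra_simps)
    moreover have "m (m u v) e1 = m (m u e1) v" by (rule RC)
    moreover have "m (m u e1) v = m v (m u e1) + m u e1 $ 1 *s D v" by (rule swap) fact
    moreover have "m u (m v e1) = m v (m u e1)"
      using LS[of u v e1] comV[OF that] by (simp add: algebra_simps)
    ultimately show ?thesis by (simp add: algebra_simps)
  qed
  have \<beta>D: "m (D u) v $ 1 = 0" if "u$1 = 0" "v$1 = 0" for u v
  proof -
    have "m (D v) u $ 1 = m (D u) v $ 1" using arg_cong[OF I[OF that], of "\<lambda>x. x$1"] by simp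
    moreover have "m u (D v) $ 1 + m (D u) v $ 1 = 0"
      using arg_cong[OF II[OF that], of "\<lambda>x. x$1"] by simp
    moreover have "m u (D v) = m (D v) u" by (rule comV) (use that in simp_all)
    ultimately have "2 * m (D u) v $ 1 = 0" by simp
    then show ?thesis by simp
  qed
  have \<beta>sym: "m v w $ 1 *s D u = m u w $ 1 *s D v" if "u$1 = 0" "v$1 = 0" "w$1 = 0" for u v w
  proof -
    have "m u (m v w) = m v (m u w)" using LS[of u v w] comV[OF that(1,2)] by (simp add: algebra_simps)
    moreover have "m (m v w) u = m (m u w) v"
      using RC[of w v u] comV that by metis
    ultimately show ?thesis
      using swap[OF that(1), of "m v w"] swap[OF that(2), of "m u w"] by (simp add: algebra_simps)
  qed
  obtain u0' where "D (D u0') \<noteq> 0" using D2 by blast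
  define u0 where "u0 = D u0'"
  have u0: "u0$1 = 0" "D u0 \<noteq> 0" using \<open>D (D u0') \<noteq> 0\<close> by (simp_all add: u0_def)
  have \<beta>u0: "m u0 v $ 1 = 0" if "v$1 = 0" for v
  proof -
    have "u0 = D (u0' - u0'$1 *s e1)" by (simp add: u0_def D_lin De1)
    then show ?thesis using \<beta>D[of "u0' - u0'$1 *s e1" v] that by simp
  qed
  have \<beta>: "m v w $ 1 = 0" if "v$1 = 0" "w$1 = 0" for v w
    using \<beta>sym[of u0 v w] \<beta>u0[OF that(2)] u0 that by simp
  have sym2: "m u e1 $ 1 *s D v = m v e1 $ 1 *s D u" if "u$1 = 0" "v$1 = 0" for u v
  proof -
    have "m u (D v) = m (D v) u" "m (D u) v = m v (D u)" by (rule comV; use that in simp)+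
    then show ?thesis
      using II[OF that] II[OF that(2,1)] comV[OF that] by (metis add.commute add_left_imp_eq)
  qed
  have xx: "m e1 e1 = c *s e1 + (m e1 e1 - c *s e1)" by simp
  have w1: "(m e1 e1 - c *s e1) $ 1 = 0" by (simp add: c_def)
  have pD: "m (D u) e1 $ 1 = 0" if u: "u$1 = 0" for u
  proof -
    let ?p = "\<lambda>y. m y e1 $ 1" and ?\<eta> = "\<lambda>y :: 'f ^ 3. y - y$1 *s e1"
    have xxu: "m (m e1 e1) u $ 1 = c * ?p u"
      by (subst xx) (simp only: bil(1,3) e1y[of u] vector_add_component vector_smult_component \<beta>[OF w1 u] D1, simp)
    have "m (m e1 u) e1 = m (m e1 e1) u" by (rule RC)
    then have "?p (m e1 u) = c * ?p u" using xxu by simp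
    moreover have "?p (m e1 u) = ?p u * c + ?p (?\<eta> (m u e1)) + ?p (D u)"
      by (simp add: e1y[of u] bil c_def)
    ultimately have 1: "?p (?\<eta> (m u e1)) + ?p (D u) = 0" by (simp add: algebra_simps)
    have "m e1 (m u e1) - m u (m e1 e1) = m (D u) e1"
      using LS[of e1 u e1] by (simp add: e1y[of u] bil algebra_simps)
    then have "m e1 (m u e1) $ 1 - m u (m e1 e1) $ 1 = ?p (D u)"
      by (metis vector_minus_component)
    moreover have "m e1 (m u e1) $ 1 = ?p u * c + ?p (?\<eta> (m u e1))"
      by (simp add: e1y[of "m u e1"] bil c_def)
    moreover have "m u (m e1 e1) $ 1 = c * ?p u"
      by (subst xx) (simp only: bil(2,4) vector_add_component vector_smult_component \<beta>[OF u w1], simp)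
    ultimately have "?p (?\<eta> (m u e1)) = ?p (D u)" by (simp add: algebra_simps)
    then have "2 * ?p (D u) = 0" using 1 by simp
    then show ?thesis by simp
  qed
  have p: "m v e1 $ 1 = 0" if "v$1 = 0" for v
  proof -
    have "u0 = D (u0' - u0'$1 *s e1)" by (simp add: u0_def D_lin De1)
    then have "m u0 e1 $ 1 = 0" using pD[of "u0' - u0'$1 *s e1"] by simp
    then show ?thesis using sym2[OF that u0(1)] u0 by simp
  qed
  show "m u v = m v u \<and> m u v $ 1 = 0" if "u$1 = 0" "v$1 = 0" for u v
    using that comV \<beta> by blast
  show "m e1 u = m u e1 + D u \<and> m u e1 $ 1 = 0" if "u$1 = 0" for u
    using that p e1y by blast
  show Dm: "m (D u) v = m u (D v)" if "u$1 = 0" "v$1 = 0" for u v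
  proof -
    have "m (D u) v = m (D v) u" using I[OF that] p that by simp
    also have "\<dots> = m u (D v)" by (rule comV) (use that in simp_all)
    finally show ?thesis .
  qed
  show "D (m u v) = 2 *s m (D u) v" if "u$1 = 0" "v$1 = 0" for u v
    using II[OF that] p[OF that(1)] Dm[OF that] by (simp add: vec_eq_iff)
  let ?w = "m e1 e1 - c *s e1"
  have Qv: "m u e1 = c *s u + Q u" for u by (simp add: Q_def)
  have Q_lin: "Q (x + y) = Q x + Q y" "Q (k *s x) = k *s Q x" for x y k
    by (simp_all add: Q_def bil vec_eq_iff algebra_simps)
  have A: "Q (Q u) + c *s Q u + Q (D u) = m u ?w" if u: "u$1 = 0" for u
  proof -
    have "m (m e1 u) e1 = m (m e1 e1) u" by (rule RC)
    also have "\<dots> = c *s m e1 u + m ?w u" by (subst xx) (simp only: bil)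
    also have "m ?w u = m u ?w" using comV w1 u by blast
    finally show ?thesis by (simp add: e1y[of u] Qv Q_lin vec_eq_iff algebra_simps bil(1,3))
  qed
  show "Q (Q u) + c *s Q u + Q (D u) = m u ?w" if "u$1 = 0" for u by (rule A) fact
  show "D (Q u) = 2 *s Q (D u)" if u: "u$1 = 0" for u
  proof -
    have "m e1 (m u e1) - m u (m e1 e1) = m (D u) e1"
      using LS[of e1 u e1] by (simp add: e1y[of u] bil algebra_simps)
    moreover have "m u (m e1 e1) = c *s (c *s u + Q u) + m u ?w"
      by (subst xx) (simp only: bil Qv)
    moreover have "m e1 (m u e1)
        = c *s (c *s u + Q u) + (c *s Q u + Q (Q u)) + (c *s D u + D (Q u))"
      by (subst e1y) (simp only: Qv Q_lin D_lin)
    ultimately have "c *s (c *s u + Q u) + (c *s Q u + Q (Q u)) + (c *s D u + D (Q u))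
        - (c *s (c *s u + Q u) + (Q (Q u) + c *s Q u + Q (D u))) = c *s D u + Q (D u)"
      unfolding A[OF u] Qv[of "D u"] by simp
    then show ?thesis by (simp add: vec_eq_iff)
  qed
qed

text \<open>The same in coordinates: \<open>c\<close>, \<open>w\<close> describe \<open>e\<^sub>1 e\<^sub>1\<close>, the \<open>k\<^sub>i\<^sub>j\<close> are the entries of \<open>Q\<close>, and
  \<open>f, g, h\<close> are the products inside \<open>V\<close>.\<close>

lemma ideal_structure_coordinates:
  fixes m :: "'f::field_char_0 ^ 3 \<Rightarrow> 'f ^ 3 \<Rightarrow> 'f ^ 3"
  assumes m: "lie_shape p q r s m" and D2: "p * p + q * r \<noteq> 0 \<or> q * (p + s) \<noteq> 0 \<or> r * (p + s) \<noteq> 0 \<or> s * s + q * r \<noteq> 0"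
  obtains c w2 w3 k22 k32 k23 k33 f2 f3 g2 g3 h2 h3 where
    "\<And>x y. m x y = vector [c * x$1 * y$1,
       w2 * x$1 * y$1 + c * (x$1 * y$2 + x$2 * y$1) + x$1 * (p * y$2 + r * y$3)
         + k22 * (x$1 * y$2 + x$2 * y$1) + k23 * (x$1 * y$3 + x$3 * y$1)
         + f2 * x$2 * y$2 + g2 * (x$2 * y$3 + x$3 * y$2) + h2 * x$3 * y$3,
       w3 * x$1 * y$1 + c * (x$1 * y$3 + x$3 * y$1) + x$1 * (q * y$2 + s * y$3)
         + k32 * (x$1 * y$2 + x$2 * y$1) + k33 * (x$1 * y$3 + x$3 * y$1)
         + f3 * x$2 * y$2 + g3 * (x$2 * y$3 + x$3 * y$2) + h3 * x$3 * y$3]"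
    "p * k22 + r * k32 = 2 * (p * k22 + q * k23)" "q * k22 + s * k32 = 2 * (p * k32 + q * k33)"
    "p * k23 + r * k33 = 2 * (r * k22 + s * k23)" "q * k23 + s * k33 = 2 * (r * k32 + s * k33)"
    "p * f2 + r * f3 = 2 * (p * f2 + q * g2)" "q * f2 + s * f3 = 2 * (p * f3 + q * g3)"
    "p * g2 + r * g3 = 2 * (r * f2 + s * g2)" "q * g2 + s * g3 = 2 * (r * f3 + s * g3)"
    "p * g2 + r * g3 = 2 * (p * g2 + q * h2)" "q * g2 + s * g3 = 2 * (p * g3 + q * h3)"
    "p * h2 + r * h3 = 2 * (r * g2 + s * h2)" "q * h2 + s * h3 = 2 * (r * g3 + s * h3)"
    "k22 * k22 + k23 * k32 + c * k22 + p * k22 + q * k23 = w2 * f2 + w3 * g2"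
    "k32 * k22 + k33 * k32 + c * k32 + p * k32 + q * k33 = w2 * f3 + w3 * g3"
proof -
  let ?D = "\<lambda>y :: 'f ^ 3. vector [0, p * y$2 + r * y$3, q * y$2 + s * y$3] :: 'f ^ 3"
  have "\<exists>u. ?D (?D u) \<noteq> 0"
  proof (rule ccontr)
    assume "\<not> ?thesis"
    then have "?D (?D e2) = 0" "?D (?D e3) = 0" by blast+
    then show False using D2 by (simp add: vec3_eq_iff algebra_simps)
  qed
  note S = ideal_structure[OF m this]
  have N: "novikov3 m" using m by (simp add: lie_shape_def)
  note bil = novikov3D[OF N]
  define c where "c = m e1 e1 $ 1"
  have De: "?D e2 = p *s e2 + q *s e3" "?D e3 = r *s e2 + s *s e3" by (simp_all add: vec3_eq_iff)
  define w2 where "w2 = m e1 e1 $ 2"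
  define w3 where "w3 = m e1 e1 $ 3"
  define k22 where "k22 = m e2 e1 $ 2 - c"
  define k32 where "k32 = m e2 e1 $ 3"
  define k23 where "k23 = m e3 e1 $ 2"
  define k33 where "k33 = m e3 e1 $ 3 - c"
  define f2 where "f2 = m e2 e2 $ 2"
  define f3 where "f3 = m e2 e2 $ 3"
  define g2 where "g2 = m e2 e3 $ 2"
  define g3 where "g3 = m e2 e3 $ 3"
  define h2 where "h2 = m e3 e3 $ 2"
  define h3 where "h3 = m e3 e3 $ 3"
  have M: "m e1 e1 = c *s e1 + w2 *s e2 + w3 *s e3"
    "m e2 e1 = (c + k22) *s e2 + k32 *s e3" "m e3 e1 = k23 *s e2 + (c + k33) *s e3"
    "m e2 e2 = f2 *s e2 + f3 *s e3" "m e2 e3 = g2 *s e2 + g3 *s e3" "m e3 e3 = h2 *s e2 + h3 *s e3"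
    using S(1)[of e2 e2] S(1)[of e2 e3] S(1)[of e3 e2] S(1)[of e3 e3] S(2)[of e2] S(2)[of e3]
    by (simp_all add: vec3_eq_iff c_def w2_def w3_def k22_def k32_def k23_def k33_def f2_def f3_def
        g2_def g3_def h2_def h3_def)
  have M32: "m e3 e2 = g2 *s e2 + g3 *s e3" using S(1)[of e3 e2] M by simp
  have M1: "m e1 e2 = (c + k22 + p) *s e2 + (k32 + q) *s e3" "m e1 e3 = (k23 + r) *s e2 + (c + k33 + s) *s e3"
    using S(2)[of e2] S(2)[of e3] M by (simp_all add: vec3_eq_iff)
  have Q: "m e2 e1 - c *s e2 = k22 *s e2 + k32 *s e3" "m e3 e1 - c *s e3 = k23 *s e2 + k33 *s e3"
    by (simp_all add: M vec3_eq_iff algebra_simps)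
  note S' = S(3-6)[folded c_def]
  show thesis
  proof (rule that[of c w2 k22 k23 f2 g2 h2 w3 k32 k33 f3 g3 h3])
    fix x y :: "'f ^ 3"
    have "m x y = m (x$1 *s e1 + x$2 *s e2 + x$3 *s e3) (y$1 *s e1 + y$2 *s e2 + y$3 *s e3)"
      by (rule arg_cong2[where f = m]) (simp_all add: vec3_eq_iff)
    then show "m x y = vector [c * x$1 * y$1,
       w2 * x$1 * y$1 + c * (x$1 * y$2 + x$2 * y$1) + x$1 * (p * y$2 + r * y$3)
         + k22 * (x$1 * y$2 + x$2 * y$1) + k23 * (x$1 * y$3 + x$3 * y$1)
         + f2 * x$2 * y$2 + g2 * (x$2 * y$3 + x$3 * y$2) + h2 * x$3 * y$3,
       w3 * x$1 * y$1 + c * (x$1 * y$3 + x$3 * y$1) + x$1 * (q * y$2 + s * y$3)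
         + k32 * (x$1 * y$2 + x$2 * y$1) + k33 * (x$1 * y$3 + x$3 * y$1)
         + f3 * x$2 * y$2 + g3 * (x$2 * y$3 + x$3 * y$2) + h3 * x$3 * y$3]"
      unfolding bil M M1 M32 by (simp add: vec3_eq_iff algebra_simps)
  next
    show "p * k22 + r * k32 = 2 * (p * k22 + q * k23)" "q * k22 + s * k32 = 2 * (p * k32 + q * k33)"
      using S'(1)[of e2] unfolding De bil Q M by (simp_all add: vec3_eq_iff algebra_simps)
    show "p * k23 + r * k33 = 2 * (r * k22 + s * k23)" "q * k23 + s * k33 = 2 * (r * k32 + s * k33)"
      using S'(1)[of e3] unfolding De bil Q M by (simp_all add: vec3_eq_iff algebra_simps)
    show "p * f2 + r * f3 = 2 * (p * f2 + q * g2)" "q * f2 + s * f3 = 2 * (p * f3 + q * g3)"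
      using S'(3)[of e2 e2] unfolding De bil M M32 by (simp_all add: vec3_eq_iff algebra_simps)
    show "p * g2 + r * g3 = 2 * (r * f2 + s * g2)" "q * g2 + s * g3 = 2 * (r * f3 + s * g3)"
      using S'(3)[of e3 e2] unfolding De bil M M32 by (simp_all add: vec3_eq_iff algebra_simps)
    show "p * g2 + r * g3 = 2 * (p * g2 + q * h2)" "q * g2 + s * g3 = 2 * (p * g3 + q * h3)"
      using S'(3)[of e2 e3] unfolding De bil M M32 by (simp_all add: vec3_eq_iff algebra_simps)
    show "p * h2 + r * h3 = 2 * (r * g2 + s * h2)" "q * h2 + s * h3 = 2 * (r * g3 + s * h3)"
      using S'(3)[of e3 e3] unfolding De bil M M32 by (simp_all add: vec3_eq_iff algebra_simps)
    have w: "m e1 e1 - c *s e1 = w2 *s e2 + w3 *s e3" by (simp add: M)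
    show "k22 * k22 + k23 * k32 + c * k22 + p * k22 + q * k23 = w2 * f2 + w3 * g2"
      "k32 * k22 + k33 * k32 + c * k32 + p * k32 + q * k33 = w2 * f3 + w3 * g3"
      using S'(4)[of e2] unfolding De Q w bil M M32 by (simp_all add: vec3_eq_iff algebra_simps)
  qed
qed

lemma frameI_det:
  assumes "b1$1 * (b2$2 * b3$3 - b2$3 * b3$2) - b1$2 * (b2$1 * b3$3 - b2$3 * b3$1)
    + b1$3 * (b2$1 * b3$2 - b2$2 * b3$1) \<noteq> 0"
  shows "frame b1 b2 b3"
proof -
  have "frame (b1$1 *s e1 + b1$2 *s e2 + b1$3 *s e3) (b2$1 *s e1 + b2$2 *s e2 + b2$3 *s e3)
      (b3$1 *s e1 + b3$2 *s e2 + b3$3 *s e3)"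
    by (rule frame_change) (use assms in \<open>simp_all add: frame_def vec3_eq_iff\<close>)
  moreover have "b$1 *s e1 + b$2 *s e2 + b$3 *s e3 = b" for b :: "'a ^ 3" by (simp add: vec3_eq_iff)
  ultimately show ?thesis by metis
qed

lemma frameI:
  assumes "b2$1 = 0" "b3$1 = 0" "b1$1 \<noteq> 0" "b2$2 * b3$3 \<noteq> b2$3 * b3$2"
  shows "frame b1 b2 b3"
  by (rule frameI_det) (use assms in simp)

lemma iso3_frameI:
  fixes m :: "'f::field ^ 3 \<Rightarrow> 'f ^ 3 \<Rightarrow> 'f ^ 3" and b1 b2 b3 T
  defines "t \<equiv> \<lambda>x y. frame_map b1 b2 b3 (table_product T x y)"
  assumes N: "novikov3 m" and fr: "frame b1 b2 b3"
    and "m b1 b1 = t e1 e1" "m b1 b2 = t e1 e2" "m b1 b3 = t e1 e3"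
    and "m b2 b1 = t e2 e1" "m b2 b2 = t e2 e2" "m b2 b3 = t e2 e3"
    and "m b3 b1 = t e3 e1" "m b3 b2 = t e3 e2" "m b3 b3 = t e3 e3"
  shows "iso3 m (table_product T)"
proof (rule iso3_frame[OF fr])
  note bil = novikov3D[OF N]
  let ?g = "frame_map b1 b2 b3"
  fix x y
  have t: "t (x + y) z = t x z + t y z" "t z (x + y) = t z x + t z y"
    "t (c *s x) z = c *s t x z" "t z (c *s x) = c *s t z x" for x y z c
    unfolding t_def table_product_bilinear using linear_frame_map[of b1 b2 b3]
    by (simp_all add: Vector_Spaces.linear_iff)
  have "t x y = t (x$1 *s e1 + x$2 *s e2 + x$3 *s e3) (y$1 *s e1 + y$2 *s e2 + y$3 *s e3)"
    by (rule arg_cong2[where f = t]) (simp_all add: vec3_eq_iff)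
  also have "\<dots> = m (?g x) (?g y)"
    unfolding frame_map_def t bil assms(4-) ..
  finally show "?g (table_product T x y) = m (?g x) (?g y)" unfolding t_def .
qed

section \<open>Normal forms over the Lie algebras with non-nilpotent derivation\<close>

abbreviation classified :: "('f::field_char_0 ^ 3 \<Rightarrow> 'f ^ 3 \<Rightarrow> 'f ^ 3) \<Rightarrow> bool" where
  "classified m \<equiv> \<exists>N. listed N \<and> iso3 m (novikov_product N)"

lemma classifiedI:
  fixes N :: "'f::field_char_0 novikov_name"
  defines "t \<equiv> table_product (novikov_table N)"
  assumes "listed N" "novikov3 m" "frame b1 b2 b3"
    and "m b1 b1 = frame_map b1 b2 b3 (t e1 e1)" "m b1 b2 = frame_map b1 b2 b3 (t e1 e2)"
    "m b1 b3 = frame_map b1 b2 b3 (t e1 e3)" "m b2 b1 = frame_map b1 b2 b3 (t e2 e1)"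
    "m b2 b2 = frame_map b1 b2 b3 (t e2 e2)" "m b2 b3 = frame_map b1 b2 b3 (t e2 e3)"
    "m b3 b1 = frame_map b1 b2 b3 (t e3 e1)" "m b3 b2 = frame_map b1 b2 b3 (t e3 e2)"
    "m b3 b3 = frame_map b1 b2 b3 (t e3 e3)"
  shows "classified m"
  using iso3_frameI[OF assms(3-)[unfolded t_def]] assms(2) unfolding novikov_product_def by blast

text \<open>The algebras in which \<open>V\<close> is a zero algebra on which \<open>e\<^sub>1\<close> acts from the right by a scalar.\<close>

definition affine :: "'f::field \<Rightarrow> 'f \<Rightarrow> 'f \<Rightarrow> 'f \<Rightarrow> 'f \<Rightarrow> 'f \<Rightarrow> 'f \<Rightarrow> 'f ^ 3 \<Rightarrow> 'f ^ 3 \<Rightarrow> 'f ^ 3" where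
  "affine p q r s c w2 w3 x y = vector [c * x$1 * y$1,
     w2 * x$1 * y$1 + c * (x$1 * y$2 + x$2 * y$1) + x$1 * (p * y$2 + r * y$3),
     w3 * x$1 * y$1 + c * (x$1 * y$3 + x$3 * y$1) + x$1 * (q * y$2 + s * y$3)]"

lemma affine_case:
  fixes m :: "'f::field_char_0 ^ 3 \<Rightarrow> 'f ^ 3 \<Rightarrow> 'f ^ 3"
  assumes m: "lie_shape p q r s m"
    and nz: "(p * s - q * r) * (9 * (p * s - q * r) - 2 * (p + s)\<^sup>2) \<noteq> 0"
  shows "\<exists>c w2 w3. m = affine p q r s c w2 w3"
proof -
  have "p * p + q * r \<noteq> 0 \<or> q * (p + s) \<noteq> 0 \<or> r * (p + s) \<noteq> 0 \<or> s * s + q * r \<noteq> 0"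
  proof (rule ccontr)
    assume "\<not> ?thesis"
    then have E: "p * p + q * r = 0" "q * (p + s) = 0" "r * (p + s) = 0" "s * s + q * r = 0" by auto
    have "(p * s - q * r) * (p * s - q * r) = (p * p + q * r) * (s * s + q * r) - q * (p + s) * (r * (p + s))"
      by (simp add: algebra_simps)
    then show False using nz unfolding E by simp
  qed
  from ideal_structure_coordinates[OF m this]
  obtain c w2 w3 k22 k32 k23 k33 f2 f3 g2 g3 h2 h3 where
    M: "\<And>x y. m x y = vector [c * x$1 * y$1,
       w2 * x$1 * y$1 + c * (x$1 * y$2 + x$2 * y$1) + x$1 * (p * y$2 + r * y$3)
         + k22 * (x$1 * y$2 + x$2 * y$1) + k23 * (x$1 * y$3 + x$3 * y$1)
         + f2 * x$2 * y$2 + g2 * (x$2 * y$3 + x$3 * y$2) + h2 * x$3 * y$3,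
       w3 * x$1 * y$1 + c * (x$1 * y$3 + x$3 * y$1) + x$1 * (q * y$2 + s * y$3)
         + k32 * (x$1 * y$2 + x$2 * y$1) + k33 * (x$1 * y$3 + x$3 * y$1)
         + f3 * x$2 * y$2 + g3 * (x$2 * y$3 + x$3 * y$2) + h3 * x$3 * y$3]" and
    Q: "p * k22 + r * k32 = 2 * (p * k22 + q * k23)" "q * k22 + s * k32 = 2 * (p * k32 + q * k33)"
    "p * k23 + r * k33 = 2 * (r * k22 + s * k23)" "q * k23 + s * k33 = 2 * (r * k32 + s * k33)" and
    F: "p * f2 + r * f3 = 2 * (p * f2 + q * g2)" "q * f2 + s * f3 = 2 * (p * f3 + q * g3)"
    "p * g2 + r * g3 = 2 * (r * f2 + s * g2)" "q * g2 + s * g3 = 2 * (r * f3 + s * g3)" and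
    H: "p * g2 + r * g3 = 2 * (p * g2 + q * h2)" "q * g2 + s * g3 = 2 * (p * g3 + q * h3)"
    "p * h2 + r * h3 = 2 * (r * g2 + s * h2)" "q * h2 + s * h3 = 2 * (r * g3 + s * h3)"
    by metis
  have "k22 = 0" "k32 = 0" "k23 = 0" "k33 = 0" "f2 = 0" "f3 = 0" "g2 = 0" "g3 = 0" "h2 = 0" "h3 = 0"
    using no_eigenvalue_doubling[OF Q nz] no_eigenvalue_doubling[OF F nz]
      no_eigenvalue_doubling[OF H nz] by auto
  then have "m = affine p q r s c w2 w3" by (simp add: fun_eq_iff M affine_def)
  then show ?thesis by blast
qed

lemmas table_simps = table_product_def frame_map_def vec3_eq_iff

lemma affine_scalar_classified:
  assumes N: "novikov3 (affine 1 0 0 1 c w2 w3)"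
  shows "classified (affine 1 0 0 1 c w2 w3)"
proof (cases "c = - 1")
  case False
  then have c: "c + 1 \<noteq> 0" by (simp add: eq_neg_iff_add_eq_0)
  define v2 where "v2 = - w2 / (c + 1)"
  define v3 where "v3 = - w3 / (c + 1)"
  have "(c + 1) * v2 = - w2" "(c + 1) * v3 = - w3" using c by (simp_all add: v2_def v3_def)
  then have w: "w2 = - ((c + 1) * v2)" "w3 = - ((c + 1) * v3)" by simp_all
  show ?thesis unfolding w
    by (rule classifiedI[where N = "N1_1 c" and ?b1.0 = "vector [1, v2, v3]" and ?b2.0 = e2 and ?b3.0 = e3])
      (use N w in \<open>simp_all add: frameI affine_def table_simps algebra_simps\<close>)
next
  case c: True
  show ?thesis
  proof (cases "w2 = 0 \<and> w3 = 0")
    case True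
    show ?thesis
      by (rule classifiedI[OF _ N, where N = "N1_1 c" and ?b1.0 = e1 and ?b2.0 = e2 and ?b3.0 = e3])
        (simp_all add: frameI affine_def table_simps True)
  next
    case False
    let ?b = "if w2 = 0 then e2 else e3"
    show ?thesis
      by (rule classifiedI[OF _ N, where N = N1_2 and ?b1.0 = e1 and ?b2.0 = "vector [0, w2, w3]" and ?b3.0 = ?b])
        (use False c in \<open>auto simp add: affine_def table_simps intro!: frameI\<close>)
  qed
qed

lemma affine_trace_one_classified:
  assumes N: "novikov3 (affine 0 1 \<alpha> 1 c w2 w3)"
  shows "classified (affine 0 1 \<alpha> 1 c w2 w3)"
proof (cases "c\<^sup>2 + c = \<alpha>")
  case False
  define \<delta> where "\<delta> = c\<^sup>2 + c - \<alpha>"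
  have \<delta>: "\<delta> \<noteq> 0" using False by (simp add: \<delta>_def)
  define v2 where "v2 = (\<alpha> * w3 - (1 + c) * w2) / \<delta>"
  define v3 where "v3 = (w2 - c * w3) / \<delta>"
  have "\<delta> * w2 = \<delta> * (- c * v2 - \<alpha> * v3)"
    using \<delta> by (simp add: v2_def v3_def field_simps) (simp add: \<delta>_def algebra_simps power2_eq_square)
  moreover have "\<delta> * w3 = \<delta> * (- v2 - (1 + c) * v3)"
    using \<delta> by (simp add: v2_def v3_def field_simps) (simp add: \<delta>_def algebra_simps power2_eq_square)
  ultimately have w: "w2 = - c * v2 - \<alpha> * v3" "w3 = - v2 - (1 + c) * v3" using \<delta> by simp_all
  show ?thesis unfolding w
    by (rule classifiedI[where N = "N2_1 \<alpha> c" and ?b1.0 = "vector [1, v2, v3]" and ?b2.0 = e2 and ?b3.0 = e3])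
      (use N w in \<open>simp_all add: frameI affine_def table_simps algebra_simps\<close>)
next
  case c: True
  define k where "k = w2 - c * w3"
  have w2: "w2 = k + c * w3" by (simp add: k_def)
  show ?thesis
  proof (cases "k = 0")
    case True
    show ?thesis
      by (rule classifiedI[OF _ N, where N = "N2_1 \<alpha> c" and ?b1.0 = "vector [1, - w3, 0]" and ?b2.0 = e2 and ?b3.0 = e3])
        (simp_all add: frameI affine_def table_simps True w2 algebra_simps)
  next
    case False
    show ?thesis
      by (rule classifiedI[OF _ N, where N = "N2_2 \<alpha> c" and ?b1.0 = "vector [1, - w3, 0]" and ?b2.0 = "k *s e2" and ?b3.0 = "k *s e3"])
        (use False c in \<open>simp_all add: frameI affine_def table_simps w2 algebra_simps\<close>)
  qed
qed

lemma affine_trace_zero_classified: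
  fixes \<beta> :: "'f::field_char_0"
  assumes N: "novikov3 (affine 0 1 \<beta> 0 c w2 w3)" and \<beta>: "\<beta> = 1 \<or> \<beta> = - 1 \<and> (\<nexists>i. i\<^sup>2 = (- 1 :: 'f))"
  shows "classified (affine 0 1 \<beta> 0 c w2 w3)"
proof (cases "c\<^sup>2 = \<beta>")
  case False
  define \<delta> where "\<delta> = c\<^sup>2 - \<beta>"
  have \<delta>: "\<delta> \<noteq> 0" using False by (simp add: \<delta>_def)
  define v2 where "v2 = (\<beta> * w3 - c * w2) / \<delta>"
  define v3 where "v3 = (w2 - c * w3) / \<delta>"
  have "\<delta> * w2 = \<delta> * (- c * v2 - \<beta> * v3)"
    using \<delta> by (simp add: v2_def v3_def field_simps) (simp add: \<delta>_def algebra_simps power2_eq_square)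
  moreover have "\<delta> * w3 = \<delta> * (- v2 - c * v3)"
    using \<delta> by (simp add: v2_def v3_def field_simps) (simp add: \<delta>_def algebra_simps power2_eq_square)
  ultimately have w: "w2 = - c * v2 - \<beta> * v3" "w3 = - v2 - c * v3" using \<delta> by simp_all
  from \<beta> show ?thesis
  proof
    assume [simp]: "\<beta> = 1"
    show ?thesis unfolding w
      by (rule classifiedI[where N = "N4_1 c" and ?b1.0 = "vector [1, v2, v3]" and ?b2.0 = e2 and ?b3.0 = e3])
        (use N w in \<open>simp_all add: frameI affine_def table_simps algebra_simps\<close>)
  next
    assume "\<beta> = - 1 \<and> (\<nexists>i. i\<^sup>2 = (- 1 :: 'f))"
    then have [simp]: "\<beta> = - 1" by simp
    show ?thesis unfolding w
      by (rule classifiedI[where N = "N5_1 c" and ?b1.0 = "vector [1, v2, v3]" and ?b2.0 = e2 and ?b3.0 = e3])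
        (use N w in \<open>simp_all add: frameI affine_def table_simps algebra_simps\<close>)
  qed
next
  case True
  then have [simp]: "\<beta> = 1" using \<beta> by auto
  then have "c = 1 \<or> c = - 1" using True by (simp add: power2_eq_1_iff)
  then show ?thesis
  proof
    assume c: "c = 1"
    show ?thesis
    proof (cases "w3 = w2")
      case True
      show ?thesis
        by (rule classifiedI[OF _ N, where N = "N4_1 c" and ?b1.0 = "vector [1, - w2, 0]" and ?b2.0 = e2 and ?b3.0 = e3])
          (simp_all add: frameI affine_def table_simps True c)
    next
      case False
      define k where "k = w3 - w2"
      have w3: "w3 = w2 + k" and k: "k \<noteq> 0" using False by (simp_all add: k_def)
      show ?thesis
        by (rule classifiedI[OF _ N, where N = N4_2 and ?b1.0 = "vector [1, - w2, 0]"
              and ?b2.0 = "k *s e2" and ?b3.0 = "k *s e3"])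
          (use k c in \<open>simp_all add: frameI affine_def table_simps w3\<close>)
    qed
  next
    assume c: "c = - 1"
    show ?thesis
    proof (cases "w3 + w2 = 0")
      case True
      then have w3: "w3 = - w2" by (simp add: eq_neg_iff_add_eq_0)
      show ?thesis
        by (rule classifiedI[OF _ N, where N = "N4_1 c" and ?b1.0 = "vector [1, w2, 0]" and ?b2.0 = e2 and ?b3.0 = e3])
          (simp_all add: frameI affine_def table_simps w3 c)
    next
      case False
      define k where "k = w3 + w2"
      have w3: "w3 = k - w2" and k: "k \<noteq> 0" using False by (simp_all add: k_def)
      show ?thesis
        by (rule classifiedI[OF _ N, where N = N4_2 and ?b1.0 = "vector [- 1, - w2, 0]"
              and ?b2.0 = "(- k) *s e2" and ?b3.0 = "k *s e3"])
          (use k c in \<open>simp_all add: frameI affine_def table_simps w3\<close>)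
    qed
  qed
qed

subsection \<open>Eigenvalues \<open>1/3\<close> and \<open>2/3\<close>\<close>

text \<open>Here \<open>D\<close> is diagonal on eigenvectors \<open>f\<^sub>1 = e\<^sub>2\<close>, \<open>f\<^sub>2 = e\<^sub>3\<close>; eigenvalue doubling leaves the
  entry \<open>Q f\<^sub>1 = s f\<^sub>2\<close> and the product \<open>f\<^sub>1 f\<^sub>1 = b f\<^sub>2\<close>.\<close>

definition diag3 :: "'f::field_char_0 \<Rightarrow> 'f \<Rightarrow> 'f \<Rightarrow> 'f \<Rightarrow> 'f \<Rightarrow> 'f ^ 3 \<Rightarrow> 'f ^ 3 \<Rightarrow> 'f ^ 3" where
  "diag3 c s b w2 w3 x y = vector [c * x$1 * y$1,
     w2 * x$1 * y$1 + c * (x$1 * y$2 + x$2 * y$1) + x$1 * y$2 / 3,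
     w3 * x$1 * y$1 + c * (x$1 * y$3 + x$3 * y$1) + 2 * x$1 * y$3 / 3
       + s * (x$1 * y$2 + x$2 * y$1) + b * x$2 * y$2]"

lemma diag3_case:
  fixes m :: "'f::field_char_0 ^ 3 \<Rightarrow> 'f ^ 3 \<Rightarrow> 'f ^ 3"
  assumes m: "lie_shape (1/3) 0 0 (2/3) m"
  shows "\<exists>c s b w2 w3. m = diag3 c s b w2 w3 \<and> (c + 1/3) * s = b * w2"
proof -
  have "(1/3 :: 'f) * (1/3) + 0 * 0 \<noteq> 0 \<or> 0 * (1/3 + 2/3) \<noteq> (0::'f) \<or> 0 * (1/3 + 2/3) \<noteq> (0::'f)
      \<or> (2/3) * (2/3) + 0 * 0 \<noteq> (0::'f)" by simp
  from ideal_structure_coordinates[OF m this]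
  obtain c w2 w3 k22 k32 k23 k33 f2 f3 g2 g3 h2 h3 where
    M: "\<And>x y. m x y = vector [c * x$1 * y$1,
       w2 * x$1 * y$1 + c * (x$1 * y$2 + x$2 * y$1) + x$1 * (1/3 * y$2 + 0 * y$3)
         + k22 * (x$1 * y$2 + x$2 * y$1) + k23 * (x$1 * y$3 + x$3 * y$1)
         + f2 * x$2 * y$2 + g2 * (x$2 * y$3 + x$3 * y$2) + h2 * x$3 * y$3,
       w3 * x$1 * y$1 + c * (x$1 * y$3 + x$3 * y$1) + x$1 * (0 * y$2 + 2/3 * y$3)
         + k32 * (x$1 * y$2 + x$2 * y$1) + k33 * (x$1 * y$3 + x$3 * y$1)
         + f3 * x$2 * y$2 + g3 * (x$2 * y$3 + x$3 * y$2) + h3 * x$3 * y$3]" and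
    Q: "1/3 * k22 + 0 * k32 = 2 * (1/3 * k22 + 0 * k23)" "1/3 * k23 + 0 * k33 = 2 * (0 * k22 + 2/3 * k23)"
      "0 * k23 + 2/3 * k33 = 2 * (0 * k32 + 2/3 * k33)" and
    F: "1/3 * f2 + 0 * f3 = 2 * (1/3 * f2 + 0 * g2)" "1/3 * g2 + 0 * g3 = 2 * (0 * f2 + 2/3 * g2)"
      "0 * g2 + 2/3 * g3 = 2 * (0 * f3 + 2/3 * g3)" "1/3 * h2 + 0 * h3 = 2 * (0 * g2 + 2/3 * h2)"
      "0 * h2 + 2/3 * h3 = 2 * (0 * g3 + 2/3 * h3)" and
    W: "k32 * k22 + k33 * k32 + c * k32 + 1/3 * k32 + 0 * k33 = w2 * f3 + w3 * g3"
    by metis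
  have z: "k22 = 0" "k23 = 0" "k33 = 0" "f2 = 0" "g2 = 0" "g3 = 0" "h2 = 0" "h3 = 0"
    using Q F by simp_all
  have "m = diag3 c k32 f3 w2 w3" by (simp add: fun_eq_iff M diag3_def z vec3_eq_iff)
  moreover have "(c + 1/3) * k32 = f3 * w2" using W by (simp add: z algebra_simps)
  ultimately show ?thesis by blast
qed

text \<open>Replacing \<open>e\<^sub>1\<close> by \<open>e\<^sub>1 + r\<^sub>1 f\<^sub>1 + r\<^sub>2 f\<^sub>2\<close> changes \<open>s\<close> by \<open>b r\<^sub>1\<close>, \<open>w\<^sub>2\<close> by \<open>(c + 1/3) r\<^sub>1\<close> and \<open>w\<^sub>3\<close> by
  \<open>(c + 2/3) r\<^sub>2 + 2 s r\<^sub>1 + b r\<^sub>1\<^sup>2\<close>.  The basis of the table is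
  \<open>e\<^sub>2 = f\<^sub>1 + f\<^sub>2\<close>, \<open>e\<^sub>3 = f\<^sub>1/3 + 2 f\<^sub>2/3\<close> for suitably scaled eigenvectors.\<close>

lemma diag3_classified:
  fixes c :: "'f::field_char_0"
  assumes N: "novikov3 (diag3 c s b w2 w3)" and rel: "(c + 1/3) * s = b * w2"
    and sq: "\<And>y :: 'f. \<exists>t. y = t\<^sup>2 \<or> y = - t\<^sup>2" and two: "\<exists>j :: 'f. j\<^sup>2 = 2"
  shows "classified (diag3 c s b w2 w3)"
proof (cases "b = 0")
  case b: True
  show ?thesis
  proof (cases "s = 0")
    case s: True
    consider "c \<noteq> -1/3" "c \<noteq> -2/3" | "c = -1/3" "w2 = 0" | "c = -1/3" "w2 \<noteq> 0" 
      | "c = -2/3" "w3 = 0" | "c = -2/3" "w3 \<noteq> 0" by blast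
    then show ?thesis
    proof cases
      case 1
      then have "c + 1/3 \<noteq> 0" "c + 2/3 \<noteq> 0" by (simp_all add: add_eq_0_iff2)
      then obtain v2 v3 where w: "w2 = - ((c + 1/3) * v2)" "w3 = - ((c + 2/3) * v3)"
        by (metis minus_minus mult_minus_right nonzero_mult_div_cancel_left times_divide_eq_right)
      show ?thesis
        by (rule classifiedI[OF _ N, where N = "N2_1 (-2/9) c" and ?b1.0 = "vector [1, v2, v3]"
              and ?b2.0 = "vector [0, 1, 1]" and ?b3.0 = "vector [0, 1/3, 2/3]"];
          simp add: frameI diag3_def table_simps w b s; simp add: field_simps)
    next
      case 2
      show ?thesis
        by (rule classifiedI[OF _ N, where N = "N2_1 (-2/9) c" and ?b1.0 = "vector [1, 0, - 3 * w3]"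
              and ?b2.0 = "vector [0, 1, 1]" and ?b3.0 = "vector [0, 1/3, 2/3]"];
          simp add: frameI diag3_def table_simps 2 b s; simp add: field_simps)
    next
      case 3
      show ?thesis
        by (rule classifiedI[OF _ N, where N = "N2_2 (-2/9) c" and ?b1.0 = "vector [1, 0, 3 - 3 * w3]"
              and ?b2.0 = "vector [0, w2, 1]" and ?b3.0 = "vector [0, w2/3, 2/3]"];
          use 3 in \<open>simp add: frameI diag3_def table_simps 3 b s power2_eq_square; simp add: field_simps\<close>)
    next
      case 4
      show ?thesis
        by (rule classifiedI[OF _ N, where N = "N2_1 (-2/9) c" and ?b1.0 = "vector [1, 3 * w2, 0]"
              and ?b2.0 = "vector [0, 1, 1]" and ?b3.0 = "vector [0, 1/3, 2/3]"];
          simp add: frameI diag3_def table_simps 4 b s; simp add: field_simps)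
    next
      case 5
      show ?thesis
        by (rule classifiedI[OF _ N, where N = "N2_2 (-2/9) c" and ?b1.0 = "vector [1, 3 * w2 - 3, 0]"
              and ?b2.0 = "vector [0, 1, w3]" and ?b3.0 = "vector [0, 1/3, 2 * w3/3]"];
          use 5 in \<open>simp add: frameI diag3_def table_simps 5 b s power2_eq_square; simp add: field_simps\<close>)
    qed
  next
    case s: False
    then have c: "c = - 1/3" using rel b by (simp add: add_eq_0_iff2)
    show ?thesis
    proof (cases "w2 = 0")
      case True
      show ?thesis
        by (rule classifiedI[OF _ N, where N = N2_3 and ?b1.0 = "vector [1, 0, - 3 * w3]"
              and ?b2.0 = "vector [0, 1, - s/3]" and ?b3.0 = "vector [0, 1/3, - 2 * s/9]"];
          use s in \<open>simp add: frameI diag3_def table_simps True b c; simp add: field_simps\<close>)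
    next
      case False
      show ?thesis
        by (rule classifiedI[OF _ N, where N = N2_4 and ?b1.0 = "vector [1, 0, - s * w2 - 3 * w3]"
              and ?b2.0 = "vector [0, w2, - s * w2/3]" and ?b3.0 = "vector [0, w2/3, - 2 * s * w2/9]"];
          use s False in \<open>simp add: frameI diag3_def table_simps b c; simp add: field_simps\<close>)
    qed
  qed
next
  case b: False
  \<comment> \<open>Translating \<open>e\<^sub>1\<close> by a multiple of the first eigenvector shifts \<open>s\<close> by multiples of \<open>b\<close>.\<close>
  define v where "v = s / b"
  have s: "s = b * v" using b by (simp add: v_def)
  have w2: "w2 = (c + 1/3) * v" using rel b by (simp add: s)
  show ?thesis
  proof (cases "c = - 2/3")
    case False
    define a where "a = c / 3"
    have c: "c = 3 * a" by (simp add: a_def)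
    have "c + 2/3 \<noteq> 0" using False by (simp add: add_eq_0_iff2)
    then obtain u where "u * (c + 2/3) = (- 3 * a\<^sup>2 - a / 3) * (b/3) - w3 - 2 * s * (- a - v) - b * (- a - v)\<^sup>2"
      by (metis nonzero_divide_eq_eq)
    then have w3: "w3 = (- 3 * a\<^sup>2 - a / 3) * (b/3) - 2 * s * (- a - v) - b * (- a - v)\<^sup>2 - u * (3 * a + 2/3)"
      by (simp add: c algebra_simps)
    show ?thesis
      by (rule classifiedI[OF _ N, where N = "N2_5 a" and ?b1.0 = "vector [1, - a - v, u]"
            and ?b2.0 = "vector [0, 1, b/3]" and ?b3.0 = "vector [0, 1/3, 2 * b/9]"];
        use b in \<open>simp add: frameI diag3_def table_simps c s w2 w3; simp add: field_simps power2_eq_square\<close>)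
  next
    case c: True
    \<comment> \<open>Once \<open>s\<close> and \<open>w\<^sub>2\<close> are removed, \<open>w\<^sub>3/b\<close> is the invariant \<open>w\<close>, defined up to squares.\<close>
    define w where "w = (w3 - b * v\<^sup>2) / b"
    have w3: "w3 = b * w + b * v\<^sup>2" using b by (simp add: w_def)
    obtain t where "27 * w = t\<^sup>2 \<or> 27 * w = - t\<^sup>2" using sq by blast
    then have t: "w = t\<^sup>2 / 27 \<or> w = - t\<^sup>2 / 27"
      by (metis nonzero_mult_div_cancel_left zero_neq_numeral)
    consider "w = 0" | "w \<noteq> 0" "w = t\<^sup>2 / 27" | "w \<noteq> 0" "w = - t\<^sup>2 / 27" using t by blast
    then show ?thesis
    proof cases
      case 1
      show ?thesis
        by (rule classifiedI[OF _ N, where N = N2_6 and ?b1.0 = "vector [1, 2/9 - v, 0]"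
              and ?b2.0 = "vector [0, 1, b/3]" and ?b3.0 = "vector [0, 1/3, 2 * b/9]"];
          use b in \<open>simp add: frameI diag3_def table_simps c s w2 w3 1; simp add: field_simps power2_eq_square\<close>)
    next
      case 2
      then have "t \<noteq> 0" by auto
      show ?thesis
        by (rule classifiedI[OF _ N, where N = N2_7 and ?b1.0 = "vector [1, 2 * t/9 - v, 0]"
              and ?b2.0 = "vector [0, t, b * t\<^sup>2/3]" and ?b3.0 = "vector [0, t/3, 2 * b * t\<^sup>2/9]"];
          use b \<open>t \<noteq> 0\<close> in \<open>simp add: frameI diag3_def table_simps c s w2 w3 2(2); simp add: field_simps power2_eq_square\<close>)
    next
      case 3
      obtain j where j: "j\<^sup>2 = (2 :: 'f)" using two by blast
      define r where "r = t / j"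
      have "t\<^sup>2 = 2 * r\<^sup>2" by (simp add: r_def power_divide j)
      then have w: "w = - 2 * r\<^sup>2 / 27" using 3 by simp
      then have "r \<noteq> 0" using 3 by auto
      show ?thesis
        by (rule classifiedI[OF _ N, where N = "N2_5 (- 2/9)" and ?b1.0 = "vector [1, 2 * r/9 - v, 0]"
              and ?b2.0 = "vector [0, r, b * r\<^sup>2/3]" and ?b3.0 = "vector [0, r/3, 2 * b * r\<^sup>2/9]"];
          use b \<open>r \<noteq> 0\<close> in \<open>simp add: frameI diag3_def table_simps c s w2 w3 w; simp add: field_simps power2_eq_square\<close>)
    qed
  qed
qed

subsection \<open>Eigenvalues \<open>0\<close> and \<open>1\<close>\<close>

text \<open>The eigenvectors are now the central \<open>e\<^sub>2\<close> and \<open>e\<^sub>3\<close>.  As \<open>0\<close> is its own double, what is left is the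
  entry \<open>Q e\<^sub>2 = s e\<^sub>2\<close> and the product \<open>e\<^sub>2 e\<^sub>2 = b e\<^sub>2\<close>.\<close>

definition diag0 :: "'f::field_char_0 \<Rightarrow> 'f \<Rightarrow> 'f \<Rightarrow> 'f \<Rightarrow> 'f \<Rightarrow> 'f ^ 3 \<Rightarrow> 'f ^ 3 \<Rightarrow> 'f ^ 3" where
  "diag0 c s b w2 w3 x y = vector [c * x$1 * y$1,
     w2 * x$1 * y$1 + (c + s) * (x$1 * y$2 + x$2 * y$1) + b * x$2 * y$2,
     w3 * x$1 * y$1 + c * (x$1 * y$3 + x$3 * y$1) + x$1 * y$3]"

lemma diag0_case:
  fixes m :: "'f::field_char_0 ^ 3 \<Rightarrow> 'f ^ 3 \<Rightarrow> 'f ^ 3"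
  assumes m: "lie_shape 0 0 0 1 m"
  shows "\<exists>c s b w2 w3. m = diag0 c s b w2 w3 \<and> s * (s + c) = b * w2"
proof -
  have "(0 :: 'f) * 0 + 0 * 0 \<noteq> 0 \<or> 0 * (0 + 1) \<noteq> (0::'f) \<or> 0 * (0 + 1) \<noteq> (0::'f)
      \<or> 1 * 1 + 0 * 0 \<noteq> (0::'f)" by simp
  from ideal_structure_coordinates[OF m this]
  obtain c w2 w3 k22 k32 k23 k33 f2 f3 g2 g3 h2 h3 where
    M: "\<And>x y. m x y = vector [c * x$1 * y$1,
       w2 * x$1 * y$1 + c * (x$1 * y$2 + x$2 * y$1) + x$1 * (0 * y$2 + 0 * y$3)
         + k22 * (x$1 * y$2 + x$2 * y$1) + k23 * (x$1 * y$3 + x$3 * y$1)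
         + f2 * x$2 * y$2 + g2 * (x$2 * y$3 + x$3 * y$2) + h2 * x$3 * y$3,
       w3 * x$1 * y$1 + c * (x$1 * y$3 + x$3 * y$1) + x$1 * (0 * y$2 + 1 * y$3)
         + k32 * (x$1 * y$2 + x$2 * y$1) + k33 * (x$1 * y$3 + x$3 * y$1)
         + f3 * x$2 * y$2 + g3 * (x$2 * y$3 + x$3 * y$2) + h3 * x$3 * y$3]" and
    Q: "0 * k22 + 1 * k32 = 2 * (0 * k32 + 0 * k33)" "0 * k23 + 0 * k33 = 2 * (0 * k22 + 1 * k23)"
      "0 * k23 + 1 * k33 = 2 * (0 * k32 + 1 * k33)" and
    F: "0 * f2 + 1 * f3 = 2 * (0 * f3 + 0 * g3)" "0 * g2 + 0 * g3 = 2 * (0 * f2 + 1 * g2)"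
      "0 * g2 + 1 * g3 = 2 * (0 * f3 + 1 * g3)" "0 * h2 + 0 * h3 = 2 * (0 * g2 + 1 * h2)"
      "0 * h2 + 1 * h3 = 2 * (0 * g3 + 1 * h3)" and
    W: "k22 * k22 + k23 * k32 + c * k22 + 0 * k22 + 0 * k23 = w2 * f2 + w3 * g2"
    by metis
  have z: "k32 = 0" "k23 = 0" "k33 = 0" "f3 = 0" "g2 = 0" "g3 = 0" "h2 = 0" "h3 = 0"
    using Q F by simp_all
  have "m = diag0 c k22 f2 w2 w3" by (simp add: fun_eq_iff M diag0_def z vec3_eq_iff algebra_simps)
  moreover have "k22 * (k22 + c) = f2 * w2" using W by (simp add: z algebra_simps)
  ultimately show ?thesis by blast
qed

text \<open>Replacing \<open>e\<^sub>1\<close> by \<open>e\<^sub>1 + r\<^sub>2 e\<^sub>2 + r\<^sub>3 e\<^sub>3\<close> changes \<open>s\<close> by \<open>b r\<^sub>2\<close>, \<open>w\<^sub>2\<close> by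
  \<open>(c + 2 s) r\<^sub>2 + b r\<^sub>2\<^sup>2\<close> and \<open>w\<^sub>3\<close> by \<open>(c + 1) r\<^sub>3\<close>.  The basis of the table is obtained by
  adding \<open>e\<^sub>3\<close> to \<open>e\<^sub>2\<close>, after scaling.\<close>

lemma diag0_classified:
  fixes c :: "'f::field_char_0"
  assumes N: "novikov3 (diag0 c s b w2 w3)" and rel: "s * (s + c) = b * w2"
  shows "classified (diag0 c s b w2 w3)"
proof (cases "b = 0")
  case b: True
  show ?thesis
  proof (cases "s = 0")
    case s: True
    consider "c \<noteq> 0" "c \<noteq> -1" | "c = 0" "w2 = 0" | "c = 0" "w2 \<noteq> 0" 
      | "c = -1" "w3 = 0" | "c = -1" "w3 \<noteq> 0" by blast
    then show ?thesis
    proof cases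
      case 1
      then have "c \<noteq> 0" "c + 1 \<noteq> 0" by (simp_all add: add_eq_0_iff2)
      then obtain v2 v3 where w: "w2 = - (c * v2)" "w3 = - ((c + 1) * v3)"
        by (metis minus_minus mult_minus_right nonzero_mult_div_cancel_left times_divide_eq_right)
      show ?thesis
        by (rule classifiedI[OF _ N, where N = "N2_1 0 c" and ?b1.0 = "vector [1, v2, v3]"
              and ?b2.0 = "vector [0, 1, 1]" and ?b3.0 = e3];
          simp add: frameI diag0_def table_simps w b s; simp add: field_simps)
    next
      case 2
      show ?thesis
        by (rule classifiedI[OF _ N, where N = "N2_1 0 c" and ?b1.0 = "vector [1, 0, - w3]"
              and ?b2.0 = "vector [0, 1, 1]" and ?b3.0 = e3])
          (simp_all add: frameI diag0_def table_simps 2 b s)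
    next
      case 3
      show ?thesis
        by (rule classifiedI[OF _ N, where N = "N2_2 0 c" and ?b1.0 = "vector [1, 0, 1 - w3]"
              and ?b2.0 = "vector [0, w2, 1]" and ?b3.0 = e3])
          (use 3 in \<open>simp_all add: frameI diag0_def table_simps b s\<close>)
    next
      case 4
      show ?thesis
        by (rule classifiedI[OF _ N, where N = "N2_1 0 c" and ?b1.0 = "vector [1, w2, 0]"
              and ?b2.0 = "vector [0, 1, 1]" and ?b3.0 = e3])
          (simp_all add: frameI diag0_def table_simps 4 b s)
    next
      case 5
      show ?thesis
        by (rule classifiedI[OF _ N, where N = "N2_2 0 c" and ?b1.0 = "vector [1, w2 - 1, 0]"
              and ?b2.0 = "vector [0, 1, w3]" and ?b3.0 = "w3 *s e3"])
          (use 5 in \<open>simp_all add: frameI diag0_def table_simps b s\<close>)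
    qed
  next
    case False
    then have s: "s = - c" "c \<noteq> 0" using rel b by (auto simp: add_eq_0_iff2)
    define v where "v = w2 / c"
    have w2: "w2 = c * v" using s by (simp add: v_def)
    consider "c \<noteq> - 1" | "c = - 1" "w3 = 0" | "c = - 1" "w3 \<noteq> 0" by blast
    then show ?thesis
    proof cases
      case 1
      then have "c + 1 \<noteq> 0" by (simp add: add_eq_0_iff2)
      then obtain v3 where w3: "w3 = - ((c + 1) * v3)"
        by (metis minus_minus mult_minus_right nonzero_mult_div_cancel_left times_divide_eq_right)
      show ?thesis
        by (rule classifiedI[OF _ N, where N = "N2_8 c" and ?b1.0 = "vector [1, v, v3]"
              and ?b2.0 = "vector [0, 1, 1]" and ?b3.0 = e3];
          use s in \<open>simp add: frameI diag0_def table_simps w2 w3 b; simp add: field_simps\<close>)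
    next
      case 2
      show ?thesis
        by (rule classifiedI[OF _ N, where N = "N2_8 c" and ?b1.0 = "vector [1, v, 0]"
              and ?b2.0 = "vector [0, 1, 1]" and ?b3.0 = e3])
          (simp_all add: frameI diag0_def table_simps w2 2 b s)
    next
      case 3
      show ?thesis
        by (rule classifiedI[OF _ N, where N = N2_9 and ?b1.0 = "vector [1, v, 0]"
              and ?b2.0 = "vector [0, 1, w3]" and ?b3.0 = "w3 *s e3"])
          (use 3 in \<open>simp_all add: frameI diag0_def table_simps w2 b s\<close>)
    qed
  qed
next
  case b: False
  define v where "v = s / b"
  have s: "s = b * v" using b by (simp add: v_def)
  have w2: "w2 = v * (b * v + c)" using rel b by (simp add: s)
  consider "c \<noteq> - 1" | "c = - 1" "w3 = 0" | "c = - 1" "w3 \<noteq> 0" by blast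
  then show ?thesis
  proof cases
    case 1
    then have "c + 1 \<noteq> 0" by (simp add: add_eq_0_iff2)
    then obtain v3 where w3: "w3 = - ((c + 1) * v3)"
      by (metis minus_minus mult_minus_right nonzero_mult_div_cancel_left times_divide_eq_right)
    show ?thesis
      by (rule classifiedI[OF _ N, where N = "N2_10 c" and ?b1.0 = "vector [1, - v, v3]"
            and ?b2.0 = "vector [0, - 1 / b, 1]" and ?b3.0 = e3];
        use b in \<open>simp add: frameI diag0_def table_simps s w2 w3; simp add: field_simps\<close>)
  next
    case 2
    show ?thesis
      by (rule classifiedI[OF _ N, where N = "N2_10 c" and ?b1.0 = "vector [1, - v, 0]"
            and ?b2.0 = "vector [0, - 1 / b, 1]" and ?b3.0 = e3];
        use b in \<open>simp add: frameI diag0_def table_simps s w2 2; simp add: field_simps\<close>)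
  next
    case 3
    show ?thesis
      by (rule classifiedI[OF _ N, where N = N2_11 and ?b1.0 = "vector [1, - v, 0]"
            and ?b2.0 = "vector [0, - 1 / b, w3]" and ?b3.0 = "w3 *s e3"];
        use b 3 in \<open>simp add: frameI diag0_def table_simps s w2; simp add: field_simps\<close>)
  qed
qed

section \<open>The Heisenberg algebra\<close>

text \<open>Left multiplication by the central commutator \<open>d = e\<^sub>3\<close> is \<open>[L\<^sub>1, L\<^sub>2]\<close>.  As \<open>d\<close> is central, it acts
  on the quotient by \<open>F d\<close> as a scalar, which is zero because \<open>L\<^sub>d\<close> has trace zero.\<close>

lemma heisenberg_center:
  fixes m :: "'f::field_char_0 ^ 3 \<Rightarrow> 'f ^ 3 \<Rightarrow> 'f ^ 3"
  assumes m: "lie_shape 0 1 0 0 m"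
  shows "\<exists>l k. m e3 e1 = l *s e3 \<and> m e3 e2 = k *s e3 \<and> m e3 e3 = 0 \<and> m e1 e3 = l *s e3 \<and> m e2 e3 = k *s e3"
proof -
  have N: "novikov3 m" and K: "m x y - m y x = bracketD 0 1 0 0 x y" for x y
    using m by (auto simp: lie_shape_def commutator_def)
  note bil = novikov3D[OF N]
  note LS = novikov3_left_symmetric[OF N] and RC = novikov3_right_commutative[OF N]
  have com: "m x y = m y x + (x$1 * y$2 - x$2 * y$1) *s e3" for x y :: "'f ^ 3"
    using K[of x y] by (simp add: bracketD_def vec3_eq_iff algebra_simps)
  have cen: "m x e3 = m e3 x" for x using com[of x e3] by simp
  have A: "m e3 (m x y) = m (m e3 x) y" for x y
  proof -
    have "m e3 (m x y) = m (m x e3) y" using cen[of "m x y"] RC[of x y e3] by simp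
    then show ?thesis by (simp add: cen)
  qed
  have B: "m e3 (m y x) = m y (m e3 x)" for x y
    using LS[of e3 y x] cen[of y] by simp
  have D: "(m e3 x $ 1 * y$2 - m e3 x $ 2 * y$1) *s e3 = (x$1 * y$2 - x$2 * y$1) *s m e3 e3" for x y :: "'f ^ 3"
  proof -
    have "(m e3 x $ 1 * y$2 - m e3 x $ 2 * y$1) *s e3 = m e3 (m x y) - m e3 (m y x)"
      using com[of "m e3 x" y] A B by simp
    also have "\<dots> = (x$1 * y$2 - x$2 * y$1) *s m e3 e3"
      by (subst com[of x y]) (simp add: bil)
    finally show ?thesis .
  qed
  define s where "s = m e3 e1 $ 1"
  have s: "m e3 e3 = s *s e3" "m e3 e1 $ 2 = 0" "m e3 e2 $ 2 = s" "m e3 e2 $ 1 = 0"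
    using D[of e1 e2] D[of e1 e1] D[of e2 e1] D[of e2 e2] by (auto simp: s_def vec3_eq_iff)
  have "m e3 z = m e1 (m e2 z) - m e2 (m e1 z)" for z
    using LS[of e1 e2 z] com[of e1 e2] by (simp add: bil algebra_simps)
  then have "tr3 (m e3) = tr3 (\<lambda>z. m e1 (m e2 z)) - tr3 (\<lambda>z. m e2 (m e1 z))"
    by (simp add: tr3_def)
  also have "\<dots> = 0"
    using tr3_comp_commute[of "m e1" "m e2"] by (simp add: linear3I bil)
  finally have "3 * s = 0" by (simp add: tr3_def s s_def)
  then have "s = 0" by simp
  then have "m e3 e1 = (m e3 e1 $ 3) *s e3" "m e3 e2 = (m e3 e2 $ 3) *s e3" "m e3 e3 = 0"
    using s by (simp_all add: vec3_eq_iff s_def)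
  then show ?thesis using cen by metis
qed

text \<open>The quotient by \<open>F d\<close> is a commutative associative plane on which \<open>d\<close> acts by the character
  with values \<open>l, k\<close>; its regular trace form is twice that character.\<close>

lemma heisenberg_structure:
  fixes m :: "'f::field_char_0 ^ 3 \<Rightarrow> 'f ^ 3 \<Rightarrow> 'f ^ 3"
  assumes m: "lie_shape 0 1 0 0 m" and e31: "m e3 e1 = l *s e3" and e32: "m e3 e2 = k *s e3"
  obtains a1 a2 a3 b1 b2 b3 c1 c2 c3 where
    "\<And>x y. m x y = vector [a1 * x$1 * y$1 + b1 * (x$1 * y$2 + x$2 * y$1) + c1 * x$2 * y$2,
      a2 * x$1 * y$1 + b2 * (x$1 * y$2 + x$2 * y$1) + c2 * x$2 * y$2,
      a3 * x$1 * y$1 + b3 * (x$1 * y$2 + x$2 * y$1) + c3 * x$2 * y$2 + x$1 * y$2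
       + l * (x$1 * y$3 + x$3 * y$1) + k * (x$2 * y$3 + x$3 * y$2)]"
    "l * l = l * a1 + k * a2" "l * k = l * b1 + k * b2" "k * k = l * c1 + k * c2"
    "a1 + b2 = 2 * l" "b1 + c2 = 2 * k"
    "a1 * b1 + a2 * c1 = b1 * a1 + b2 * b1" "a1 * b2 + a2 * c2 = b1 * a2 + b2 * b2"
    "b1 * b1 + b2 * c1 = c1 * a1 + c2 * b1" "b1 * b2 + b2 * c2 = c1 * a2 + c2 * b2"
    "a1 * (b3 + 1) + a2 * c3 + a3 * k = b1 * a3 + b2 * b3 + (b3 + 1) * l"
    "b1 * (b3 + 1) + b2 * c3 + b3 * k = c1 * a3 + c2 * b3 + c3 * l"
proof -
  have N: "novikov3 m" and K: "m x y - m y x = bracketD 0 1 0 0 x y" for x y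
    using m by (auto simp: lie_shape_def commutator_def)
  note bil = novikov3D[OF N]
  note LS = novikov3_left_symmetric[OF N] and RC = novikov3_right_commutative[OF N]
  have Z: "m e3 e1 = l *s e3" "m e3 e2 = k *s e3" "m e3 e3 = 0" "m e1 e3 = l *s e3" "m e2 e3 = k *s e3"
    using heisenberg_center[OF m] e31 e32 by (auto simp: vec3_eq_iff)
  define a1 where "a1 = m e1 e1 $ 1"
  define a2 where "a2 = m e1 e1 $ 2"
  define a3 where "a3 = m e1 e1 $ 3"
  define b1 where "b1 = m e2 e1 $ 1"
  define b2 where "b2 = m e2 e1 $ 2"
  define b3 where "b3 = m e2 e1 $ 3"
  define c1 where "c1 = m e2 e2 $ 1"
  define c2 where "c2 = m e2 e2 $ 2"
  define c3 where "c3 = m e2 e2 $ 3"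
  have M: "m e1 e1 = a1 *s e1 + a2 *s e2 + a3 *s e3" "m e2 e1 = b1 *s e1 + b2 *s e2 + b3 *s e3"
    "m e2 e2 = c1 *s e1 + c2 *s e2 + c3 *s e3"
    by (simp_all add: vec3_eq_iff a1_def a2_def a3_def b1_def b2_def b3_def c1_def c2_def c3_def)
  have M12: "m e1 e2 = b1 *s e1 + b2 *s e2 + (b3 + 1) *s e3"
    using K[of e1 e2] by (simp add: M bracketD_def vec3_eq_iff algebra_simps)
  note T = M M12 Z
  have E31: "m e3 (m e1 e1) = m (m e3 e1) e1" and E32: "m e3 (m e2 e1) = m (m e3 e1) e2"
    and E33: "m e3 (m e2 e2) = m (m e3 e2) e2"
    using LS[of e3 e1 e1] LS[of e3 e2 e1] LS[of e3 e2 e2] RC[of e1 e3 e1] RC[of e2 e3 e1] RC[of e2 e3 e2]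
    by (simp_all add: Z bil)
  note R1 = RC[of e1 e1 e2] and R2 = RC[of e2 e1 e2]
  note L1 = LS[of e1 e2 e1] and L2 = LS[of e1 e2 e2]
  have 1: "l * l = l * a1 + k * a2" "l * k = l * b1 + k * b2" "k * k = l * c1 + k * c2"
    using E31 E32 E33 unfolding T bil by (simp_all add: T vec3_eq_iff bil algebra_simps)
  have 2: "a1 * b1 + a2 * c1 = b1 * a1 + b2 * b1" "a1 * b2 + a2 * c2 = b1 * a2 + b2 * b2"
    "a1 * (b3 + 1) + a2 * c3 + a3 * k = b1 * a3 + b2 * b3 + (b3 + 1) * l"
    using R1 unfolding T bil by (simp_all add: T vec3_eq_iff bil algebra_simps)
  have 3: "b1 * b1 + b2 * c1 = c1 * a1 + c2 * b1" "b1 * b2 + b2 * c2 = c1 * a2 + c2 * b2"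
    "b1 * (b3 + 1) + b2 * c3 + b3 * k = c1 * a3 + c2 * b3 + c3 * l"
    using R2 unfolding T bil by (simp_all add: T vec3_eq_iff bil algebra_simps)
  have 4: "b1 * a3 + b2 * (b3 + 1) + b3 * l - (a1 * b3 + a2 * c3 + a3 * k) = l"
    using L1 unfolding T bil by (simp add: T vec3_eq_iff bil algebra_simps)
  have 5: "c1 * a3 + c2 * (b3 + 1) + c3 * l - (b1 * b3 + b2 * c3 + (b3 + 1) * k) = k"
    using L2 unfolding T bil by (simp add: T vec3_eq_iff bil algebra_simps)
  have 6: "a1 + b2 = 2 * l" "b1 + c2 = 2 * k"
    using 2(3) 4 3(3) 5 by algebra+
  show thesis
  proof (rule that)
    fix x y :: "'f ^ 3"
    have "m x y = m (x$1 *s e1 + x$2 *s e2 + x$3 *s e3) (y$1 *s e1 + y$2 *s e2 + y$3 *s e3)"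
      by (rule arg_cong2[where f = m]) (simp_all add: vec3_eq_iff)
    then show "m x y = vector [a1 * x$1 * y$1 + b1 * (x$1 * y$2 + x$2 * y$1) + c1 * x$2 * y$2,
      a2 * x$1 * y$1 + b2 * (x$1 * y$2 + x$2 * y$1) + c2 * x$2 * y$2,
      a3 * x$1 * y$1 + b3 * (x$1 * y$2 + x$2 * y$1) + c3 * x$2 * y$2 + x$1 * y$2
       + l * (x$1 * y$3 + x$3 * y$1) + k * (x$2 * y$3 + x$3 * y$2)]"
      unfolding bil T by (simp add: vec3_eq_iff algebra_simps)
  qed (fact 1 2 3 6)+
qed

text \<open>The \<open>a\<^sub>i, b\<^sub>i, c\<^sub>i\<close> are the coordinates of \<open>e\<^sub>1 e\<^sub>1\<close>, \<open>e\<^sub>2 e\<^sub>1\<close> and \<open>e\<^sub>2 e\<^sub>2\<close>; the term \<open>x\<^sub>1 y\<^sub>2\<close> is the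
  Heisenberg commutator, and \<open>l, k\<close> are the values of the character.\<close>

definition heis :: "'f::field \<Rightarrow> 'f \<Rightarrow> 'f \<Rightarrow> 'f \<Rightarrow> 'f \<Rightarrow> 'f \<Rightarrow> 'f \<Rightarrow> 'f \<Rightarrow> 'f \<Rightarrow> 'f \<Rightarrow> 'f \<Rightarrow> 'f ^ 3 \<Rightarrow> 'f ^ 3 \<Rightarrow> 'f ^ 3" where
  "heis a1 a2 a3 b1 b2 b3 c1 c2 c3 l k x y = vector [
      a1 * x$1 * y$1 + b1 * (x$1 * y$2 + x$2 * y$1) + c1 * x$2 * y$2,
      a2 * x$1 * y$1 + b2 * (x$1 * y$2 + x$2 * y$1) + c2 * x$2 * y$2,
      a3 * x$1 * y$1 + b3 * (x$1 * y$2 + x$2 * y$1) + c3 * x$2 * y$2 + x$1 * y$2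
       + l * (x$1 * y$3 + x$3 * y$1) + k * (x$2 * y$3 + x$3 * y$2)]"

text \<open>If the character vanishes, the regular traces of the quotient plane vanish and it is nilpotent.
  It has a generator \<open>x\<close>, which gives the basis \<open>x\<close>, \<open>x x\<close>, \<open>[x, x x]\<close>, or its product is zero and a
  bilinear form on the plane remains; a vector \<open>y\<close> on which the form does not vanish and a vector
  \<open>x\<close> with \<open>y x = 0\<close> bring it into normal form, and without such a \<open>y\<close> it is alternating.\<close>

lemma heisenberg_nilpotent_classified:
  fixes a1 :: "'f::field_char_0"
  assumes N: "novikov3 (heis a1 a2 a3 b1 b2 b3 c1 c2 c3 0 0)"
    and tr: "b2 = - a1" "c2 = - b1"
    and E: "a1 * b1 + a2 * c1 = b1 * a1 + b2 * b1" "a1 * b2 + a2 * c2 = b1 * a2 + b2 * b2"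
      "b1 * b1 + b2 * c1 = c1 * a1 + c2 * b1"
      "a1 * (b3 + 1) + a2 * c3 = b1 * a3 + b2 * b3" "b1 * (b3 + 1) + b2 * c3 = c1 * a3 + c2 * b3"
  shows "classified (heis a1 a2 a3 b1 b2 b3 c1 c2 c3 0 0)"
proof -
  have sq: "a1 * a1 = - (a2 * b1)" "b1 * b1 = a1 * c1" "a2 * c1 = - (a1 * b1)"
  proof -
    have "2 * (a1 * a1 + a2 * b1) = 0" using E(2) by (simp add: tr algebra_simps)
    then show "a1 * a1 = - (a2 * b1)" by (metis eq_neg_iff_add_eq_0 mult_eq_0_iff zero_neq_numeral)
    have "2 * (b1 * b1 - a1 * c1) = 0" using E(3) by (simp add: tr algebra_simps)
    then show "b1 * b1 = a1 * c1" by (metis right_minus_eq mult_eq_0_iff zero_neq_numeral)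
    show "a2 * c1 = - (a1 * b1)" using E(1) by (simp add: tr eq_neg_iff_add_eq_0 add.commute)
  qed
  \<comment> \<open>The generator is \<open>e\<^sub>1\<close> or \<open>e\<^sub>2\<close>; the ratio \<open>r\<close> parametrises the nilpotent planes.\<close>
  consider "a2 \<noteq> 0" | "c1 \<noteq> 0" | "a2 = 0" "c1 = 0" by blast
  then show ?thesis
  proof cases
    case 1
    define r where "r = a1 / a2"
    have a1: "a1 = r * a2" using 1 by (simp add: r_def)
    have "a2 * b1 = a2 * (- r * r * a2)" using sq(1) unfolding a1 by algebra
    then have b1: "b1 = - r * r * a2" by (rule mult_left_cancel[OF 1, THEN iffD1])
    have "a2 * c1 = a2 * (r * r * r * a2)" using sq(3) unfolding a1 b1 by algebra
    then have c1: "c1 = r * r * r * a2" by (rule mult_left_cancel[OF 1, THEN iffD1])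
    have "a2 * c3 = a2 * (- r * r * a3 - 2 * r * b3 - r)"
      using E(4) unfolding tr a1 b1 by algebra
    then have c3: "c3 = - r * r * a3 - 2 * r * b3 - r" by (rule mult_left_cancel[OF 1, THEN iffD1])
    show ?thesis
      by (rule classifiedI[OF _ N, where N = "N3_1 (r * a3 + b3)" and ?b1.0 = e1 
            and ?b2.0 = "vector [a1, a2, a3]" and ?b3.0 = "a2 *s e3"];
          use 1 in \<open>simp add: frameI_det heis_def table_simps c3 c1 tr b1 a1; simp add: algebra_simps\<close>)
  next
    case 2
    define r where "r = - b1 / c1"
    have b1: "b1 = - r * c1" using 2 by (simp add: r_def)
    have "c1 * a1 = c1 * (r * r * c1)" using sq(2) unfolding b1 by algebra
    then have a1: "a1 = r * r * c1" by (rule mult_left_cancel[OF 2, THEN iffD1])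
    have "c1 * a2 = c1 * (r * r * r * c1)" using sq(3) unfolding a1 b1 by algebra
    then have a2: "a2 = r * r * r * c1" by (rule mult_left_cancel[OF 2, THEN iffD1])
    have "c1 * a3 = c1 * (- r * (2 * b3 + 1) - r * r * c3)"
      using E(5) unfolding tr a1 b1 by algebra
    then have a3: "a3 = - r * (2 * b3 + 1) - r * r * c3" by (rule mult_left_cancel[OF 2, THEN iffD1])
    show ?thesis
      by (rule classifiedI[OF _ N, where N = "N3_1 (- (b3 + r * c3) - 1)" and ?b1.0 = e2 
            and ?b2.0 = "vector [c1, c2, c3]" and ?b3.0 = "- c1 *s e3"];
          use 2 in \<open>simp add: frameI_det heis_def table_simps a3 a2 tr b1 a1; simp add: algebra_simps\<close>)
  next
    case 3
    then have z: "a1 = 0" "b1 = 0" "b2 = 0" "c2 = 0" using sq by (simp_all add: tr)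
    consider "c3 \<noteq> 0" | "c3 = 0" "a3 \<noteq> 0" | "c3 = 0" "a3 = 0" "2 * b3 + 1 \<noteq> 0" 
      | "c3 = 0" "a3 = 0" "2 * b3 + 1 = 0" by blast
    then show ?thesis
    proof cases
      case 1
      show ?thesis
        by (rule classifiedI[OF _ N, where N = "N3_2 (c3 * a3 - b3 * b3 - b3)" and ?b1.0 = "vector [c3, - b3, 0]" 
            and ?b2.0 = e2 and ?b3.0 = "c3 *s e3"];
          use 1 in \<open>simp add: frameI_det heis_def table_simps z 3; simp add: algebra_simps\<close>)
    next
      case 2
      show ?thesis
        by (rule classifiedI[OF _ N, where N = "N3_2 (- b3 * b3 - b3)" and ?b1.0 = "vector [b3 + 1, - a3, 0]" 
            and ?b2.0 = e1 and ?b3.0 = "a3 *s e3"];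
          use 2 in \<open>simp add: frameI_det heis_def table_simps z 3; simp add: algebra_simps\<close>)
    next
      case c3: 3
      define g where "g = 2 * b3 + 1"
      have b3: "b3 = (g - 1) / 2" by (simp add: g_def)
      have g: "g \<noteq> 0" using c3 by (simp add: g_def)
      show ?thesis
        by (rule classifiedI[OF _ N, where N = "N3_2 (- b3 * b3 - b3)" and ?b1.0 = "vector [(g + 1) / 2, (1 - g) / 2, 0]" 
            and ?b2.0 = "vector [1, 1, 0]" and ?b3.0 = "g *s e3"];
          use g in \<open>simp add: frameI_det heis_def table_simps z 3 c3 b3; simp add: field_simps\<close>)
    next
      case 4
      then have b3: "b3 = - 1 / 2" by (metis add_eq_0_iff2 nonzero_mult_div_cancel_left zero_neq_numeral)
      show ?thesis
        by (rule classifiedI[OF _ N, where N = N3_5 and ?b1.0 = e1 and ?b2.0 = e2 and ?b3.0 = e3];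
          simp add: frameI heis_def table_simps z 3 4 b3)
    qed
  qed
qed

text \<open>If the character is non-zero, the plane is unital with square-zero radical, the kernel of the
  character.  Translating the lift of the unit makes it an idempotent, and only the square of a
  lift of the radical remains.\<close>

lemma heisenberg_classified:
  fixes m :: "'f::field_char_0 ^ 3 \<Rightarrow> 'f ^ 3 \<Rightarrow> 'f ^ 3"
  assumes m: "lie_shape 0 1 0 0 m"
  shows "classified m"
proof -
  obtain l k where lk: "m e3 e1 = l *s e3" "m e3 e2 = k *s e3" using heisenberg_center[OF m] by metis
  have N: "novikov3 m" using m by (simp add: lie_shape_def)
  show ?thesis
  proof (cases "l = 0 \<and> k = 0")
    case True
    then have z: "l = 0" "k = 0" by auto
    obtain a1 a2 a3 b1 b2 b3 c1 c2 c3 where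
      M: "\<And>x y. m x y = vector [a1 * x$1 * y$1 + b1 * (x$1 * y$2 + x$2 * y$1) + c1 * x$2 * y$2,
        a2 * x$1 * y$1 + b2 * (x$1 * y$2 + x$2 * y$1) + c2 * x$2 * y$2,
        a3 * x$1 * y$1 + b3 * (x$1 * y$2 + x$2 * y$1) + c3 * x$2 * y$2 + x$1 * y$2
         + l * (x$1 * y$3 + x$3 * y$1) + k * (x$2 * y$3 + x$3 * y$2)]" and
      T: "a1 + b2 = 2 * l" "b1 + c2 = 2 * k" and
      E: "a1 * b1 + a2 * c1 = b1 * a1 + b2 * b1" "a1 * b2 + a2 * c2 = b1 * a2 + b2 * b2"
        "b1 * b1 + b2 * c1 = c1 * a1 + c2 * b1"
        "a1 * (b3 + 1) + a2 * c3 + a3 * k = b1 * a3 + b2 * b3 + (b3 + 1) * l"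
        "b1 * (b3 + 1) + b2 * c3 + b3 * k = c1 * a3 + c2 * b3 + c3 * l"
      using heisenberg_structure[OF m lk] by metis
    have "m = heis a1 a2 a3 b1 b2 b3 c1 c2 c3 0 0" by (simp add: fun_eq_iff M heis_def z)
    moreover have "b2 = - a1" "c2 = - b1" using T by (simp_all add: z add_eq_0_iff)
    ultimately show ?thesis
      using heisenberg_nilpotent_classified[of a1 a2 a3 b1 b2 b3 c1 c2 c3] N E by (simp add: z)
  next
    case False
    \<comment> \<open>A basis of the plane adapted to the character.\<close>
    define p1 where "p1 = (if k = 0 then vector [0, - l, 0] else vector [k, - l, 0] :: 'f ^ 3)"
    define p2 where "p2 = (if k = 0 then vector [1 / l, 0, 0] else vector [0, 1 / k, 0] :: 'f ^ 3)"
    have fr: "frame p1 p2 e3"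
      by (rule frameI_det) (use False in \<open>auto simp: p1_def p2_def\<close>)
    note bil = novikov3D[OF N]
    have K: "commutator m x y = bracketD 0 1 0 0 x y" for x y using m by (simp add: lie_shape_def)
    have "commutator m p1 p2 = 0 *s p2 + 1 *s e3" "commutator m p1 e3 = 0 *s p2 + 0 *s e3"
      "commutator m p2 e3 = 0"
      using False by (simp_all add: K bracketD_def vec3_eq_iff p1_def p2_def)
    from lie_shape_frame_map[OF N fr this] obtain m' where m': "lie_shape 0 1 0 0 m'" "iso3 m m'"
      and g: "\<And>x y. frame_map p1 p2 e3 (m' x y) = m (frame_map p1 p2 e3 x) (frame_map p1 p2 e3 y)" by blast
    have inj: "x = y" if "frame_map p1 p2 e3 x = frame_map p1 p2 e3 y" for x y
      using injD[OF bij_is_inj[OF bij_frame_map[OF fr]]] that .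
    have p12: "p1 = p1$1 *s e1 + p1$2 *s e2" "p2 = p2$1 *s e1 + p2$2 *s e2"
      by (simp_all add: p1_def p2_def vec3_eq_iff)
    have mp1: "m e3 p1 = 0"
      by (subst p12) (simp add: bil lk p1_def vec3_eq_iff)
    have mp2: "m e3 p2 = e3"
      by (subst p12) (use False in \<open>simp add: bil lk p2_def vec3_eq_iff\<close>)
    have e: "frame_map p1 p2 e3 e1 = p1" "frame_map p1 p2 e3 e2 = p2" "frame_map p1 p2 e3 e3 = e3"
      by (simp_all add: frame_map_def)
    have e': "frame_map p1 p2 e3 (0 *s e3) = 0" "frame_map p1 p2 e3 (1 *s e3) = e3"
      by (simp_all add: frame_map_def)
    have "m' e3 e1 = 0 *s e3" "m' e3 e2 = 1 *s e3"
      by (rule inj, simp only: g e e' mp1 mp2)+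
    then obtain a1 a2 a3 b1 b2 b3 c1 c2 c3 where
      M: "\<And>x y. m' x y = vector [a1 * x$1 * y$1 + b1 * (x$1 * y$2 + x$2 * y$1) + c1 * x$2 * y$2,
        a2 * x$1 * y$1 + b2 * (x$1 * y$2 + x$2 * y$1) + c2 * x$2 * y$2,
        a3 * x$1 * y$1 + b3 * (x$1 * y$2 + x$2 * y$1) + c3 * x$2 * y$2 + x$1 * y$2
         + 0 * (x$1 * y$3 + x$3 * y$1) + 1 * (x$2 * y$3 + x$3 * y$2)]" and
      X: "0 * 0 = 0 * a1 + 1 * a2" "0 * 1 = 0 * b1 + 1 * b2" "1 * 1 = 0 * c1 + 1 * c2" and
      T: "a1 + b2 = 2 * 0" "b1 + c2 = 2 * 1" and
      E: "b1 * (b3 + 1) + b2 * c3 + b3 * 1 = c1 * a3 + c2 * b3 + c3 * 0"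
      using heisenberg_structure[OF m'(1)] by metis
    have v: "a2 = 0" "b2 = 0" "c2 = 1" "a1 = 0" "b1 = 1" using X T by simp_all
    have b3: "b3 = c1 * a3 - 1" using E by (simp add: v algebra_simps)
    define u where "u = - (c3 - c1 * (2 * b3 + 1) + c1 * c1 * a3)"
    have N': "novikov3 m'" using m' by (simp add: lie_shape_def)
    have "classified m'"
    proof (cases "a3 = 0")
      case True
      show ?thesis
        by (rule classifiedI[OF _ N', where N = N3_4 and ?b1.0 = e1 and ?b2.0 = "vector [- c1, 1, u]" and ?b3.0 = e3];
          simp add: frameI_det M table_simps v b3 True u_def; simp add: algebra_simps)
    next
      case a3: False
      show ?thesis
        by (rule classifiedI[OF _ N', where N = N3_3 and ?b1.0 = "(1 / a3) *s e1" and ?b2.0 = "vector [- c1, 1, u]"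
              and ?b3.0 = "(1 / a3) *s e3"];
          use a3 in \<open>simp add: frameI_det M table_simps v b3 u_def; simp add: field_simps\<close>)
    qed
    then show ?thesis using algebra_iso_trans[OF m'(2)] by blast
  qed
qed

section \<open>Completeness of the list\<close>

lemma lie_shape_nonzero:
  assumes "lie_shape p q r s m" "\<exists>x y. commutator m x y \<noteq> 0"
  shows "p \<noteq> 0 \<or> q \<noteq> 0 \<or> r \<noteq> 0 \<or> s \<noteq> 0"
  using assms by (auto simp: lie_shape_def bracketD_def vec3_eq_iff)

lemma noncommutative_iso3:
  assumes "algebra_iso s1 m1 s2 m2" "\<exists>x y. commutator m1 x y \<noteq> 0"
  shows "\<exists>x y. commutator m2 x y \<noteq> 0"
proof -
  obtain f where f: "inj f" "\<And>x y. f (m1 x y) = m2 (f x) (f y)"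
    using assms(1) unfolding algebra_iso_def bij_def by blast
  obtain x y where "m1 x y \<noteq> m1 y x" using assms(2) by (auto simp: commutator_def)
  then have "m2 (f x) (f y) \<noteq> m2 (f y) (f x)" using f by (metis injD)
  then show ?thesis by (auto simp: commutator_def)
qed

lemma trace_one_classified:
  fixes m :: "'f::field_char_0 ^ 3 \<Rightarrow> 'f ^ 3 \<Rightarrow> 'f ^ 3"
  assumes m: "lie_shape 0 1 \<alpha> 1 m"
    and sq: "\<And>y :: 'f. \<exists>t. y = t\<^sup>2 \<or> y = - t\<^sup>2" and two: "\<exists>j :: 'f. j\<^sup>2 = 2"
  shows "classified m"
proof -
  have N: "novikov3 m" and K: "commutator m x y = bracketD 0 1 \<alpha> 1 x y" for x y
    using m by (auto simp: lie_shape_def)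
  consider "\<alpha> = - 2/9" | "\<alpha> = 0" | "\<alpha> \<noteq> 0" "\<alpha> \<noteq> - 2/9" by blast
  then show ?thesis
  proof cases
    case 1
    have "\<exists>m'. lie_shape (1/3) 0 0 (2/3) m' \<and> iso3 m m'"
      by (rule lie_shape_frame[OF N, where ?b1.0 = e1 and ?b2.0 = "vector [0, 2, - 3]" and ?b3.0 = "vector [0, - 1, 3]"])
        (simp_all add: frameI K bracketD_def vec3_eq_iff 1)
    then obtain m' where m': "lie_shape (1/3) 0 0 (2/3) m'" "iso3 m m'" by blast
    have "classified m'"
      using diag3_case[OF m'(1)] diag3_classified sq two m'(1) unfolding lie_shape_def by metis
    then show ?thesis using algebra_iso_trans[OF m'(2)] by blast
  next
    case 2
    have "\<exists>m'. lie_shape 0 0 0 1 m' \<and> iso3 m m'"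
      by (rule lie_shape_frame[OF N, where ?b1.0 = e1 and ?b2.0 = "vector [0, 1, - 1]" and ?b3.0 = e3])
        (simp_all add: frameI K bracketD_def vec3_eq_iff 2)
    then obtain m' where m': "lie_shape 0 0 0 1 m'" "iso3 m m'" by blast
    have "classified m'"
      using diag0_case[OF m'(1)] diag0_classified m'(1) unfolding lie_shape_def by metis
    then show ?thesis using algebra_iso_trans[OF m'(2)] by blast
  next
    case 3
    have "9 * \<alpha> + 2 \<noteq> 0"
    proof
      assume "9 * \<alpha> + 2 = 0"
      then have "\<alpha> = - 2/9" by (metis add_eq_0_iff2 nonzero_mult_div_cancel_left zero_neq_numeral)
      then show False using 3 by simp
    qed
    moreover have "(0 * 1 - 1 * \<alpha>) * (9 * (0 * 1 - 1 * \<alpha>) - 2 * (0 + 1)\<^sup>2) = \<alpha> * (9 * \<alpha> + 2)"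
      by (simp add: algebra_simps)
    ultimately have "(0 * 1 - 1 * \<alpha>) * (9 * (0 * 1 - 1 * \<alpha>) - 2 * (0 + 1)\<^sup>2) \<noteq> 0" using 3 by simp
    from affine_case[OF m this] show ?thesis using affine_trace_one_classified N by blast
  qed
qed

lemma coordinate_classification:
  fixes m :: "'f::field_char_0 ^ 3 \<Rightarrow> 'f ^ 3 \<Rightarrow> 'f ^ 3"
  assumes N: "novikov3 m" and nc: "\<exists>x y. commutator m x y \<noteq> 0"
    and sq: "\<And>y :: 'f. \<exists>t. y = t\<^sup>2 \<or> y = - t\<^sup>2" and two: "\<exists>j :: 'f. j\<^sup>2 = 2"
  shows "classified m"
proof -
  obtain p q r s m1 where m1: "lie_shape p q r s m1" "iso3 m m1"
    using novikov_lie_shape[OF N] by blast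
  have "p \<noteq> 0 \<or> q \<noteq> 0 \<or> r \<noteq> 0 \<or> s \<noteq> 0"
    using lie_shape_nonzero[OF m1(1)] noncommutative_iso3[OF m1(2) nc] by blast
  from lie_shape_normal_form[OF m1(1) this sq] obtain m2 where m2: "iso3 m1 m2"
    and shape: "lie_shape 1 0 0 1 m2 \<or> (\<exists>\<alpha>. lie_shape 0 1 \<alpha> 1 m2) \<or>
      lie_shape 0 1 1 0 m2 \<or> lie_shape 0 1 (-1) 0 m2 \<and> (\<nexists>i::'f. i\<^sup>2 = -1) \<or> lie_shape 0 1 0 0 m2"
    by blast
  have N2: "novikov3 m2" using shape by (auto simp: lie_shape_def)
  from shape have "classified m2"
  proof (elim disjE exE conjE)
    assume m: "lie_shape 1 0 0 1 m2"
    have "\<exists>c w2 w3. m2 = affine 1 0 0 1 c w2 w3" by (rule affine_case[OF m]) simp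
    then show ?thesis using affine_scalar_classified N2 by blast
  next
    fix \<alpha> assume "lie_shape 0 1 \<alpha> 1 m2"
    then show ?thesis by (rule trace_one_classified[OF _ sq two])
  next
    assume m: "lie_shape 0 1 1 0 m2"
    have "\<exists>c w2 w3. m2 = affine 0 1 1 0 c w2 w3" by (rule affine_case[OF m]) simp
    then show ?thesis using affine_trace_zero_classified[of 1] N2 by blast
  next
    assume m: "lie_shape 0 1 (- 1) 0 m2" and i: "\<nexists>i::'f. i\<^sup>2 = -1"
    have "\<exists>c w2 w3. m2 = affine 0 1 (- 1) 0 c w2 w3" by (rule affine_case[OF m]) simp
    then show ?thesis using affine_trace_zero_classified[of "- 1"] N2 i by blast
  next
    assume "lie_shape 0 1 0 0 m2"
    then show ?thesis by (rule heisenberg_classified)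
  qed
  then show ?thesis using algebra_iso_trans[OF algebra_iso_trans[OF m1(2) m2]] by blast
qed

lemma classification_complete:
  fixes mul :: "'a::ab_group_add \<Rightarrow> 'a \<Rightarrow> 'a" and sc :: "'f::field_char_0 \<Rightarrow> 'a \<Rightarrow> 'a"
  assumes A: "novikov_algebra sc mul" and dim: "vector_space.dim sc (UNIV :: 'a set) = 3"
    and nc: "\<exists>x y. commutator mul x y \<noteq> 0"
    and sq: "\<And>y :: 'f. \<exists>t. y = t\<^sup>2 \<or> y = - t\<^sup>2" and two: "\<exists>j :: 'f. j\<^sup>2 = 2"
  shows "\<exists>N. listed N \<and> algebra_iso sc mul (*s) (novikov_product N)"
proof -
  obtain m where m: "novikov3 m" "algebra_iso sc mul (*s) m"
    using three_dimensional_coordinates[OF A dim] by blast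
  have "classified m"
    by (rule coordinate_classification[OF m(1) noncommutative_iso3[OF m(2) nc] sq two])
  then show ?thesis using algebra_iso_trans[OF m(2)] by blast
qed

section \<open>Invariants\<close>

text \<open>For the listed algebras outside the Heisenberg case the vectors with the following property
  are those of \<open>V\<close>; stated through commutators it is visibly preserved by isomorphisms.\<close>

definition centralizes_derived :: "('f::field ^ 3 \<Rightarrow> 'f ^ 3 \<Rightarrow> 'f ^ 3) \<Rightarrow> 'f ^ 3 \<Rightarrow> bool" where
  "centralizes_derived m u \<longleftrightarrow> (\<forall>a b. commutator m u (commutator m a b) = 0)"

text \<open>Whether \<open>w\<close> can be removed by translating \<open>e\<^sub>1\<close>.\<close>

definition has_square_eigenvector :: "('f::field ^ 3 \<Rightarrow> 'f ^ 3 \<Rightarrow> 'f ^ 3) \<Rightarrow> bool" where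
  "has_square_eigenvector m \<longleftrightarrow> (\<exists>x k. \<not> centralizes_derived m x \<and> m x x = k *s x)"

definition has_inner_product :: "('f::field ^ 3 \<Rightarrow> 'f ^ 3 \<Rightarrow> 'f ^ 3) \<Rightarrow> bool" where
  "has_inner_product m \<longleftrightarrow> (\<exists>u v. centralizes_derived m u \<and> centralizes_derived m v \<and> m u v \<noteq> 0)"

text \<open>Whether \<open>Q\<close> vanishes, for algebras with \<open>V V = 0\<close>.\<close>

definition right_scalar :: "('f::field ^ 3 \<Rightarrow> 'f ^ 3 \<Rightarrow> 'f ^ 3) \<Rightarrow> bool" where
  "right_scalar m \<longleftrightarrow> (\<forall>u x. centralizes_derived m u \<longrightarrow> (\<exists>k. m u x = k *s u))"

text \<open>For \<open>c = - 2/3\<close> and \<open>V V \<noteq> 0\<close>: if \<open>e\<^sub>1\<close> is translated so that \<open>Q = 0\<close>, the remaining \<open>w\<close> is a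
  multiple of \<open>f\<^sub>1 f\<^sub>1\<close>, and the property says that the factor is a square up to the constant of
  \<open>N2_7\<close>.\<close>

definition square_witness :: "('f::field ^ 3 \<Rightarrow> 'f ^ 3 \<Rightarrow> 'f ^ 3) \<Rightarrow> bool" where
  "square_witness m \<longleftrightarrow> (\<exists>x u. centralizes_derived m u \<and> (\<forall>v. centralizes_derived m v \<longrightarrow> m v x = (- 2/3) *s v) \<and>
     27 *s (m x x + (2/3) *s x) = m u u)"

definition has_idempotent :: "('f::field ^ 3 \<Rightarrow> 'f ^ 3 \<Rightarrow> 'f ^ 3) \<Rightarrow> bool" where
  "has_idempotent m \<longleftrightarrow> (\<exists>x. x \<noteq> 0 \<and> m x x = x)"

definition has_cube_zero :: "('f::field ^ 3 \<Rightarrow> 'f ^ 3 \<Rightarrow> 'f ^ 3) \<Rightarrow> bool" where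
  "has_cube_zero m \<longleftrightarrow> (\<exists>x. m x x \<noteq> 0 \<and> m (m x x) x = 0)"

definition has_cube :: "('f::field ^ 3 \<Rightarrow> 'f ^ 3 \<Rightarrow> 'f ^ 3) \<Rightarrow> bool" where
  "has_cube m \<longleftrightarrow> (\<exists>x. m (m x x) x \<noteq> 0 \<or> m x (m x x) \<noteq> 0)"

definition has_square :: "('f::field ^ 3 \<Rightarrow> 'f ^ 3 \<Rightarrow> 'f ^ 3) \<Rightarrow> bool" where
  "has_square m \<longleftrightarrow> (\<exists>x. m x x \<noteq> 0)"

definition cube_ratio :: "'f \<Rightarrow> ('f::field ^ 3 \<Rightarrow> 'f ^ 3 \<Rightarrow> 'f ^ 3) \<Rightarrow> bool" where
  "cube_ratio a m \<longleftrightarrow> (\<forall>x. a *s m x (m x x) = (a + 1) *s m (m x x) x)"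

text \<open>On algebras whose products are given by a bilinear form with values in the centre, \<open>a\<close> is the
  determinant of the form, normalised by the square of its alternating part.\<close>

definition form_discriminant :: "'f \<Rightarrow> ('f::field ^ 3 \<Rightarrow> 'f ^ 3 \<Rightarrow> 'f ^ 3) \<Rightarrow> bool" where
  "form_discriminant a m \<longleftrightarrow> (\<exists>x y p q s. commutator m x y \<noteq> 0 \<and> m x x = p *s commutator m x y \<and>
     m x y = q *s commutator m x y \<and> m y y = s *s commutator m x y \<and> p * s - q * (q - 1) = a)"

lemma iso3E:
  assumes "iso3 m m'"
  obtains f where "\<And>x y. f (x + y) = f x + f y" "\<And>c x. f (c *s x) = c *s f x"
    "\<And>x y. f (x - y) = f x - f y" "f 0 = 0" "\<And>x. f x = 0 \<longleftrightarrow> x = 0" "inj f" "surj f"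
    "\<And>x y. f (m x y) = m' (f x) (f y)"
    "\<And>x y. f (commutator m x y) = commutator m' (f x) (f y)"
proof -
  obtain f where f: "lin3 f" "bij f" "\<And>x y. f (m x y) = m' (f x) (f y)"
    using assms unfolding algebra_iso_def by blast
  note lin = lin3D[OF f(1)]
  have d: "f (x - y) = f x - f y" for x y using lin(1)[of "x - y" y] by (simp add: algebra_simps)
  have z: "f 0 = 0" using d[of 0 0] by simp
  have "f x = 0 \<longleftrightarrow> x = 0" for x using f(2) z by (metis bij_pointE)
  then show thesis
    using that[of f] lin d z f by (simp add: commutator_def bij_is_inj bij_is_surj)
qed

lemma centralizes_derived_iso:
  assumes "surj f" "\<And>x. f x = 0 \<longleftrightarrow> x = 0"
    "\<And>x y. f (commutator m x y) = commutator m' (f x) (f y)"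
  shows "centralizes_derived m' (f u) \<longleftrightarrow> centralizes_derived m u"
proof -
  have "centralizes_derived m' (f u) \<longleftrightarrow> (\<forall>a b. commutator m' (f u) (commutator m' (f a) (f b)) = 0)"
    unfolding centralizes_derived_def using assms(1) by (metis surjD)
  also have "\<dots> \<longleftrightarrow> centralizes_derived m u"
    unfolding centralizes_derived_def assms(3)[symmetric] assms(2) ..
  finally show ?thesis .
qed

lemma invariants_mono:
  assumes iso: "iso3 m m'"
  shows "has_square_eigenvector m \<Longrightarrow> has_square_eigenvector m'"
    "has_inner_product m \<Longrightarrow> has_inner_product m'"
    "right_scalar m \<Longrightarrow> right_scalar m'"
    "square_witness m \<Longrightarrow> square_witness m'"
    "has_idempotent m \<Longrightarrow> has_idempotent m'"
    "has_cube_zero m \<Longrightarrow> has_cube_zero m'"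
    "has_cube m \<Longrightarrow> has_cube m'"
    "has_square m \<Longrightarrow> has_square m'"
    "cube_ratio a m \<Longrightarrow> cube_ratio a m'"
    "form_discriminant a m \<Longrightarrow> form_discriminant a m'"
proof -
  obtain f where f: "\<And>x y. f (x + y) = f x + f y" "\<And>c x. f (c *s x) = c *s f x"
    "\<And>x y. f (x - y) = f x - f y" "f 0 = 0" "\<And>x. f x = 0 \<longleftrightarrow> x = 0" "inj f" "surj f"
    "\<And>x y. f (m x y) = m' (f x) (f y)"
    "\<And>x y. f (commutator m x y) = commutator m' (f x) (f y)"
    by (rule iso3E[OF iso], rule that, assumption+)
  have V: "centralizes_derived m' (f u) \<longleftrightarrow> centralizes_derived m u" for u by (rule centralizes_derived_iso[OF f(7,5,9)])
  have ex: "\<exists>x. y = f x" for y using f(7) by (meson surjD)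
  show "has_square_eigenvector m \<Longrightarrow> has_square_eigenvector m'"
    unfolding has_square_eigenvector_def by (metis V f(2,8))
  show "has_inner_product m \<Longrightarrow> has_inner_product m'"
    unfolding has_inner_product_def by (metis V f(5,8))
  show "right_scalar m \<Longrightarrow> right_scalar m'"
    unfolding right_scalar_def by (metis V ex f(2,8))
  show "square_witness m'" if W: "square_witness m"
  proof -
    obtain x u where xu: "centralizes_derived m u" "\<And>v. centralizes_derived m v \<Longrightarrow> m v x = (- 2/3) *s v"
      "27 *s (m x x + (2/3) *s x) = m u u" using W unfolding square_witness_def by blast
    have "m' v (f x) = (- 2/3) *s v" if v: "centralizes_derived m' v" for v
    proof -
      obtain v0 where v0: "v = f v0" using ex by blast
      have "m v0 x = (- 2/3) *s v0" using xu(2) v V by (simp add: v0)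
      then have "f (m v0 x) = (- 2/3) *s f v0" by (simp only: f(2))
      then show ?thesis by (simp only: f(8) v0)
    qed
    moreover have "27 *s (m' (f x) (f x) + (2/3) *s f x) = m' (f u) (f u)"
      using arg_cong[OF xu(3), of f] by (simp only: f(1,2,8))
    ultimately show ?thesis unfolding square_witness_def using V xu(1) by blast
  qed
  show "has_idempotent m \<Longrightarrow> has_idempotent m'"
    unfolding has_idempotent_def by (metis f(5,8))
  show "has_cube_zero m \<Longrightarrow> has_cube_zero m'"
    unfolding has_cube_zero_def by (metis f(5,8))
  show "has_cube m \<Longrightarrow> has_cube m'"
    unfolding has_cube_def by (metis f(5,8))
  show "has_square m \<Longrightarrow> has_square m'"
    unfolding has_square_def by (metis f(5,8))
  show "cube_ratio a m \<Longrightarrow> cube_ratio a m'"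
    unfolding cube_ratio_def by (metis ex f(2,8))
  show "form_discriminant a m'" if W: "form_discriminant a m"
  proof -
    obtain x y p q s where "commutator m x y \<noteq> 0" "m x x = p *s commutator m x y"
      "m x y = q *s commutator m x y" "m y y = s *s commutator m x y" "p * s - q * (q - 1) = a"
      using W unfolding form_discriminant_def by blast
    then have "commutator m' (f x) (f y) \<noteq> 0" "m' (f x) (f x) = p *s commutator m' (f x) (f y)"
      "m' (f x) (f y) = q *s commutator m' (f x) (f y)" "m' (f y) (f y) = s *s commutator m' (f x) (f y)"
      "p * s - q * (q - 1) = a"
      by (simp_all only: f(5) f(2,8,9)[symmetric] not_False_eq_True)
    then show ?thesis unfolding form_discriminant_def by blast
  qed
qed

lemma invariants_eq:
  assumes iso: "iso3 m m'"
  shows "has_square_eigenvector m = has_square_eigenvector m'"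
    "has_inner_product m = has_inner_product m'"
    "right_scalar m = right_scalar m'" "square_witness m = square_witness m'"
    "has_idempotent m = has_idempotent m'" "has_cube_zero m = has_cube_zero m'"
    "has_cube m = has_cube m'" "has_square m = has_square m'"
    "cube_ratio a m = cube_ratio a m'" "form_discriminant a m = form_discriminant a m'"
  using invariants_mono[OF iso] invariants_mono[OF algebra_iso_sym[OF iso]] by blast+

subsection \<open>The Lie algebra\<close>

text \<open>An isomorphism preserves \<open>V\<close>, the centraliser of the derived algebra, and conjugates the
  derivations up to the factor by which it acts modulo \<open>V\<close>.\<close>

lemma lie_isomorphism:
  fixes f :: "'f::field ^ 3 \<Rightarrow> 'f ^ 3"
  assumes add: "\<And>x y. f (x + y) = f x + f y" and sc: "\<And>c x. f (c *s x) = c *s f x"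
    and inj: "\<And>x. f x = 0 \<longleftrightarrow> x = 0" and surj: "surj f"
    and br: "\<And>x y. f (bracketD p q r s x y) = bracketD p' q' r' s' (f x) (f y)"
    and nn: "p' * s' - q' * r' \<noteq> 0 \<or> p' + s' \<noteq> 0"
  obtains t a b c d where "t \<noteq> 0" "f e1 $ 1 = t" "f e2 = vector [0, a, b]" "f e3 = vector [0, c, d]"
    "a * d - b * c \<noteq> 0"
    "p * a + q * c = t * (p' * a + r' * b)" "p * b + q * d = t * (q' * a + s' * b)"
    "r * a + s * c = t * (p' * c + r' * d)" "r * b + s * d = t * (q' * c + s' * d)"
    "t * (p' + s') = p + s" "t\<^sup>2 * (p' * s' - q' * r') = p * s - q * r"
proof -
  have first: "f v $ 1 = 0" if "v$1 = 0" for v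
  proof (rule ccontr)
    assume nz: "f v $ 1 \<noteq> 0"
    have "bracketD p' q' r' s' (f v) (bracketD p' q' r' s' e1 z) = 0" for z
    proof -
      obtain x y where "e1 = f x" "z = f y" using surj by (meson surjD)
      then have "bracketD p' q' r' s' (f v) (bracketD p' q' r' s' e1 z) = f (bracketD p q r s v (bracketD p q r s x y))"
        by (simp only: br)
      also have "bracketD p q r s v (bracketD p q r s x y) = 0"
        using that by (simp add: bracketD_def vec3_eq_iff)
      finally show ?thesis using inj by simp
    qed
    from this[of e2] this[of e3] have "f v $ 1 * (p' * p' + r' * q') = 0"
      "f v $ 1 * (q' * (p' + s')) = 0" "f v $ 1 * (r' * (p' + s')) = 0" "f v $ 1 * (q' * r' + s' * s') = 0"
      by (simp_all add: bracketD_def vec3_eq_iff algebra_simps)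
    then have "p' * p' + r' * q' = 0" "q' * (p' + s') = 0" "r' * (p' + s') = 0" "q' * r' + s' * s' = 0"
      using nz by simp_all
    moreover have "(p' * s' - q' * r') * (p' * s' - q' * r')
        = (p' * p' + r' * q') * (q' * r' + s' * s') - (q' * (p' + s')) * (r' * (p' + s'))"
      "(p' + s') * ((p' + s') * (p' + s')) = (p' + s') * (p' * p' + r' * q') + (p' + s') * (q' * r' + s' * s') 
        + 2 * (p' + s') * (p' * s' - q' * r')"
      by (simp_all add: algebra_simps)
    ultimately show False using nn by auto
  qed
  define t where "t = f e1 $ 1"
  obtain a b where ab: "f e2 = vector [0, a, b]"
    by (rule that[of "f e2 $ 2" "f e2 $ 3"]) (simp add: vec3_eq_iff first)
  obtain c d where cd: "f e3 = vector [0, c, d]"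
    by (rule that[of "f e3 $ 2" "f e3 $ 3"]) (simp add: vec3_eq_iff first)
  have t: "t \<noteq> 0"
  proof
    assume "t = 0"
    obtain x where x: "e1 = f x" using surj by (meson surjD)
    have "x = x$1 *s e1 + x$2 *s e2 + x$3 *s e3" by (simp add: vec3_eq_iff)
    then have "f x = f (x$1 *s e1 + x$2 *s e2 + x$3 *s e3)" by (rule arg_cong)
    then have "f x $ 1 = 0" using \<open>t = 0\<close> by (simp add: add sc t_def ab cd)
    then show False using x by (metis e_nth(1) zero_neq_one)
  qed
  have det: "a * d - b * c \<noteq> 0"
  proof
    assume D: "a * d - b * c = 0"
    have "f (d *s e2 + (- b) *s e3) = 0" "f (c *s e2 + (- a) *s e3) = 0"
      using D by (simp_all only: add sc ab cd) (simp_all add: vec3_eq_iff algebra_simps)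
    then have "d *s e2 + (- b) *s e3 = 0" "c *s e2 + (- a) *s e3 = 0" using inj by simp_all
    then have "a = 0" "b = 0" by (simp_all add: vec3_eq_iff)
    then have "f e2 = 0" by (simp add: ab vec3_eq_iff)
    then show False using inj[of e2] by (simp add: vec3_eq_iff)
  qed
  have "bracketD p q r s e1 e2 = p *s e2 + q *s e3" "bracketD p q r s e1 e3 = r *s e2 + s *s e3"
    by (simp_all add: bracketD_def vec3_eq_iff)
  then have "p *s f e2 + q *s f e3 = bracketD p' q' r' s' (f e1) (f e2)"
    "r *s f e2 + s *s f e3 = bracketD p' q' r' s' (f e1) (f e3)"
    using br[of e1 e2] br[of e1 e3] by (simp_all only: add sc)
  then have E: "p * a + q * c = t * (p' * a + r' * b)" "p * b + q * d = t * (q' * a + s' * b)"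
    "r * a + s * c = t * (p' * c + r' * d)" "r * b + s * d = t * (q' * c + s' * d)"
    by (simp_all add: ab cd bracketD_def vec3_eq_iff t_def algebra_simps)
  have "(a * d - b * c) * (t * (p' + s')) = d * (t * (p' * a + r' * b)) - c * (t * (q' * a + s' * b))
      - b * (t * (p' * c + r' * d)) + a * (t * (q' * c + s' * d))" by (simp add: algebra_simps)
  also have "\<dots> = (a * d - b * c) * (p + s)" unfolding E[symmetric] by (simp add: algebra_simps)
  finally have tr: "t * (p' + s') = p + s" using det by simp
  have "(a * d - b * c) * (t\<^sup>2 * (p' * s' - q' * r')) = (t * (p' * a + r' * b)) * (t * (q' * c + s' * d))
      - (t * (q' * a + s' * b)) * (t * (p' * c + r' * d))" by (simp add: algebra_simps power2_eq_square)
  also have "\<dots> = (a * d - b * c) * (p * s - q * r)" unfolding E[symmetric] by (simp add: algebra_simps)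
  finally have "t\<^sup>2 * (p' * s' - q' * r') = p * s - q * r" using det by simp
  then show thesis using that[OF t _ ab cd det E tr] by (simp add: t_def)
qed

subsection \<open>Values of the invariants on the list\<close>

lemma lie_bracket_eq:
  "lie_bracket G1 = bracketD 1 0 0 1" "lie_bracket (G2 \<alpha>) = bracketD 0 1 \<alpha> 1"
  "lie_bracket G3 = bracketD 0 1 0 0" "lie_bracket G4 = bracketD 0 1 1 0"
  "lie_bracket G5 = bracketD 0 1 (- 1) 0"
  by (simp_all add: fun_eq_iff lie_bracket_def bracketD_def table_product_def vec3_eq_iff algebra_simps)

lemma centralizes_derived_novikov_product:
  fixes N :: "'f::field_char_0 novikov_name"
  assumes "listed N" "lie_of N \<noteq> G3"
  shows "centralizes_derived (novikov_product N) u \<longleftrightarrow> u$1 = 0"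
proof
  assume "centralizes_derived (novikov_product N) u"
  then have "lie_bracket (lie_of N) u (lie_bracket (lie_of N) e1 e2) = 0"
    "lie_bracket (lie_of N) u (lie_bracket (lie_of N) e1 e3) = 0"
    by (simp_all add: centralizes_derived_def commutator_novikov_product[OF assms(1)])
  then show "u$1 = 0"
    using assms(2) by (cases "lie_of N") (auto simp: lie_bracket_eq bracketD_def vec3_eq_iff)
next
  assume "u$1 = 0"
  then show "centralizes_derived (novikov_product N) u"
    using assms(2) by (cases "lie_of N")
      (auto simp: centralizes_derived_def commutator_novikov_product[OF assms(1)] lie_bracket_eq bracketD_def vec3_eq_iff)
qed

lemmas product_eval = novikov_product_def table_product_def vec3_eq_iff

lemma square_eigenvectorI:
  fixes N :: "'f::field_char_0 novikov_name"
  assumes "listed N" "lie_of N \<noteq> G3" "novikov_product N x x = k *s x" "x$1 \<noteq> 0"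
  shows "has_square_eigenvector (novikov_product N)"
  unfolding has_square_eigenvector_def using assms centralizes_derived_novikov_product by blast

lemma square_eigenvector_values:
  fixes a :: "'f::field_char_0"
  shows "has_square_eigenvector (novikov_product (N1_1 a))"
    "\<not> has_square_eigenvector (novikov_product (N1_2 :: 'f novikov_name))"
    "has_square_eigenvector (novikov_product (N2_1 \<alpha> a))"
    "a\<^sup>2 + a = \<alpha> \<Longrightarrow> \<not> has_square_eigenvector (novikov_product (N2_2 \<alpha> a))"
    "has_square_eigenvector (novikov_product (N2_3 :: 'f novikov_name))"
    "\<not> has_square_eigenvector (novikov_product (N2_4 :: 'f novikov_name))"
    "\<not> has_square_eigenvector (novikov_product (N2_5 (- 2/9) :: 'f novikov_name))"
    "has_square_eigenvector (novikov_product (N2_6 :: 'f novikov_name))"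
    "\<not> has_square_eigenvector (novikov_product (N2_7 :: 'f novikov_name))"
    "a \<noteq> 0 \<Longrightarrow> has_square_eigenvector (novikov_product (N2_8 a))"
    "\<not> has_square_eigenvector (novikov_product (N2_9 :: 'f novikov_name))"
    "has_square_eigenvector (novikov_product (N2_10 a))"
    "\<not> has_square_eigenvector (novikov_product (N2_11 :: 'f novikov_name))"
    "has_square_eigenvector (novikov_product (N4_1 a))"
    "\<not> has_square_eigenvector (novikov_product (N4_2 :: 'f novikov_name))"
proof -
  have no: "\<not> has_square_eigenvector (novikov_product N)"
    if "listed N" "lie_of N \<noteq> G3" "\<And>x k. novikov_product N x x = k *s x \<Longrightarrow> x$1 = 0" for N :: "'f novikov_name"
    unfolding has_square_eigenvector_def using that centralizes_derived_novikov_product by blast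
  have cancel: "y = z" if "x * y = x * z" "x \<noteq> 0" for x y z :: 'f using that by simp
  show "has_square_eigenvector (novikov_product (N1_1 a))"
    by (rule square_eigenvectorI[where x = e1 and k = a]) (simp_all add: product_eval)
  show "has_square_eigenvector (novikov_product (N2_1 \<alpha> a))"
    by (rule square_eigenvectorI[where x = e1 and k = a]) (simp_all add: product_eval)
  show "has_square_eigenvector (novikov_product (N2_3 :: 'f novikov_name))"
    by (rule square_eigenvectorI[where x = e1 and k = "- 1/3"]) (simp_all add: product_eval)
  show "has_square_eigenvector (novikov_product (N2_6 :: 'f novikov_name))"
    by (rule square_eigenvectorI[where x = "vector [1, - 4/9, 2/3]" and k = "- 2/3"]) (simp_all add: product_eval)
  show "has_square_eigenvector (novikov_product (N2_8 a))" if "a \<noteq> 0"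
    by (rule square_eigenvectorI[where x = e1 and k = a]) (simp_all add: product_eval that)
  show "has_square_eigenvector (novikov_product (N2_10 a))"
    by (rule square_eigenvectorI[where x = e1 and k = a]) (simp_all add: product_eval)
  show "has_square_eigenvector (novikov_product (N4_1 a))"
    by (rule square_eigenvectorI[where x = e1 and k = a]) (simp_all add: product_eval)
  show "\<not> has_square_eigenvector (novikov_product (N1_2 :: 'f novikov_name))"
  proof (rule no)
    fix x k assume "novikov_product (N1_2 :: 'f novikov_name) x x = k *s x"
    then have H: "novikov_product (N1_2 :: 'f novikov_name) x x $ i = k * x$i" for i by simp
    have E1: "- (x$1 * x$1) = k * x$1"
      using H[of 1] by (simp add: novikov_product_def table_product_def field_simps power2_eq_square; algebra?)
    have E2: "x$1 * x$1 - x$2 * x$1 = k * x$2"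
      using H[of 2] by (simp add: novikov_product_def table_product_def field_simps power2_eq_square; algebra?)
    have "x$1 * x$1 * x$1 = 0" using E1 E2 by algebra
    then show "x$1 = 0" by simp
  qed simp_all
  show "\<not> has_square_eigenvector (novikov_product (N2_2 \<alpha> a))" if "a\<^sup>2 + a = \<alpha>"
  proof (rule no)
    fix x k assume "novikov_product (N2_2 \<alpha> a) x x = k *s x"
    then have H: "novikov_product (N2_2 \<alpha> a) x x $ i = k * x$i" for i by simp
    have E1: "a * (x$1 * x$1) = k * x$1"
      using H[of 1] by (simp add: novikov_product_def table_product_def field_simps power2_eq_square; algebra?)
    have E2: "x$1 * x$1 + 2 * a * x$1 * x$2 + (a * a + a) * x$1 * x$3 = k * x$2"
      using H[of 2] by (simp add: novikov_product_def table_product_def field_simps power2_eq_square; algebra?)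
    have E3: "x$1 * x$2 + (2 * a + 1) * x$1 * x$3 = k * x$3"
      using H[of 3] by (simp add: novikov_product_def table_product_def field_simps power2_eq_square; algebra?)
    have "x$1 * x$1 * x$1 = 0" using E1 E2 E3 by algebra
    then show "x$1 = 0" by simp
  qed (simp_all add: that)
  show "\<not> has_square_eigenvector (novikov_product (N2_4 :: 'f novikov_name))"
  proof (rule no)
    fix x k assume "novikov_product (N2_4 :: 'f novikov_name) x x = k *s x"
    then have H: "novikov_product (N2_4 :: 'f novikov_name) x x $ i = k * x$i" for i by simp
    have E1: "- (x$1 * x$1) = 3 * (k * x$1)"
      using H[of 1] by (simp add: novikov_product_def table_product_def field_simps power2_eq_square; algebra?)
    have E2: "9 * (x$1 * x$1) + 48 * (x$1 * x$2) + 16 * (x$1 * x$3) = 9 * (k * x$2)"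
      using H[of 2] by (simp add: novikov_product_def table_product_def field_simps power2_eq_square; algebra?)
    have E3: "- 51 * (x$1 * x$2) - 17 * (x$1 * x$3) = 3 * (k * x$3)"
      using H[of 3] by (simp add: novikov_product_def table_product_def field_simps power2_eq_square; algebra?)
    have "x$1 * x$1 * x$1 = 0" using E1 E2 E3 by algebra
    then show "x$1 = 0" by simp
  qed simp_all
  show "\<not> has_square_eigenvector (novikov_product (N2_9 :: 'f novikov_name))"
  proof (rule no)
    fix x k assume "novikov_product (N2_9 :: 'f novikov_name) x x = k *s x"
    then have H: "novikov_product (N2_9 :: 'f novikov_name) x x $ i = k * x$i" for i by simp
    have E1: "- (x$1 * x$1) = k * x$1"
      using H[of 1] by (simp add: novikov_product_def table_product_def field_simps power2_eq_square; algebra?)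
    have E2: "0 = k * x$2"
      using H[of 2] by (simp add: novikov_product_def table_product_def field_simps power2_eq_square; algebra?)
    have E3: "x$1 * x$1 - x$2 * x$1 - x$3 * x$1 = k * x$3"
      using H[of 3] by (simp add: novikov_product_def table_product_def field_simps power2_eq_square; algebra?)
    have "x$1 * x$1 * x$1 * x$1 = 0" using E1 E2 E3 by algebra
    then show "x$1 = 0" by simp
  qed simp_all
  show "\<not> has_square_eigenvector (novikov_product (N2_11 :: 'f novikov_name))"
  proof (rule no)
    fix x k assume "novikov_product (N2_11 :: 'f novikov_name) x x = k *s x"
    then have H: "novikov_product (N2_11 :: 'f novikov_name) x x $ i = k * x$i" for i by simp
    have E1: "- (x$1 * x$1) = k * x$1"
      using H[of 1] by (simp add: novikov_product_def table_product_def field_simps power2_eq_square; algebra?)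
    have E2: "- 2 * (x$1 * x$2) - x$2 * x$2 = k * x$2"
      using H[of 2] by (simp add: novikov_product_def table_product_def field_simps power2_eq_square; algebra?)
    have E3: "x$1 * x$1 + x$1 * x$2 + x$2 * x$2 - x$1 * x$3 = k * x$3"
      using H[of 3] by (simp add: novikov_product_def table_product_def field_simps power2_eq_square; algebra?)
    have "x$1 * x$1 * x$1 = 0" using E1 E2 E3 by algebra
    then show "x$1 = 0" by simp
  qed simp_all
  show "\<not> has_square_eigenvector (novikov_product (N4_2 :: 'f novikov_name))"
  proof (rule no)
    fix x k assume "novikov_product (N4_2 :: 'f novikov_name) x x = k *s x"
    then have H: "novikov_product (N4_2 :: 'f novikov_name) x x $ i = k * x$i" for i by simp
    have E1: "x$1 * x$1 = k * x$1"
      using H[of 1] by (simp add: novikov_product_def table_product_def field_simps power2_eq_square; algebra?)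
    have E2: "2 * (x$1 * x$2) + x$1 * x$3 = k * x$2"
      using H[of 2] by (simp add: novikov_product_def table_product_def field_simps power2_eq_square; algebra?)
    have E3: "x$1 * x$1 + x$1 * x$2 + 2 * (x$1 * x$3) = k * x$3"
      using H[of 3] by (simp add: novikov_product_def table_product_def field_simps power2_eq_square; algebra?)
    have "x$1 * x$1 * x$1 = 0" using E1 E2 E3 by algebra
    then show "x$1 = 0" by simp
  qed simp_all
  show "\<not> has_square_eigenvector (novikov_product (N2_7 :: 'f novikov_name))"
  proof (rule no)
    fix x k assume "novikov_product (N2_7 :: 'f novikov_name) x x = k *s x"
    then have H: "novikov_product (N2_7 :: 'f novikov_name) x x $ i = k * x$i" for i by simp
    have E1: "- 2 * (x$1 * x$1) = 3 * (k * x$1)"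
      using H[of 1] by (simp add: novikov_product_def table_product_def field_simps power2_eq_square; algebra?)
    have E2: "- 11 * (x$1 * x$1) - 72 * (x$1 * x$2) - 18 * (x$1 * x$3) - 9 * (3 * x$2 + x$3)\<^sup>2 = 27 * (k * x$2)"
      using H[of 2] by (simp add: novikov_product_def table_product_def field_simps power2_eq_square; algebra?)
    have E3: "x$1 * x$1 + 5 * (x$1 * x$2) + x$1 * x$3 + (3 * x$2 + x$3)\<^sup>2 = k * x$3"
      using H[of 3] by (simp add: novikov_product_def table_product_def field_simps power2_eq_square; algebra?)
    have "3 * (2 * x$1 + 9 * x$2 + 3 * x$3) * (x$1 * x$1) = 0" using E1 E2 E3 by algebra
    then have "x$1 = 0 \<or> 2 * x$1 + 9 * x$2 + 3 * x$3 = 0" unfolding mult_eq_0_iff by auto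
    then show "x$1 = 0"
    proof
      assume "2 * x$1 + 9 * x$2 + 3 * x$3 = 0"
      then have "x$1 * x$1 * x$1 = 0" using E1 E2 E3 by algebra
      then show ?thesis by simp
    qed
  qed simp_all
  show "\<not> has_square_eigenvector (novikov_product (N2_5 (- 2/9) :: 'f novikov_name))"
  proof (rule no)
    fix x k assume "novikov_product (N2_5 (- 2/9) :: 'f novikov_name) x x = k *s x"
    then have H: "novikov_product (N2_5 (- 2/9) :: 'f novikov_name) x x $ i = k * x$i" for i by simp
    have E1: "- 2 * (x$1 * x$1) = 3 * (k * x$1)"
      using H[of 1] by (simp add: novikov_product_def table_product_def field_simps power2_eq_square; algebra?)
    have E2: "- 2 * (x$1 * x$1) - 72 * (x$1 * x$2) - 18 * (x$1 * x$3) - 9 * (3 * x$2 + x$3)\<^sup>2 = 27 * (k * x$2)"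
      using H[of 2] by (simp add: novikov_product_def table_product_def field_simps power2_eq_square; algebra?)
    have E3: "5 * (x$1 * x$2) + x$1 * x$3 + (3 * x$2 + x$3)\<^sup>2 = k * x$3"
      using H[of 3] by (simp add: novikov_product_def table_product_def field_simps power2_eq_square; algebra?)
    have "3 * (2 * x$1 + 9 * x$2 + 3 * x$3) * (x$1 * x$1) = 0" using E1 E2 E3 by algebra
    then have "x$1 = 0 \<or> 2 * x$1 + 9 * x$2 + 3 * x$3 = 0" unfolding mult_eq_0_iff by auto
    then show "x$1 = 0"
    proof
      assume "2 * x$1 + 9 * x$2 + 3 * x$3 = 0"
      then have "x$1 * x$1 * x$1 = 0" using E1 E2 E3 by algebra
      then show ?thesis by simp
    qed
  qed simp_all
qed

lemma inner_product_values:
  fixes a :: "'f::field_char_0"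
  shows "\<not> has_inner_product (novikov_product (N2_1 \<alpha> a))"
    "a\<^sup>2 + a = \<alpha> \<Longrightarrow> \<not> has_inner_product (novikov_product (N2_2 \<alpha> a))"
    "\<not> has_inner_product (novikov_product (N2_3 :: 'f novikov_name))"
    "\<not> has_inner_product (novikov_product (N2_4 :: 'f novikov_name))"
    "has_inner_product (novikov_product (N2_5 a))"
    "has_inner_product (novikov_product (N2_6 :: 'f novikov_name))"
    "has_inner_product (novikov_product (N2_7 :: 'f novikov_name))"
    "a \<noteq> 0 \<Longrightarrow> \<not> has_inner_product (novikov_product (N2_8 a))"
    "\<not> has_inner_product (novikov_product (N2_9 :: 'f novikov_name))"
    "has_inner_product (novikov_product (N2_10 a))"
    "has_inner_product (novikov_product (N2_11 :: 'f novikov_name))"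
proof -
  have yes: "has_inner_product (novikov_product N)"
    if "listed N" "lie_of N \<noteq> G3" "novikov_product N e2 e2 \<noteq> 0" for N :: "'f novikov_name"
    unfolding has_inner_product_def using that centralizes_derived_novikov_product e_nth(4) by blast
  have no: "\<not> has_inner_product (novikov_product N)"
    if "listed N" "lie_of N \<noteq> G3" "\<And>u v. u$1 = 0 \<Longrightarrow> v$1 = 0 \<Longrightarrow> novikov_product N u v = 0" for N :: "'f novikov_name"
    unfolding has_inner_product_def using that centralizes_derived_novikov_product by blast
  show "\<not> has_inner_product (novikov_product (N2_1 \<alpha> a))"
    "a\<^sup>2 + a = \<alpha> \<Longrightarrow> \<not> has_inner_product (novikov_product (N2_2 \<alpha> a))"
    "\<not> has_inner_product (novikov_product (N2_3 :: 'f novikov_name))"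
    "\<not> has_inner_product (novikov_product (N2_4 :: 'f novikov_name))"
    "a \<noteq> 0 \<Longrightarrow> \<not> has_inner_product (novikov_product (N2_8 a))"
    "\<not> has_inner_product (novikov_product (N2_9 :: 'f novikov_name))"
    by (rule no; simp add: product_eval)+
  show "has_inner_product (novikov_product (N2_5 a))"
    "has_inner_product (novikov_product (N2_6 :: 'f novikov_name))"
    "has_inner_product (novikov_product (N2_7 :: 'f novikov_name))"
    "has_inner_product (novikov_product (N2_10 a))"
    "has_inner_product (novikov_product (N2_11 :: 'f novikov_name))"
    by (rule yes; simp add: product_eval)+
qed

lemma right_scalar_values:
  fixes a :: "'f::field_char_0"
  shows "right_scalar (novikov_product (N2_1 \<alpha> a))"
    "a\<^sup>2 + a = \<alpha> \<Longrightarrow> right_scalar (novikov_product (N2_2 \<alpha> a))"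
    "\<not> right_scalar (novikov_product (N2_3 :: 'f novikov_name))"
    "\<not> right_scalar (novikov_product (N2_4 :: 'f novikov_name))"
    "a \<noteq> 0 \<Longrightarrow> \<not> right_scalar (novikov_product (N2_8 a))"
    "\<not> right_scalar (novikov_product (N2_9 :: 'f novikov_name))"
proof -
  have yes: "right_scalar (novikov_product N)"
    if "listed N" "lie_of N \<noteq> G3" "\<And>u x. u$1 = 0 \<Longrightarrow> novikov_product N u x = (c * x$1) *s u"
    for N :: "'f novikov_name" and c
    unfolding right_scalar_def using that centralizes_derived_novikov_product by blast
  have no: "\<not> right_scalar (novikov_product N)"
    if "listed N" "lie_of N \<noteq> G3" "\<And>k. novikov_product N e2 e1 \<noteq> k *s e2" for N :: "'f novikov_name"
    unfolding right_scalar_def using that centralizes_derived_novikov_product e_nth(4) by blast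
  show "right_scalar (novikov_product (N2_1 \<alpha> a))"
    by (rule yes[where c = a]; simp add: product_eval)
  show "a\<^sup>2 + a = \<alpha> \<Longrightarrow> right_scalar (novikov_product (N2_2 \<alpha> a))"
    by (rule yes[where c = a]; simp add: product_eval)
  show "\<not> right_scalar (novikov_product (N2_3 :: 'f novikov_name))"
    "\<not> right_scalar (novikov_product (N2_4 :: 'f novikov_name))"
    "a \<noteq> 0 \<Longrightarrow> \<not> right_scalar (novikov_product (N2_8 a))"
    "\<not> right_scalar (novikov_product (N2_9 :: 'f novikov_name))"
    by (rule no; simp add: product_eval)+
qed

lemma square_witness_N2_7: "square_witness (novikov_product (N2_7 :: 'f::field_char_0 novikov_name))"
proof -
  have V: "centralizes_derived (novikov_product (N2_7 :: 'f novikov_name)) u \<longleftrightarrow> u$1 = 0" for u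
    by (rule centralizes_derived_novikov_product) simp_all
  show ?thesis
    unfolding square_witness_def V
    by (rule exI[of _ "vector [1, - 4/9, 2/3]"], rule exI[of _ "vector [0, 2, - 3]"])
      (simp add: product_eval field_simps)
qed

lemma square_witness_N2_5:
  assumes "square_witness (novikov_product (N2_5 (- 2/9) :: 'f::field_char_0 novikov_name))"
  shows "\<exists>j :: 'f. j\<^sup>2 = - 2"
proof -
  let ?m = "novikov_product (N2_5 (- 2/9) :: 'f novikov_name)"
  have V: "centralizes_derived ?m u \<longleftrightarrow> u$1 = 0" for u by (rule centralizes_derived_novikov_product) simp_all
  obtain x u where u: "u$1 = 0" and x: "\<And>v. v$1 = 0 \<Longrightarrow> ?m v x = (- 2/3) *s v"
    and eq: "27 *s (?m x x + (2/3) *s x) = ?m u u"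
    using assms unfolding square_witness_def V by blast
  have H: "?m (vector [0, 2, - 3]) x $ i = (- 2/3) * vector [0, 2, - 3] $ i" for i
    using x[of "vector [0, 2, - 3]"] by simp
  have A: "18 * x$1 + 27 * x$2 + 9 * x$3 = 12"
    using H[of 2] by (simp add: novikov_product_def table_product_def field_simps; algebra?)
  have B: "4 * x$1 + 9 * x$2 + 3 * x$3 = 2"
    using H[of 3] by (simp add: novikov_product_def table_product_def field_simps; algebra?)
  have "6 * x$1 = (18 * x$1 + 27 * x$2 + 9 * x$3) - 3 * (4 * x$1 + 9 * x$2 + 3 * x$3)"
    by (simp add: algebra_simps)
  then have "6 * x$1 = 6" unfolding A B by simp
  then have x1: "x$1 = 1" by simp
  have "3 * (3 * x$2 + x$3) = (4 * x$1 + 9 * x$2 + 3 * x$3) - 4 * x$1" by simp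
  then have "3 * (3 * x$2 + x$3) = - 2" unfolding B by (simp add: x1)
  then have x23: "3 * x$2 + x$3 = - 2 / 3" by (metis nonzero_mult_div_cancel_left zero_neq_numeral)
  have "(27 *s (?m x x + (2/3) *s x)) $ 3 = ?m u u $ 3" using eq by simp
  then have A1: "27 * (5 * x$2 + x$3 + (3 * x$2 + x$3)\<^sup>2 + 2/3 * x$3) = (3 * u$2 + u$3)\<^sup>2"
    by (simp add: novikov_product_def table_product_def x1 u power2_eq_square algebra_simps)
  have A2: "5 * x$2 + x$3 + (3 * x$2 + x$3)\<^sup>2 + 2/3 * x$3
      = 5/3 * (3 * x$2 + x$3) + (3 * x$2 + x$3)\<^sup>2" by (simp add: field_simps)
  have "(3 * u$2 + u$3)\<^sup>2 = 27 * (5/3 * (- 2/3) + (- 2/3)\<^sup>2)"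
    using A1[symmetric] unfolding A2 unfolding x23 .
  also have "\<dots> = - 18" by (simp add: power2_eq_square)
  finally have "((3 * u$2 + u$3) / 3)\<^sup>2 = - 2" by (simp add: power_divide)
  then show ?thesis by blast
qed

lemma heisenberg_values:
  fixes a :: "'f::field_char_0"
  shows "\<not> has_idempotent (novikov_product (N3_1 a))" "\<not> has_idempotent (novikov_product (N3_2 a))"
    "has_idempotent (novikov_product (N3_3 :: 'f novikov_name))"
    "has_idempotent (novikov_product (N3_4 :: 'f novikov_name))"
    "\<not> has_idempotent (novikov_product (N3_5 :: 'f novikov_name))"
    "has_cube_zero (novikov_product (N3_3 :: 'f novikov_name))"
    "\<not> has_cube_zero (novikov_product (N3_4 :: 'f novikov_name))"
    "has_cube (novikov_product (N3_1 a))"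
    "\<not> has_cube (novikov_product (N3_2 a))"
    "\<not> has_cube (novikov_product (N3_5 :: 'f novikov_name))"
    "has_square (novikov_product (N3_2 a))"
    "\<not> has_square (novikov_product (N3_5 :: 'f novikov_name))"
    "cube_ratio a (novikov_product (N3_1 a))"
    "cube_ratio a (novikov_product (N3_1 b)) \<Longrightarrow> a = b"
    "form_discriminant a (novikov_product (N3_2 a))"
    "form_discriminant a (novikov_product (N3_2 b)) \<Longrightarrow> a = b"
proof -
  show "\<not> has_idempotent (novikov_product (N3_1 a))" "\<not> has_idempotent (novikov_product (N3_2 a))"
    "\<not> has_idempotent (novikov_product (N3_5 :: 'f novikov_name))"
    by (auto simp: has_idempotent_def product_eval)
  show "has_idempotent (novikov_product (N3_3 :: 'f novikov_name))"
    "has_idempotent (novikov_product (N3_4 :: 'f novikov_name))"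
    unfolding has_idempotent_def by (rule exI[of _ e2]; simp add: product_eval)+
  show "has_cube_zero (novikov_product (N3_3 :: 'f novikov_name))"
    unfolding has_cube_zero_def by (rule exI[of _ e1]; simp add: product_eval)
  show "\<not> has_cube_zero (novikov_product (N3_4 :: 'f novikov_name))"
    by (auto simp: has_cube_zero_def product_eval)
  have "a \<noteq> 0 \<or> a + 1 \<noteq> 0" by auto
  then show "has_cube (novikov_product (N3_1 a))"
    unfolding has_cube_def by (intro exI[of _ e1]) (auto simp add: product_eval)
  show "\<not> has_cube (novikov_product (N3_2 a))" "\<not> has_cube (novikov_product (N3_5 :: 'f novikov_name))"
    by (auto simp: has_cube_def product_eval)
  show "has_square (novikov_product (N3_2 a))"
    unfolding has_square_def by (rule exI[of _ e2]; simp add: product_eval)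
  show "\<not> has_square (novikov_product (N3_5 :: 'f novikov_name))"
    by (auto simp: has_square_def product_eval)
  show "cube_ratio a (novikov_product (N3_1 a))"
    by (auto simp: cube_ratio_def product_eval)
  show "a = b" if "cube_ratio a (novikov_product (N3_1 b))"
    using that[unfolded cube_ratio_def, rule_format, of e1] by (simp add: product_eval algebra_simps)
  show "form_discriminant a (novikov_product (N3_2 a))"
    unfolding form_discriminant_def
    by (rule exI[of _ e1], rule exI[of _ e2], rule exI[of _ a], rule exI[of _ 1], rule exI[of _ 1])
      (simp add: product_eval commutator_def)
  show "a = b" if W: "form_discriminant a (novikov_product (N3_2 b))"
  proof -
    obtain x y p q s where nz: "commutator (novikov_product (N3_2 b)) x y \<noteq> 0"
      and xx: "novikov_product (N3_2 b) x x = p *s commutator (novikov_product (N3_2 b)) x y"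
      and xy: "novikov_product (N3_2 b) x y = q *s commutator (novikov_product (N3_2 b)) x y"
      and yy: "novikov_product (N3_2 b) y y = s *s commutator (novikov_product (N3_2 b)) x y"
      and a: "p * s - q * (q - 1) = a"
      using W unfolding form_discriminant_def by blast
    define d where "d = x$1 * y$2 - x$2 * y$1"
    have K: "commutator (novikov_product (N3_2 b)) x y = d *s e3"
      by (simp add: commutator_def product_eval d_def algebra_simps)
    have d: "d \<noteq> 0" using nz by (auto simp: K)
    have E: "p * d = b * x$1 * x$1 + x$1 * x$2 + x$2 * x$2" "q * d = b * x$1 * y$1 + x$1 * y$2 + x$2 * y$2"
      "s * d = b * y$1 * y$1 + y$1 * y$2 + y$2 * y$2"
      using xx xy yy unfolding K by (simp_all add: product_eval algebra_simps)
    have "d * d * a = (p * d) * (s * d) - (q * d) * (q * d - d)" by (simp add: a[symmetric] algebra_simps)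
    also have "\<dots> = d * d * b" unfolding E by (simp add: d_def algebra_simps)
    finally show "a = b" using d by simp
  qed
qed

section \<open>Isomorphisms between members of the list\<close>

text \<open>The coefficient \<open>c\<close> with \<open>e\<^sub>1 e\<^sub>1 \<in> c e\<^sub>1 + V\<close>; the Heisenberg algebras get a dummy value.\<close>

fun top_coeff :: "'f::field novikov_name \<Rightarrow> 'f" where
  "top_coeff (N1_1 a) = a" | "top_coeff N1_2 = -1"
| "top_coeff (N2_1 \<alpha> a) = a" | "top_coeff (N2_2 \<alpha> a) = a"
| "top_coeff N2_3 = -1/3" | "top_coeff N2_4 = -1/3" | "top_coeff (N2_5 a) = 3 * a"
| "top_coeff N2_6 = -2/3" | "top_coeff N2_7 = -2/3"
| "top_coeff (N2_8 a) = a" | "top_coeff N2_9 = -1" | "top_coeff (N2_10 a) = a" | "top_coeff N2_11 = -1"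
| "top_coeff (N3_1 a) = 0" | "top_coeff (N3_2 a) = 0" | "top_coeff N3_3 = 0" | "top_coeff N3_4 = 0"
| "top_coeff N3_5 = 0"
| "top_coeff (N4_1 a) = a" | "top_coeff N4_2 = 1" | "top_coeff (N5_1 a) = a"

lemma novikov_product_first:
  "lie_of N \<noteq> G3 \<Longrightarrow> novikov_product N x y $ 1 = top_coeff N * x$1 * y$1" for N :: "'f::field_char_0 novikov_name"
  by (cases N) (simp_all add: novikov_product_def table_product_def)

fun lie_trace :: "'f::field lie_name \<Rightarrow> 'f" where
  "lie_trace G1 = 2" | "lie_trace (G2 \<alpha>) = 1" | "lie_trace G3 = 0" | "lie_trace G4 = 0" | "lie_trace G5 = 0"

fun lie_det :: "'f::field lie_name \<Rightarrow> 'f" where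
  "lie_det G1 = 1" | "lie_det (G2 \<alpha>) = - \<alpha>" | "lie_det G3 = 0" | "lie_det G4 = -1" | "lie_det G5 = 1"

lemma lie_bracket_coefficients:
  "\<exists>p q r s. lie_bracket g = bracketD p q r s \<and> p + s = lie_trace g \<and> p * s - q * r = lie_det g \<and>
    (g = G1 \<longrightarrow> p = 1 \<and> q = 0 \<and> r = 0 \<and> s = 1) \<and> (g \<noteq> G1 \<longrightarrow> p = 0 \<and> q = 1)"
proof (cases g)
  case G1
  then show ?thesis
    by - (rule exI[of _ 1], rule exI[of _ 0], rule exI[of _ 0], rule exI[of _ 1], simp add: lie_bracket_eq)
next
  case (G2 \<alpha>)
  then show ?thesis
    by - (rule exI[of _ 0], rule exI[of _ 1], rule exI[of _ \<alpha>], rule exI[of _ 1], simp add: lie_bracket_eq)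
next
  case G3
  then show ?thesis
    by - (rule exI[of _ 0], rule exI[of _ 1], rule exI[of _ 0], rule exI[of _ 0], simp add: lie_bracket_eq)
next
  case G4
  then show ?thesis
    by - (rule exI[of _ 0], rule exI[of _ 1], rule exI[of _ 1], rule exI[of _ 0], simp add: lie_bracket_eq)
next
  case G5
  then show ?thesis
    by - (rule exI[of _ 0], rule exI[of _ 1], rule exI[of _ "- 1"], rule exI[of _ 0], simp add: lie_bracket_eq)
qed

lemma isomorphic_sym: "isomorphic M N \<Longrightarrow> isomorphic N M"
  unfolding isomorphic_def by (rule algebra_iso_sym)

text \<open>The trace and determinant of \<open>D\<close> do not distinguish a scalar operator from a Jordan block, so the
  last conclusion is drawn from the conjugation itself.\<close>

lemma isomorphic_factor:
  fixes M N :: "'f::field_char_0 novikov_name"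
  assumes "listed M" "listed N" and iso: "isomorphic M N" and N: "lie_of N \<noteq> G3"
  obtains t where "t \<noteq> 0" "t * lie_trace (lie_of N) = lie_trace (lie_of M)"
    "t\<^sup>2 * lie_det (lie_of N) = lie_det (lie_of M)" "lie_of M \<noteq> G3 \<Longrightarrow> top_coeff M = t * top_coeff N"
    "lie_of M = G1 \<Longrightarrow> lie_of N = G1"
proof -
  obtain f where f: "\<And>x y. f (x + y) = f x + f y" "\<And>c x. f (c *s x) = c *s f x"
    "\<And>x y. f (x - y) = f x - f y" "f 0 = 0" "\<And>x. f x = 0 \<longleftrightarrow> x = 0" "inj f" "surj f"
    "\<And>x y. f (novikov_product M x y) = novikov_product N (f x) (f y)"
    "\<And>x y. f (commutator (novikov_product M) x y) = commutator (novikov_product N) (f x) (f y)"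
    by (rule iso3E[OF iso[unfolded isomorphic_def]], rule that, assumption+)
  obtain p q r s where M: "lie_bracket (lie_of M) = bracketD p q r s" "p + s = lie_trace (lie_of M)"
    "p * s - q * r = lie_det (lie_of M)" "lie_of M = G1 \<Longrightarrow> p = 1 \<and> q = 0 \<and> r = 0 \<and> s = 1"
    using lie_bracket_coefficients[of "lie_of M"] by blast
  obtain p' q' r' s' where N': "lie_bracket (lie_of N) = bracketD p' q' r' s'" "p' + s' = lie_trace (lie_of N)"
    "p' * s' - q' * r' = lie_det (lie_of N)" "lie_of N \<noteq> G1 \<Longrightarrow> q' = 1 \<and> p' = 0"
    using lie_bracket_coefficients[of "lie_of N"] by blast
  have br: "f (bracketD p q r s x y) = bracketD p' q' r' s' (f x) (f y)" for x y
    using f(9) unfolding commutator_novikov_product[OF assms(1)] commutator_novikov_product[OF assms(2)] M N' .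
  have nn: "p' * s' - q' * r' \<noteq> 0 \<or> p' + s' \<noteq> 0"
    unfolding N' using N by (cases "lie_of N") auto
  obtain t a b c d where t: "t \<noteq> 0" "f e1 $ 1 = t" and F: "f e2 = vector [0, a, b]" "f e3 = vector [0, c, d]"
    "a * d - b * c \<noteq> 0" and
    E: "p * a + q * c = t * (p' * a + r' * b)" "p * b + q * d = t * (q' * a + s' * b)"
    "r * a + s * c = t * (p' * c + r' * d)" "r * b + s * d = t * (q' * c + s' * d)" and
    T: "t * (p' + s') = p + s" "t\<^sup>2 * (p' * s' - q' * r') = p * s - q * r"
    by (rule lie_isomorphism[OF f(1,2,5,7) br nn])
  have first: "f x $ 1 = t * x$1" for x
  proof -
    have "x = x$1 *s e1 + x$2 *s e2 + x$3 *s e3" by (simp add: vec3_eq_iff)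
    then have "f x = f (x$1 *s e1 + x$2 *s e2 + x$3 *s e3)" by (rule arg_cong)
    then show ?thesis by (simp add: f(1,2) t F)
  qed
  show thesis
  proof (rule that[OF t(1)])
    show "t * lie_trace (lie_of N) = lie_trace (lie_of M)" "t\<^sup>2 * lie_det (lie_of N) = lie_det (lie_of M)"
      using T unfolding M N' .
    show "top_coeff M = t * top_coeff N" if "lie_of M \<noteq> G3"
    proof -
      have "f (novikov_product M e1 e1) $ 1 = novikov_product N (f e1) (f e1) $ 1" by (simp only: f(8))
      then have "t * top_coeff M = t * (t * top_coeff N)"
        by (simp add: first novikov_product_first[OF that] novikov_product_first[OF N] algebra_simps)
      then show ?thesis using t(1) by simp
    qed
    show "lie_of N = G1" if "lie_of M = G1"
    proof (rule ccontr)
      assume "lie_of N \<noteq> G1"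
      then have e: "p = 1" "q = 0" "r = 0" "s = 1" "p' = 0" "q' = 1" using M(4)[OF that] N'(4) by auto
      have "a = t * (r' * b)" "c = t * (r' * d)" using E by (simp_all add: e)
      then show False using F(3) by simp
    qed
  qed
qed

lemma isomorphic_lie_type:
  fixes M N :: "'f::field_char_0 novikov_name"
  assumes "listed M" "listed N" and iso: "isomorphic M N"
  shows "lie_of M = lie_of N \<or> (\<exists>i :: 'f. i\<^sup>2 = - 1) \<and> (lie_of M = G5 \<or> lie_of N = G5)"
proof -
  have half: "lie_of M = lie_of N \<or> (\<exists>i :: 'f. i\<^sup>2 = - 1) \<and> (lie_of M = G5 \<or> lie_of N = G5)
      \<or> (lie_of N = G1 \<and> (\<exists>\<alpha>. lie_of M = G2 \<alpha>))"
    if L: "listed M" "listed N" "isomorphic M N" "lie_of N \<noteq> G3" for M N :: "'f novikov_name"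
  proof -
    obtain t where "t \<noteq> 0" "t * lie_trace (lie_of N) = lie_trace (lie_of M)"
      "t\<^sup>2 * lie_det (lie_of N) = lie_det (lie_of M)" "lie_of M = G1 \<Longrightarrow> lie_of N = G1"
      by (rule isomorphic_factor[OF L]) (rule that, assumption+)
    moreover have "i\<^sup>2 = - 1" if "- (i\<^sup>2) = 1" for i :: 'f using that by (metis minus_minus)
    ultimately show ?thesis
      using \<open>lie_of N \<noteq> G3\<close> by (cases "lie_of M"; cases "lie_of N") auto
  qed
  have g: "\<not> (lie_of N = G1 \<and> (\<exists>\<alpha>. lie_of M = G2 \<alpha>))"
    if L: "listed M" "listed N" "isomorphic M N" for M N :: "'f novikov_name"
  proof
    assume A: "lie_of N = G1 \<and> (\<exists>\<alpha>. lie_of M = G2 \<alpha>)"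
    then have "lie_of M \<noteq> G3" by auto
    then have "lie_of M = G1" 
      using isomorphic_factor[OF L(2,1) isomorphic_sym[OF L(3)]] A by metis
    then show False using A by auto
  qed
  consider "lie_of N \<noteq> G3" | "lie_of M \<noteq> G3" | "lie_of M = lie_of N" by metis
  then show ?thesis
  proof cases
    case 1
    then show ?thesis using half[OF assms] g[OF assms] by blast
  next
    case 2
    then show ?thesis
      using half[OF assms(2,1) isomorphic_sym[OF iso]] g[OF assms(2,1) isomorphic_sym[OF iso]] by metis
  qed blast
qed

text \<open>Equality of the Lie algebras forces \<open>t = 1\<close> if \<open>D\<close> has trace 1 or 2, so that \<open>c\<close> is an invariant, and
  \<open>t = \<plusminus> 1\<close> if it has trace 0, which is the source of the pairs \<open>a\<close>, \<open>- a\<close>.  The remaining coincidences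
  of \<open>c\<close> are excluded by \<open>V V = 0\<close>, \<open>Q = 0\<close>, \<open>w = 0\<close> in this order, and by the square class of \<open>w\<close> for
  \<open>N2_7\<close>.\<close>

lemma isomorphic_classification:
  fixes M N :: "'f::field_char_0 novikov_name"
  assumes M: "listed M" and N: "listed N" and iso: "isomorphic M N"
    and i: "(\<nexists>i :: 'f. i\<^sup>2 = - 1) \<or> lie_of M \<noteq> G5 \<and> lie_of N \<noteq> G5"
    and j: "(\<nexists>j :: 'f. j\<^sup>2 = - 2) \<or> M \<noteq> N2_7 \<and> N \<noteq> N2_7"
  shows "M = N \<or> (\<exists>a. M = N4_1 a \<and> N = N4_1 (- a)) \<or> (\<exists>a. M = N5_1 a \<and> N = N5_1 (- a))"
proof -
  note inv = invariants_eq[OF iso[unfolded isomorphic_def]]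
  have L: "lie_of M = lie_of N" using isomorphic_lie_type[OF M N iso] i by blast
  show ?thesis
  proof (cases "lie_of N = G3")
    case True
    have "M = N"
      using True L inv(5-8) inv(9)[of "case N of N3_1 a \<Rightarrow> a"] inv(10)[of "case N of N3_2 a \<Rightarrow> a"]
      by (cases M; cases N; simp add: heisenberg_values) (auto dest: heisenberg_values(14,16))
    then show ?thesis by simp
  next
    case False
    obtain t where t: "t \<noteq> 0" "t * lie_trace (lie_of N) = lie_trace (lie_of M)"
      "t\<^sup>2 * lie_det (lie_of N) = lie_det (lie_of M)" "lie_of M \<noteq> G3 \<Longrightarrow> top_coeff M = t * top_coeff N"
      by (rule isomorphic_factor[OF M N iso False]) (rule that, assumption+)
    then have top: "top_coeff M = t * top_coeff N" using False L by simp
    have sw: "\<not> (\<exists>j :: 'f. j\<^sup>2 = - 2)" 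
      if "M = N2_7 \<or> N = N2_7" using that j by blast
    show ?thesis
    proof (cases "lie_trace (lie_of N) = 0")
      case True
      then consider "lie_of N = G4" | "lie_of N = G5" using False by (cases "lie_of N") auto
      then show ?thesis
      proof cases
        case 1
        then have "t\<^sup>2 = 1" using t(3) L by simp
        then have "t = 1 \<or> t = - 1" by (simp add: power2_eq_1_iff)
        then show ?thesis
          using 1 L top inv(1) by (cases M; cases N) (auto simp: square_eigenvector_values)
      next
        case 2
        then have "t\<^sup>2 = 1" using t(3) L by simp
        then have "t = 1 \<or> t = - 1" by (simp add: power2_eq_1_iff)
        then show ?thesis using 2 L top by (cases M; cases N) auto
      qed
    next
      case nz: False
      then have "t = 1" using t(2) L by simp
      then have top: "top_coeff M = top_coeff N" using top by simp
      have c7: "\<not> square_witness (novikov_product (N2_5 (- (2/9)) :: 'f novikov_name))"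
        if "M = N2_7 \<or> N = N2_7"
        using square_witness_N2_5 sw[OF that] by auto
      have third: "3 * a = - (2/3) \<longleftrightarrow> a = - (2/9)" "- (2/3) = 3 * a \<longleftrightarrow> a = - (2/9)" for a :: 'f
      proof -
        have "- (2/3) = 3 * (- (2/9) :: 'f)" by simp
        then show "3 * a = - (2/3) \<longleftrightarrow> a = - (2/9)" "- (2/3) = 3 * a \<longleftrightarrow> a = - (2/9)"
          by (metis mult_left_cancel zero_neq_numeral)+
      qed
      have "M = N"
        using L nz False M N top inv(1-4) c7
        by (cases M; cases N) (auto simp: square_eigenvector_values square_eigenvector_values(7)[simplified]
            inner_product_values right_scalar_values square_witness_N2_7 third)
      then show ?thesis by simp
    qed
  qed
qed

subsection \<open>The isomorphisms that do exist\<close>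

lemma isomorphic_frameI:
  fixes M N :: "'f::field_char_0 novikov_name"
  defines "m \<equiv> novikov_product M" and "t \<equiv> table_product (novikov_table N)"
  assumes "frame b1 b2 b3"
    and "m b1 b1 = frame_map b1 b2 b3 (t e1 e1)" "m b1 b2 = frame_map b1 b2 b3 (t e1 e2)"
    "m b1 b3 = frame_map b1 b2 b3 (t e1 e3)" "m b2 b1 = frame_map b1 b2 b3 (t e2 e1)"
    "m b2 b2 = frame_map b1 b2 b3 (t e2 e2)" "m b2 b3 = frame_map b1 b2 b3 (t e2 e3)"
    "m b3 b1 = frame_map b1 b2 b3 (t e3 e1)" "m b3 b2 = frame_map b1 b2 b3 (t e3 e2)"
    "m b3 b3 = frame_map b1 b2 b3 (t e3 e3)"
  shows "isomorphic M N"
  using iso3_frameI[OF novikov_product_is_novikov assms(3-)[unfolded m_def t_def]]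
  unfolding isomorphic_def novikov_product_def[of N] .

lemma N4_1_uminus: "isomorphic (N4_1 a) (N4_1 (- a))" for a :: "'f::field_char_0"
  by (rule isomorphic_frameI[where ?b1.0 = "- e1" and ?b2.0 = e2 and ?b3.0 = "- e3"];
      simp add: frameI novikov_product_def table_simps)

lemma N5_1_uminus: "isomorphic (N5_1 a) (N5_1 (- a))" for a :: "'f::field_char_0"
  by (rule isomorphic_frameI[where ?b1.0 = "- e1" and ?b2.0 = e2 and ?b3.0 = "- e3"];
      simp add: frameI novikov_product_def table_simps)

lemma N5_1_N4_1: "isomorphic (N5_1 a) (N4_1 (\<i> * a))"
proof -
  have "\<i> * a * \<i> = (\<i> * \<i>) * a" by (simp only: ac_simps)
  then have ii: "\<i> * a * \<i> = - a" by simp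
  show ?thesis
    by (rule isomorphic_frameI[where ?b1.0 = "\<i> *s e1" and ?b2.0 = e2 and ?b3.0 = "\<i> *s e3"];
        simp add: frameI novikov_product_def table_simps ii)
qed

text \<open>With \<open>f\<^sub>1 = 2 e\<^sub>2 - 3 e\<^sub>3\<close>, \<open>f\<^sub>2 = 3 e\<^sub>3 - e\<^sub>2\<close> and \<open>e = e\<^sub>1 - 2/9 f\<^sub>1\<close> in either algebra,
  \<open>e e = - 2/3 e + \<omega> f\<^sub>2\<close> and \<open>f\<^sub>1 f\<^sub>1 = 3 f\<^sub>2\<close>, where \<open>\<omega>\<close> is \<open>1/9\<close> for \<open>N2_7\<close> and \<open>- 2/9\<close> for \<open>N2_5 (- 2/9)\<close>.
  Hence \<open>k f\<^sub>1\<close>, \<open>k\<^sup>2 f\<^sub>2\<close> is the required change of eigenvectors if \<open>k\<^sup>2 = - 1/2\<close>.\<close>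

lemma N2_7_N2_5:
  fixes k :: "'f::field_char_0"
  assumes k: "2 * (k * k) = - 1"
  shows "isomorphic (N2_7 :: 'f novikov_name) (N2_5 (- 2/9))"
proof -
  have kk: "k * k = - 1/2" using k by (metis nonzero_mult_div_cancel_left zero_neq_numeral)
  have k3: "k * (k * x) = - x/2" for x using kk by (simp add: mult.assoc[symmetric])
  have "k \<noteq> 0" using k by auto
  let ?b1 = "vector [1, 4/9 * k - 4/9, 2/3 - 2/3 * k] :: 'f ^ 3"
  let ?b2 = "vector [0, 2 * k + 1/2, - 3 * k - 3/2] :: 'f ^ 3"
  let ?b3 = "vector [0, 2/3 * k + 1/3, - k - 1] :: 'f ^ 3"
  have "(2 * k + 1/2) * (- k - 1) = (- 3 * k - 3/2) * (2/3 * k + 1/3) - k/2"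
    by (simp add: field_simps)
  then have fr: "frame ?b1 ?b2 ?b3" using \<open>k \<noteq> 0\<close> by (intro frameI) simp_all
  show ?thesis
    by (rule isomorphic_frameI[OF fr]; simp add: novikov_product_def table_simps; simp add: field_simps kk k3)
qed

theorem mainTheorem1:
  shows
    "(\<forall>(scale :: real \<Rightarrow> 'a::ab_group_add \<Rightarrow> 'a) mul.
        novikov_algebra scale mul \<and> vector_space.dim scale (UNIV :: 'a set) = 3 \<and>
        (\<exists>x y. commutator mul x y \<noteq> 0) \<longrightarrow>
        (\<exists>N. listed N \<and> algebra_iso scale mul (*s) (novikov_product N)))
   \<and> (\<forall>(scale :: complex \<Rightarrow> 'b::ab_group_add \<Rightarrow> 'b) mul.
        novikov_algebra scale mul \<and> vector_space.dim scale (UNIV :: 'b set) = 3 \<and>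
        (\<exists>x y. commutator mul x y \<noteq> 0) \<longrightarrow>
        (\<exists>N. listed N \<and> algebra_iso scale mul (*s) (novikov_product N)))
   \<and> (\<forall>N :: real novikov_name. listed N \<longrightarrow>
        novikov_algebra (*s) (novikov_product N) \<and>
        commutator (novikov_product N) = lie_bracket (lie_of N))
   \<and> (\<forall>N :: complex novikov_name. listed N \<longrightarrow>
        novikov_algebra (*s) (novikov_product N) \<and>
        commutator (novikov_product N) = lie_bracket (lie_of N))
   \<and> (\<forall>M N :: real novikov_name. listed M \<and> listed N \<and> M \<noteq> N \<longrightarrow>
        (isomorphic M N \<longleftrightarrow>
          (\<exists>a. M = N4_1 a \<and> N = N4_1 (- a)) \<or> (\<exists>a. M = N5_1 a \<and> N = N5_1 (- a))))
   \<and> (\<forall>a :: complex. isomorphic (N5_1 a) (N4_1 (\<i> * a)))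
   \<and> isomorphic (N2_7 :: complex novikov_name) (N2_5 (- 2/9))
   \<and> (\<forall>M N :: complex novikov_name.
        listed M \<and> listed N \<and> M \<noteq> N \<and>
        M \<notin> insert N2_7 (range N5_1) \<and> N \<notin> insert N2_7 (range N5_1) \<longrightarrow>
        (isomorphic M N \<longleftrightarrow> (\<exists>a. M = N4_1 a \<and> N = N4_1 (- a))))"
proof (intro conjI allI impI; (elim conjE)?)
  fix scale :: "real \<Rightarrow> 'a \<Rightarrow> 'a" and mul
  assume A: "novikov_algebra scale mul" "vector_space.dim scale (UNIV :: 'a set) = 3"
    "\<exists>x y. commutator mul x y \<noteq> 0"
  show "\<exists>N. listed N \<and> algebra_iso scale mul (*s) (novikov_product N)"
  proof (rule classification_complete[OF A])
    show "\<exists>t. y = t\<^sup>2 \<or> y = - t\<^sup>2" for y :: real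
      by (rule exI[of _ "sqrt \<bar>y\<bar>"]) auto
    show "\<exists>j :: real. j\<^sup>2 = 2" by (rule exI[of _ "sqrt 2"]) simp
  qed
next
  fix scale :: "complex \<Rightarrow> 'b \<Rightarrow> 'b" and mul
  assume A: "novikov_algebra scale mul" "vector_space.dim scale (UNIV :: 'b set) = 3"
    "\<exists>x y. commutator mul x y \<noteq> 0"
  show "\<exists>N. listed N \<and> algebra_iso scale mul (*s) (novikov_product N)"
  proof (rule classification_complete[OF A])
    show "\<exists>t. y = t\<^sup>2 \<or> y = - t\<^sup>2" for y :: complex
      by (rule exI[of _ "csqrt y"]) simp
    show "\<exists>j :: complex. j\<^sup>2 = 2" by (rule exI[of _ "csqrt 2"], rule power2_csqrt)
  qed
next
  fix N :: "real novikov_name" assume "listed N"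
  then show "novikov3 (novikov_product N)" "commutator (novikov_product N) = lie_bracket (lie_of N)"
    by (simp_all add: novikov_product_is_novikov commutator_novikov_product)
next
  fix N :: "complex novikov_name" assume "listed N"
  then show "novikov3 (novikov_product N)" "commutator (novikov_product N) = lie_bracket (lie_of N)"
    by (simp_all add: novikov_product_is_novikov commutator_novikov_product)
next
  fix M N :: "real novikov_name" assume MN: "listed M" "listed N" "M \<noteq> N"
  have "i\<^sup>2 \<noteq> - 1" "i\<^sup>2 \<noteq> - 2" for i :: real
    using zero_le_power2[of i] by linarith+
  then show "isomorphic M N \<longleftrightarrow>
      (\<exists>a. M = N4_1 a \<and> N = N4_1 (- a)) \<or> (\<exists>a. M = N5_1 a \<and> N = N5_1 (- a))"
    using isomorphic_classification[OF MN(1,2)] MN(3) N4_1_uminus N5_1_uminus by blast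
next
  show "isomorphic (N5_1 a) (N4_1 (\<i> * a))" for a by (rule N5_1_N4_1)
next
  have "2 * ((csqrt (- 1/2)) * csqrt (- 1/2)) = - 1"
    by (simp only: power2_eq_square[symmetric] power2_csqrt) simp
  then show "isomorphic (N2_7 :: complex novikov_name) (N2_5 (- 2/9))" by (rule N2_7_N2_5)
next
  fix M N :: "complex novikov_name"
  assume MN: "listed M" "listed N" "M \<noteq> N"
    "M \<notin> insert N2_7 (range N5_1)" "N \<notin> insert N2_7 (range N5_1)"
  have "lie_of M \<noteq> G5" "lie_of N \<noteq> G5" using MN(4,5) by (cases M; cases N; simp)+
  then show "isomorphic M N \<longleftrightarrow> (\<exists>a. M = N4_1 a \<and> N = N4_1 (- a))"
    using isomorphic_classification[OF MN(1,2)] MN(3-5) N4_1_uminus by blast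
qed

end
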